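(* Let $\mathbf X_M=\sum_{n\ge 1}\delta_{(X_n,M_n)}$ be a stationary simple marked point process on $\mathbb R^d$ with marks in a Polish space $\mathbb M$, with intensity $0<\lambda<\infty$ and Palm mark distribution $P_M^{\mathbf o}$. Let $\{W_k\}$ be an arbitrary convex averaging sequence in $\mathbb R^d$. Let $w:\mathbb R\to\mathbb R$ be a non-negative, symmetric, Borel-measurable function with $w(x)\to w(0)=1$ as $x\to 0$, bounded by some $m_w<\infty$, and vanishing outside $[-r_w,r_w]$ for some $r_w\in(0,\infty)$. Let $\{b_k\}$ be a sequence of positive numbers such that, for all $k$, $$b_k\le \frac{\varrho(W_k)}{2\,d\,r_w\,|W_k|^{1/d}},$$ and, as $k\to\infty$, $$b_k\to 0,\qquad b_k^{d}\,|W_k|\to\infty,\qquad b_k^{3d/2}\,|W_k|\to 0 .$$ Suppose that for some $\delta>0$ $$\mathbb E\,\mathbf X_M([0,1]^d\times\mathbb M)^{4+\delta}<\infty\quad\text{and}\quad \int_1^\infty r^{d-1}\bigl(\beta^*_{\mathbf X_M}(r)\bigr)^{\delta/(4+\delta)}\,\mathrm dr<\infty ,$$ where $\beta^*_{\mathbf X_M}$ is a $\beta$-mixing rate of $\mathbf X_M$ (as defined in the context). Let $C_1,\dots,C_\ell\in\mathcal B(\mathbb M)$ and $i,j\in\{1,\dots,\ell\}$. Define $$(\widehat\sigma^{(3)}_{ij})_k=\frac1{|W_k|}\sum_{p\ge1}\mathbf 1_{W_k}(X_p)\bigl(\mathbf 1_{C_i\cap C_j}(M_p)-P_M^{\mathbf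 o}(C_i)P_M^{\mathbf o}(C_j)\bigr)$$ $$\qquad+\sum^{\neq}_{p,q\ge1}\frac{\mathbf 1_{W_k}(X_p)\mathbf 1_{W_k}(X_q)\bigl(\mathbf 1_{C_i}(M_p)-P_M^{\mathbf o}(C_i)\bigr)\bigl(\mathbf 1_{C_j}(M_q)-P_M^{\mathbf o}(C_j)\bigr)}{|(W_k-X_p)\cap(W_k-X_q)|}\;w\!\left(\frac{\|X_q-X_p\|}{b_k|W_k|^{1/d}}\right).$$ Then $$\mathbb E\bigl(\sigma_{ij}-(\widehat\sigma^{(3)}_{ij})_k\bigr)^2\longrightarrow 0\qquad(k\to\infty),$$ where $\sigma_{ij}=\lim_{k\to\infty}\mathbb E\,Y_k(C_i)Y_k(C_j)$ is the asymptotic covariance (which exists under these hypotheses).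
   Context: A marked point process (MPP) $\mathbf X_M=\sum_{n\ge1}\delta_{(X_n,M_n)}$ is a random counting measure on $\mathbb R^d\times\mathbb M$ ($\mathbb M$ Polish with Borel $\sigma$-algebra $\mathcal B(\mathbb M)$) having a.s. finitely many atoms in $B\times\mathbb M$ for bounded $B$. It is simple if all locations $X_n$ are distinct, regardless of their marks. It is stationary if $\mathbf X_M$ and $\sum_n\delta_{(X_n-x,M_n)}$ have the same distribution for all $x\in\mathbb R^d$. Its intensity is $\lambda=\mathbb E\,\mathbf X_M([0,1)^d\times\mathbb M)$, and its Palm mark distribution is $P_M^{\mathbf o}(C)=\lambda^{-1}\mathbb E\,\mathbf X_M([0,1)^d\times C)$, $C\in\mathcal B(\mathbb M)$. $|\cdot|$ is $d$-dimensional Lebesgue measure, $\|\cdot\|$ the Euclidean norm, and $B(x,r)$ the closed ball. $\sum^{\neq}_{p,q\ge1}$ is the sum over pairs of distinct indices. A convex averaging sequence is an increasing sequence $\{W_k\}$ of convex compact subsets of $\mathbb R^d$ such that $\varrho(W_k)=\sup\{r>0: B(x,r)\subset W_k\text{ for some }x\in W_k\}\to\infty$. For $C\in\mathcal B(\mathbb M)$, $Y_k(C)=|W_k|^{-1/2}\sum_{n\ge1}\mathbf 1_{W_k}(X_n)\bigl(\mathbf 1_C(M_n)-P_M^{\mathbf o}(C)\bigr)$. Mixing: for $B\in\mathcal B(\mathbb R^d)$ let $\mathcal A_{\mathbf X_M}(B)$ be the $\sigma$-algebra generated by the restriction of $\mathbf X_M$ to $B\times\mathbb M$. For sub-$\sigma$-algebras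 $\mathcal A,\mathcal A'$ let $\beta(\mathcal A,\mathcal A')=\frac12\sup\sum_{i,j}|\mathbb P(A_i\cap A_j')-\mathbb P(A_i)\mathbb P(A_j')|$, the supremum being over all finite partitions $\{A_i\}$, $\{A_j'\}$ of $\Omega$ with $A_i\in\mathcal A$, $A'_j\in\mathcal A'$. Put $K_a=[-a,a]^d$ and $K_a^c=\mathbb R^d\setminus K_a$. A $\beta$-mixing rate $\beta^*_{\mathbf X_M}:[\frac12,\infty)\to[0,\infty)$ is a non-increasing function such that, for some constant $c_0\ge1$, $\beta(\mathcal A_{\mathbf X_M}(K_a),\mathcal A_{\mathbf X_M}(K_{a+b}^c))\le\beta^*_{\mathbf X_M}(b)$ whenever $\frac12\le a\le b/c_0$. *)

theory Defs
  imports "HOL-Probability.Probability"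
begin

section \<open>Marked point processes\<close>

text \<open>
  The atoms of a marked point process at \<open>\<omega>\<close> are the pairs \<open>(X n \<omega>, M n \<omega>)\<close> with \<open>n \<in> I \<omega>\<close>.
  The index set \<open>I \<omega>\<close> allows for a finite, random total number of atoms.  The enumeration is an
  arbitrary labelling: only the counting measure below has to depend measurably on \<open>\<omega>\<close>.
  As the image of the counting measure on \<open>I \<omega>\<close>, it is the sum of the Dirac measures at the atoms.
\<close>

definition mpp ::
  "('w \<Rightarrow> nat set) \<Rightarrow> (nat \<Rightarrow> 'w \<Rightarrow> real ^ 'd) \<Rightarrow> (nat \<Rightarrow> 'w \<Rightarrow> 'm::polish_space) \<Rightarrow>
   'w \<Rightarrow> ((real ^ 'd) \<times> 'm) measure" where
  "mpp I X M \<omega> = distr (count_space (I \<omega>)) borel (\<lambda>n. (X n \<omega>, M n \<omega>))"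

lemma emeasure_mpp:
  assumes "A \<in> sets borel"
  shows "emeasure (mpp I X M \<omega>) A = emeasure (count_space UNIV) {n \<in> I \<omega>. (X n \<omega>, M n \<omega>) \<in> A}"
proof -
  have "(\<lambda>n. (X n \<omega>, M n \<omega>)) -` A \<inter> I \<omega> = {n \<in> I \<omega>. (X n \<omega>, M n \<omega>) \<in> A}" by auto
  then show ?thesis
    unfolding mpp_def using assms
    by (subst emeasure_distr) (auto simp: emeasure_count_space)
qed

text \<open>
  The measurable space of all measures on \<open>K\<close>, generated by the evaluations \<open>\<mu> \<mapsto> \<mu> A\<close>
  (as for \<^const>\<open>subprob_algebra\<close>, without a bound on the total mass).
\<close>

definition measure_algebra :: "'b measure \<Rightarrow> 'b measure measure" where
  "measure_algebra K =
     (SUP A \<in> sets K. vimage_algebra {\<mu>. sets \<mu> = sets K} (\<lambda>\<mu>. emeasure \<mu> A) borel)"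

lemma space_measure_algebra: "space (measure_algebra K) = {\<mu>. sets \<mu> = sets K}"
  by (auto simp: measure_algebra_def space_Sup_eq_UN)

definition marked_point_process ::
  "'w measure \<Rightarrow> ('w \<Rightarrow> nat set) \<Rightarrow> (nat \<Rightarrow> 'w \<Rightarrow> real ^ 'd) \<Rightarrow> (nat \<Rightarrow> 'w \<Rightarrow> 'm::polish_space) \<Rightarrow> bool" where
  "marked_point_process P I X M \<longleftrightarrow>
     mpp I X M \<in> measurable P (measure_algebra borel) \<and>
     (AE \<omega> in P. \<forall>B. bounded B \<longrightarrow> finite {n \<in> I \<omega>. X n \<omega> \<in> B})"

definition simple_mpp ::
  "'w measure \<Rightarrow> ('w \<Rightarrow> nat set) \<Rightarrow> (nat \<Rightarrow> 'w \<Rightarrow> real ^ 'd) \<Rightarrow> bool" where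
  "simple_mpp P I X \<longleftrightarrow> (AE \<omega> in P. inj_on (\<lambda>n. X n \<omega>) (I \<omega>))"

definition stationary_mpp ::
  "'w measure \<Rightarrow> ('w \<Rightarrow> nat set) \<Rightarrow> (nat \<Rightarrow> 'w \<Rightarrow> real ^ 'd) \<Rightarrow> (nat \<Rightarrow> 'w \<Rightarrow> 'm::polish_space) \<Rightarrow> bool" where
  "stationary_mpp P I X M \<longleftrightarrow>
     (\<forall>x. distr P (measure_algebra borel) (mpp I X M) =
          distr P (measure_algebra borel) (mpp I (\<lambda>n \<omega>. X n \<omega> - x) M))"

definition unit_cube :: "(real ^ 'd) set" where
  "unit_cube = {x. \<forall>i. 0 \<le> x $ i \<and> x $ i < 1}"

definition closed_unit_cube :: "(real ^ 'd) set" where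
  "closed_unit_cube = {x. \<forall>i. 0 \<le> x $ i \<and> x $ i \<le> 1}"

definition intensity ::
  "'w measure \<Rightarrow> ('w \<Rightarrow> nat set) \<Rightarrow> (nat \<Rightarrow> 'w \<Rightarrow> real ^ 'd) \<Rightarrow> (nat \<Rightarrow> 'w \<Rightarrow> 'm::polish_space) \<Rightarrow> ennreal" where
  "intensity P I X M = (\<integral>\<^sup>+ \<omega>. emeasure (mpp I X M \<omega>) (unit_cube \<times> UNIV) \<partial>P)"

definition palm_mark ::
  "'w measure \<Rightarrow> ('w \<Rightarrow> nat set) \<Rightarrow> (nat \<Rightarrow> 'w \<Rightarrow> real ^ 'd) \<Rightarrow> (nat \<Rightarrow> 'w \<Rightarrow> 'm::polish_space) \<Rightarrow>
   'm set \<Rightarrow> real" where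
  "palm_mark P I X M C =
     enn2real ((\<integral>\<^sup>+ \<omega>. emeasure (mpp I X M \<omega>) (unit_cube \<times> C) \<partial>P) / intensity P I X M)"

section \<open>Convex averaging sequences\<close>

text \<open>\<open>Sup\<close> is only meaningful here for bounded sets with nonempty interior.\<close>

definition inradius :: "(real ^ 'd) set \<Rightarrow> real" where
  "inradius W = Sup {r. r > 0 \<and> (\<exists>x\<in>W. cball x r \<subseteq> W)}"

definition convex_averaging_sequence :: "(nat \<Rightarrow> (real ^ 'd) set) \<Rightarrow> bool" where
  "convex_averaging_sequence W \<longleftrightarrow>
     incseq W \<and> (\<forall>k. convex (W k) \<and> compact (W k)) \<and>
     filterlim (\<lambda>k. inradius (W k)) at_top sequentially"

section \<open>Absolute regularity\<close>

definition sigma_algebra_on ::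
  "'w measure \<Rightarrow> ('w \<Rightarrow> nat set) \<Rightarrow> (nat \<Rightarrow> 'w \<Rightarrow> real ^ 'd) \<Rightarrow> (nat \<Rightarrow> 'w \<Rightarrow> 'm::polish_space) \<Rightarrow>
   (real ^ 'd) set \<Rightarrow> 'w set set" where
  "sigma_algebra_on P I X M B =
     sets (vimage_algebra (space P) (mpp (\<lambda>\<omega>. {n \<in> I \<omega>. X n \<omega> \<in> B}) X M) (measure_algebra borel))"

definition beta_coefficient :: "'w measure \<Rightarrow> 'w set set \<Rightarrow> 'w set set \<Rightarrow> real" where
  "beta_coefficient P \<A> \<A>' = (1/2) *
     Sup {(\<Sum>U\<in>\<U>. \<Sum>V\<in>\<V>. \<bar>measure P (U \<inter> V) - measure P U * measure P V\<bar>) | \<U> \<V>.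
            finite \<U> \<and> \<U> \<subseteq> \<A> \<and> partition_on (space P) \<U> \<and>
            finite \<V> \<and> \<V> \<subseteq> \<A>' \<and> partition_on (space P) \<V>}"

definition cube :: "real \<Rightarrow> (real ^ 'd) set" where
  "cube a = {x. \<forall>i. - a \<le> x $ i \<and> x $ i \<le> a}"

text \<open>Only the values of \<open>\<beta>\<close> on \<open>[1/2, \<infinity>)\<close> matter.\<close>

definition beta_mixing_rate ::
  "'w measure \<Rightarrow> ('w \<Rightarrow> nat set) \<Rightarrow> (nat \<Rightarrow> 'w \<Rightarrow> real ^ 'd) \<Rightarrow> (nat \<Rightarrow> 'w \<Rightarrow> 'm::polish_space) \<Rightarrow>
   (real \<Rightarrow> real) \<Rightarrow> bool" where
  "beta_mixing_rate P I X M \<beta> \<longleftrightarrow>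
     (\<forall>r\<ge>1/2. 0 \<le> \<beta> r) \<and> antimono_on {1/2..} \<beta> \<and>
     (\<exists>c0\<ge>1. \<forall>a b. 1/2 \<le> a \<and> a \<le> b / c0 \<longrightarrow>
        beta_coefficient P (sigma_algebra_on P I X M (cube a))
          (sigma_algebra_on P I X M (- cube (a + b))) \<le> \<beta> b)"

section \<open>Centred mark counts and the covariance estimator\<close>

definition Y_stat ::
  "'w measure \<Rightarrow> ('w \<Rightarrow> nat set) \<Rightarrow> (nat \<Rightarrow> 'w \<Rightarrow> real ^ 'd) \<Rightarrow> (nat \<Rightarrow> 'w \<Rightarrow> 'm::polish_space) \<Rightarrow>
   (real ^ 'd) set \<Rightarrow> 'm set \<Rightarrow> 'w \<Rightarrow> real" where
  "Y_stat P I X M W C \<omega> =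
     (\<Sum>\<^sub>\<infinity>n\<in>I \<omega>. indicator W (X n \<omega>) * (indicator C (M n \<omega>) - palm_mark P I X M C))
       / sqrt (measure lborel W)"

definition sigma_hat ::
  "'w measure \<Rightarrow> ('w \<Rightarrow> nat set) \<Rightarrow> (nat \<Rightarrow> 'w \<Rightarrow> real ^ 'd) \<Rightarrow> (nat \<Rightarrow> 'w \<Rightarrow> 'm::polish_space) \<Rightarrow>
   (real \<Rightarrow> real) \<Rightarrow> real \<Rightarrow> (real ^ 'd) set \<Rightarrow> 'm set \<Rightarrow> 'm set \<Rightarrow> 'w \<Rightarrow> real" where
  "sigma_hat P I X M w b W C D \<omega> =
     (1 / measure lborel W) *
       (\<Sum>\<^sub>\<infinity>p\<in>I \<omega>. indicator W (X p \<omega>) *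
          (indicator (C \<inter> D) (M p \<omega>) - palm_mark P I X M C * palm_mark P I X M D))
     + (\<Sum>\<^sub>\<infinity>(p, q)\<in>{(p, q). p \<in> I \<omega> \<and> q \<in> I \<omega> \<and> p \<noteq> q}.
          indicator W (X p \<omega>) * indicator W (X q \<omega>)
          * (indicator C (M p \<omega>) - palm_mark P I X M C)
          * (indicator D (M q \<omega>) - palm_mark P I X M D)
          / measure lborel ((\<lambda>y. y - X p \<omega>) ` W \<inter> (\<lambda>y. y - X q \<omega>) ` W)
          * w (norm (X q \<omega> - X p \<omega>) / (b * measure lborel W powr (1 / real CARD('d)))))"

end

theory Submission
  imports Defs
begin

text \<open>
  Let \<open>f\<^sub>i = 1\<^bsub>C\<^sub>i\<^esub> - P\<^sub>M(C\<^sub>i)\<close> be the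
  centred mark indicators, \<open>a\<^sub>k = b\<^sub>k |W\<^sub>k|\<^bsup>1/d\<^esup>\<close>,
  and \<open>h\<^sub>k(u) = |W\<^sub>k| w(|u| / a\<^sub>k) / |W\<^sub>k \<inter> (W\<^sub>k -
  u)|\<close>. Since \<open>h\<^sub>k(0) = 1\<close>, the double sum over distinct points can be
  completed by its diagonal: the estimator equals \<open>|W\<^sub>k|\<^sup>-\<^sup>1 \<Sum>
  f\<^sub>i(M\<^sub>p) f\<^sub>j(M\<^sub>q) h\<^sub>k(X\<^sub>q - X\<^sub>p)\<close>, summed
  over all pairs of points of the window, plus \<open>|W\<^sub>k|\<^sup>-\<^sup>1\<close> times
  a linear combination of the two centred mark sums (\<open>sigma_hat_eq_pair_sum\<close>). The
  same pair sum with the constant kernel \<open>1\<close> is \<open>|W\<^sub>k|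
  Y\<^sub>k(C\<^sub>i) Y\<^sub>k(C\<^sub>j)\<close>. Everything follows from one statement about
  the mean and one about the variance of pair sums with bounded kernels.

  Mean (\<open>mean_limit\<close>). Cut space into unit cubes. For points in two cubes at large
  distance \<open>n\<close>, the expectation of the pair sum is at most a constant times
  \<open>\<beta>(n/3)\<^bsup>\<delta>/(4+\<delta>)\<^esup>\<close>: it vanishes if the two cubes
  are filled by independent copies of the process, because marks are centred at every location
  (\<open>centred_mark_dev\<close>), and absolute regularity bounds the difference between the
  joint law and the product law on all functionals of the two restrictions, not only on products
  (\<open>beta_mixing_integral_diff\<close>). This matters because the kernel couples the
  locations. The bound is summable over the lattice, so stationarity and dominated convergence
  give \<open>|W\<^sub>k|\<^sup>-\<^sup>1 E(pair sum) \<rightarrow> \<Sum>\<^sub>u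
  \<kappa>(u)\<close> for every bounded kernel sequence that tends to \<open>1\<close>
  pointwise; convexity makes the boundary cubes negligible. Both the constant kernel and
  \<open>h\<^sub>k\<close> qualify, so the estimator is asymptotically unbiased, and the mark
  sums have second moments of order \<open>|W\<^sub>k|\<close>, so that the remainder of the
  estimator tends to \<open>0\<close> in mean square.

  Variance (\<open>variance_bound\<close>). If the kernel has range \<open>A\<close>, the pairs
  with first point in a given unit cube form a functional of the process in a block of side
  \<open>2A + 1\<close>, of size \<open>A\<^bsup>d\<^esup>\<close> in \<open>L\<^bsup>2 +
  \<delta>/2\<^esup>\<close>. The covariance of two such functionals is bounded by
  \<open>A\<^bsup>2d\<^esup>\<close>, and decays with the mixing rate once the blocks are
  separated by more than their size. Summation over pairs of cubes gives a variance of order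
  \<open>|W\<^sub>k| A\<^bsup>3d\<^esup>\<close>. After division by
  \<open>|W\<^sub>k|\<^sup>2\<close>, with \<open>A\<close> of order \<open>a\<^sub>k\<close>,
  this is \<open>a\<^sub>k\<^bsup>3d\<^esup> / |W\<^sub>k| = (b\<^sub>k\<^bsup>3d/2\<^esup>
  |W\<^sub>k|)\<^sup>2\<close>, which tends to \<open>0\<close> by assumption.
\<close>

section \<open>Integrals under laws that are close in total variation\<close>

lemma nn_integral_layer_cake:
  fixes G :: "'a \<Rightarrow> real"
  assumes "prob_space N" and G[measurable]: "G \<in> borel_measurable N"
  shows "(\<integral>\<^sup>+ x. ennreal (G x) \<partial>N) = (\<integral>\<^sup>+ t. emeasure N {x \<in> space N. 0 \<le> t \<and> t < G x} \<partial>lborel)"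
proof -
  interpret prob_space N by fact
  interpret pair_sigma_finite N lborel ..
  have "(\<integral>\<^sup>+ x. ennreal (G x) \<partial>N) = (\<integral>\<^sup>+ x. (\<integral>\<^sup>+ t. indicator {0..<G x} t \<partial>lborel) \<partial>N)"
  proof (intro nn_integral_cong)
    fix x show "ennreal (G x) = (\<integral>\<^sup>+ t. indicator {0..<G x} t \<partial>lborel)"
      by (cases "0 \<le> G x") (auto simp: ennreal_neg)
  qed
  also have "\<dots> = (\<integral>\<^sup>+ x. (\<integral>\<^sup>+ t. indicator {p \<in> space (N \<Otimes>\<^sub>M lborel). 0 \<le> snd p \<and> snd p < G (fst p)} (x, t) \<partial>lborel) \<partial>N)"
    by (intro nn_integral_cong) (auto simp: indicator_def space_pair_measure)
  also have "\<dots> = (\<integral>\<^sup>+ t. (\<integral>\<^sup>+ x. indicator {p \<in> space (N \<Otimes>\<^sub>M lborel). 0 \<le> snd p \<and> snd p < G (fst p)} (x, t) \<partial>N) \<partial>lborel)"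
    by (rule Fubini'[symmetric]) simp
  also have "\<dots> = (\<integral>\<^sup>+ t. (\<integral>\<^sup>+ x. indicator {x \<in> space N. 0 \<le> t \<and> t < G x} x \<partial>N) \<partial>lborel)"
    by (intro nn_integral_cong) (auto simp: indicator_def space_pair_measure)
  finally show ?thesis by simp
qed

text \<open>
  The level sets \<open>{x. t < G x}\<close> are compared one by one and the result is
  integrated over \<open>t\<close>; only the levels in \<open>[0, R]\<close> can contribute to
  the difference.
\<close>

lemma nn_integral_bounded_le_total_variation:
  fixes G :: "'a \<Rightarrow> real"
  assumes J: "prob_space J" and N: "prob_space N" and sets: "sets J = sets N"
    and G: "G \<in> borel_measurable N"
    and tv: "\<And>E. E \<in> sets N \<Longrightarrow> measure J E \<le> measure N E + \<tau>" and "0 \<le> \<tau>" "0 \<le> R"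
    and R: "\<And>x. G x \<le> R"
  shows "(\<integral>\<^sup>+ x. ennreal (G x) \<partial>J) \<le> (\<integral>\<^sup>+ x. ennreal (G x) \<partial>N) + ennreal (R * \<tau>)"
proof -
  interpret J: prob_space J by fact
  interpret N: prob_space N by fact
  note [measurable] = G
  have [measurable_cong]: "sets J = sets N" by fact
  have sp: "space J = space N" using sets by (rule sets_eq_imp_space_eq)
  have GJ: "G \<in> borel_measurable J" by simp
  interpret NL: pair_sigma_finite N lborel ..
  have m: "(\<lambda>t. emeasure N {x \<in> space N. 0 \<le> t \<and> t < G x}) \<in> borel_measurable lborel"
    by measurable
  have "(\<integral>\<^sup>+ x. ennreal (G x) \<partial>J) = (\<integral>\<^sup>+ t. emeasure J {x \<in> space N. 0 \<le> t \<and> t < G x} \<partial>lborel)"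
    using nn_integral_layer_cake[OF J GJ] by (simp add: sp)
  also have "\<dots> \<le> (\<integral>\<^sup>+ t. emeasure N {x \<in> space N. 0 \<le> t \<and> t < G x} + ennreal \<tau> * indicator {0..R} t \<partial>lborel)"
  proof (intro nn_integral_mono)
    fix t :: real
    show "emeasure J {x \<in> space N. 0 \<le> t \<and> t < G x}
      \<le> emeasure N {x \<in> space N. 0 \<le> t \<and> t < G x} + ennreal \<tau> * indicator {0..R} t"
    proof (cases "0 \<le> t \<and> t \<le> R")
      case True
      have "measure J {x \<in> space N. 0 \<le> t \<and> t < G x} \<le> measure N {x \<in> space N. 0 \<le> t \<and> t < G x} + \<tau>"
        by (rule tv) measurable
      then show ?thesis
        using True \<open>0 \<le> \<tau>\<close>
        by (simp add: J.emeasure_eq_measure N.emeasure_eq_measure flip: ennreal_plus)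
    next
      case False
      then have "\<not> (0 \<le> t \<and> t < G x)" for x using R[of x] by linarith
      then have "{x \<in> space N. 0 \<le> t \<and> t < G x} = {}" by blast
      then show ?thesis by (simp only: emeasure_empty zero_le)
    qed
  qed
  also have "\<dots> = (\<integral>\<^sup>+ t. emeasure N {x \<in> space N. 0 \<le> t \<and> t < G x} \<partial>lborel) + (\<integral>\<^sup>+ t. ennreal \<tau> * indicator {0..R} t \<partial>lborel)"
    using m by (intro nn_integral_add) auto
  also have "\<dots> = (\<integral>\<^sup>+ x. ennreal (G x) \<partial>N) + ennreal (R * \<tau>)"
    using nn_integral_layer_cake[OF N G] \<open>0 \<le> \<tau>\<close> \<open>0 \<le> R\<close>
    by (simp add: nn_integral_cmult ennreal_mult' mult.commute)
  finally show ?thesis .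
qed

text \<open>
  Truncation of \<open>G\<close> at \<open>R\<close> costs \<open>R \<tau>\<close> by the
  bounded case, and the part above \<open>R\<close> is at most \<open>R\<^bsup>1-q\<^esup>
  G\<^bsup>q\<^esup>\<close>. The choice \<open>R = \<tau>\<^bsup>-1/q\<^esup>\<close> makes
  both errors of order \<open>\<tau>\<^bsup>1-1/q\<^esup>\<close>.
\<close>

lemma nn_integral_le_total_variation:
  fixes G :: "'a \<Rightarrow> real"
  assumes J: "prob_space J" and N: "prob_space N" and sets: "sets J = sets N"
    and G[measurable]: "G \<in> borel_measurable N" and "\<And>x. 0 \<le> G x"
    and tv: "\<And>E. E \<in> sets N \<Longrightarrow> measure J E \<le> measure N E + \<tau>" and "0 < \<tau>"
    and q: "1 < q" and "0 \<le> K" and K: "(\<integral>\<^sup>+ x. ennreal (G x powr q) \<partial>J) \<le> ennreal K"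
  shows "(\<integral>\<^sup>+ x. ennreal (G x) \<partial>J) \<le> (\<integral>\<^sup>+ x. ennreal (G x) \<partial>N) + ennreal ((1 + K) * \<tau> powr (1 - 1 / q))"
proof -
  have [measurable_cong]: "sets J = sets N" by fact
  define R where "R = \<tau> powr (- (1 / q))"
  have "0 < R" using \<open>0 < \<tau>\<close> by (simp add: R_def)
  have R1: "R * \<tau> = \<tau> powr (1 - 1 / q)"
    using \<open>0 < \<tau>\<close> by (simp add: R_def powr_diff powr_minus field_simps)
  have R2: "R powr (1 - q) = \<tau> powr (1 - 1 / q)"
  proof -
    have "- (1 / q) * (1 - q) = 1 - 1 / q" using q by (simp add: field_simps)
    then show ?thesis by (simp only: R_def powr_powr)
  qed
  have le: "G x \<le> min (G x) R + R powr (1 - q) * G x powr q" for x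
  proof (cases "G x \<le> R")
    case False
    then have "R powr (1 - q) * G x powr q \<ge> G x powr (1 - q) * G x powr q"
      using q \<open>0 < R\<close> by (intro mult_right_mono powr_mono2') auto
    also have "G x powr (1 - q) * G x powr q = G x"
      using False \<open>0 < R\<close> by (simp flip: powr_add)
    finally have "G x \<le> R powr (1 - q) * G x powr q" .
    moreover have "0 \<le> min (G x) R" using \<open>0 < R\<close> assms(5)[of x] by simp
    ultimately show ?thesis by linarith
  qed auto
  have "(\<integral>\<^sup>+ x. ennreal (G x) \<partial>J) \<le> (\<integral>\<^sup>+ x. ennreal (min (G x) R) + ennreal (R powr (1 - q)) * ennreal (G x powr q) \<partial>J)"
    using le assms(5) \<open>0 < R\<close>
    by (intro nn_integral_mono) (simp add: ennreal_leI flip: ennreal_plus ennreal_mult)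
  also have "\<dots> = (\<integral>\<^sup>+ x. ennreal (min (G x) R) \<partial>J) + ennreal (R powr (1 - q)) * (\<integral>\<^sup>+ x. ennreal (G x powr q) \<partial>J)"
    by (subst nn_integral_add) (auto simp: nn_integral_cmult)
  also have "\<dots> \<le> ((\<integral>\<^sup>+ x. ennreal (min (G x) R) \<partial>N) + ennreal (R * \<tau>)) + ennreal (R powr (1 - q)) * ennreal K"
    using \<open>0 < R\<close> \<open>0 < \<tau>\<close> 
    by (intro add_mono mult_left_mono nn_integral_bounded_le_total_variation[OF J N sets _ tv] K) auto
  also have "\<dots> \<le> ((\<integral>\<^sup>+ x. ennreal (G x) \<partial>N) + ennreal (R * \<tau>)) + ennreal (R powr (1 - q)) * ennreal K"
    by (intro add_mono nn_integral_mono) (auto intro: ennreal_leI)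
  also have "\<dots> = (\<integral>\<^sup>+ x. ennreal (G x) \<partial>N) + ennreal ((1 + K) * \<tau> powr (1 - 1 / q))"
    using \<open>0 \<le> K\<close> \<open>0 < R\<close> unfolding R2 R1
    by (simp add: distrib_right add.assoc mult.commute flip: ennreal_mult ennreal_plus)
  finally show ?thesis .
qed

lemma integrable_of_powr:
  fixes G :: "'a \<Rightarrow> real"
  assumes "prob_space N" and G[measurable]: "G \<in> borel_measurable N"
    and q: "1 \<le> q" and K: "(\<integral>\<^sup>+ x. ennreal (\<bar>G x\<bar> powr q) \<partial>N) \<le> ennreal K"
  shows "integrable N G"
proof -
  interpret prob_space N by fact
  have "integrable N (\<lambda>x. \<bar>G x\<bar> powr q)"
    using K by (intro integrableI_nonneg) (auto simp: le_less_trans[OF _ ennreal_less_top])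
  then have int: "integrable N (\<lambda>x. 1 + \<bar>G x\<bar> powr q)" by simp
  show ?thesis
  proof (rule Bochner_Integration.integrable_bound[OF int G], rule AE_I2)
    fix x
    have "\<bar>G x\<bar> \<le> 1 + \<bar>G x\<bar> powr q"
    proof (cases "\<bar>G x\<bar> \<le> 1")
      case False
      then have "\<bar>G x\<bar> powr 1 \<le> \<bar>G x\<bar> powr q" using q by (intro powr_mono) auto
      then show ?thesis by simp
    qed (simp add: add_increasing2)
    then show "norm (G x) \<le> norm (1 + \<bar>G x\<bar> powr q)" by simp
  qed
qed

text \<open>
  With \<open>q = (4 + \<delta>) / 4\<close> the exponent \<open>1 - 1/q\<close> is the
  \<open>\<delta> / (4 + \<delta>)\<close> of the mixing condition.
\<close>

lemma integral_diff_le_total_variation: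
  fixes G :: "'a \<Rightarrow> real"
  assumes J: "prob_space J" and N: "prob_space N" and sets: "sets J = sets N"
    and G[measurable]: "G \<in> borel_measurable N"
    and tv: "\<And>E. E \<in> sets N \<Longrightarrow> \<bar>measure J E - measure N E\<bar> \<le> \<tau>" and "0 \<le> \<tau>"
    and q: "1 < q" and "0 \<le> K"
    and KJ: "(\<integral>\<^sup>+ x. ennreal (\<bar>G x\<bar> powr q) \<partial>J) \<le> ennreal K"
    and KN: "(\<integral>\<^sup>+ x. ennreal (\<bar>G x\<bar> powr q) \<partial>N) \<le> ennreal K"
  shows "\<bar>(\<integral>x. G x \<partial>J) - (\<integral>x. G x \<partial>N)\<bar> \<le> 2 * (1 + K) * \<tau> powr (1 - 1 / q)"
proof (cases "\<tau> = 0")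
  case True
  interpret J: prob_space J by fact
  interpret N: prob_space N by fact
  have "J = N"
    using sets tv True by (intro measure_eqI) (auto simp: J.emeasure_eq_measure N.emeasure_eq_measure)
  then show ?thesis using True by simp
next
  case False
  then have "0 < \<tau>" using \<open>0 \<le> \<tau>\<close> by simp
  interpret J: prob_space J by fact
  interpret N: prob_space N by fact
  have [measurable_cong]: "sets J = sets N" by fact
  have GJ: "G \<in> borel_measurable J" by simp
  have iJ: "integrable J G" by (rule integrable_of_powr[OF J GJ _ KJ]) (use q in simp)
  have iN: "integrable N G" by (rule integrable_of_powr[OF N G _ KN]) (use q in simp)
  have le: "(\<integral>x. F x \<partial>J') \<le> (\<integral>x. F x \<partial>N') + (1 + K) * \<tau> powr (1 - 1 / q)"
    if "prob_space J'" "prob_space N'" "sets J' = sets N'" "\<And>E. E \<in> sets N' \<Longrightarrow> measure J' E \<le> measure N' E + \<tau>"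
      "integrable J' F" "integrable N' F" "\<And>x. 0 \<le> F x" "(\<integral>\<^sup>+ x. ennreal (F x powr q) \<partial>J') \<le> ennreal K"
    for J' N' and F :: "'a \<Rightarrow> real"
  proof -
    have "ennreal (\<integral>x. F x \<partial>J') \<le> ennreal (\<integral>x. F x \<partial>N') + ennreal ((1 + K) * \<tau> powr (1 - 1 / q))"
      using nn_integral_le_total_variation[OF that(1,2,3) borel_measurable_integrable[OF that(6)] that(7,4) \<open>0 < \<tau>\<close> q \<open>0 \<le> K\<close> that(8)]
      using that(5,6,7) by (simp add: nn_integral_eq_integral)
    then show ?thesis using that(7) \<open>0 \<le> K\<close>
      by (simp add: ennreal_le_iff integral_nonneg add_nonneg_nonneg flip: ennreal_plus)
  qed
  have tv': "measure J E \<le> measure N E + \<tau>" "measure N E \<le> measure J E + \<tau>" if "E \<in> sets N" for E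
    using tv[OF that] by linarith+
  have part: "\<bar>(\<integral>x. F x \<partial>J) - (\<integral>x. F x \<partial>N)\<bar> \<le> (1 + K) * \<tau> powr (1 - 1 / q)"
    if F: "integrable J F" "integrable N F" "\<And>x. 0 \<le> F x" "\<And>x. F x \<le> \<bar>G x\<bar>" for F
  proof -
    have pw: "F x powr q \<le> \<bar>G x\<bar> powr q" for x using F(3,4) q by (intro powr_mono2) auto
    have "(\<integral>\<^sup>+ x. ennreal (F x powr q) \<partial>J) \<le> ennreal K"
      by (rule order.trans[OF nn_integral_mono KJ]) (use pw in \<open>auto intro: ennreal_leI\<close>)
    moreover have "(\<integral>\<^sup>+ x. ennreal (F x powr q) \<partial>N) \<le> ennreal K"
      by (rule order.trans[OF nn_integral_mono KN]) (use pw in \<open>auto intro: ennreal_leI\<close>)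
    ultimately have "(\<integral>x. F x \<partial>J) \<le> (\<integral>x. F x \<partial>N) + (1 + K) * \<tau> powr (1 - 1 / q)"
      "(\<integral>x. F x \<partial>N) \<le> (\<integral>x. F x \<partial>J) + (1 + K) * \<tau> powr (1 - 1 / q)"
      using F sets tv' by (auto intro!: le J N)
    then show ?thesis by linarith
  qed
  have dec: "(\<integral>x. G x \<partial>Q) = (\<integral>x. max 0 (G x) \<partial>Q) - (\<integral>x. max 0 (- G x) \<partial>Q)" if "integrable Q G" for Q
  proof -
    have "(\<integral>x. G x \<partial>Q) = (\<integral>x. max 0 (G x) - max 0 (- G x) \<partial>Q)"
      by (rule Bochner_Integration.integral_cong) auto
    then show ?thesis using that by (subst (asm) Bochner_Integration.integral_diff) auto
  qed
  have "\<bar>(\<integral>x. max 0 (G x) \<partial>J) - (\<integral>x. max 0 (G x) \<partial>N)\<bar> \<le> (1 + K) * \<tau> powr (1 - 1 / q)"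
    using iJ iN by (intro part) auto
  moreover have "\<bar>(\<integral>x. max 0 (- G x) \<partial>J) - (\<integral>x. max 0 (- G x) \<partial>N)\<bar> \<le> (1 + K) * \<tau> powr (1 - 1 / q)"
    using iJ iN by (intro part) auto
  ultimately show ?thesis
    unfolding dec[OF iJ] dec[OF iN] by (simp only: abs_le_iff) linarith
qed

section \<open>Absolute regularity as a bound on total variation\<close>

lemma finite_image_if_finite_range: "finite (range f) \<Longrightarrow> finite (f ` S)"
  by (meson finite_subset image_mono subset_UNIV)

text \<open>
  The level sets of two finitely-valued functions are admissible partitions in the definition of
  the coefficient. As that supremum is taken over reals, the work is in showing that it is over
  a set bounded above (by \<open>2\<close>).
\<close>

lemma (in prob_space) sum_le_beta_coefficient:
  fixes f g :: "'a \<Rightarrow> nat"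
  assumes A: "space A = space M" "sets A \<subseteq> events" and B: "space B = space M" "sets B \<subseteq> events"
    and f: "f \<in> A \<rightarrow>\<^sub>M count_space UNIV" "finite (range f)"
    and g: "g \<in> B \<rightarrow>\<^sub>M count_space UNIV" "finite (range g)"
  shows "(\<Sum>i\<in>f ` space M. \<Sum>j\<in>g ` space M.
           \<bar>prob ((f -` {i} \<inter> space M) \<inter> (g -` {j} \<inter> space M)) - prob (f -` {i} \<inter> space M) * prob (g -` {j} \<inter> space M)\<bar>)
         \<le> 2 * beta_coefficient M (sets A) (sets B)"
proof -
  let ?d = "\<lambda>U V. \<bar>prob (U \<inter> V) - prob U * prob V\<bar>"
  let ?P = "\<lambda>\<U> \<V>. finite \<U> \<and> \<U> \<subseteq> sets A \<and> partition_on (space M) \<U> \<and>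
            finite \<V> \<and> \<V> \<subseteq> sets B \<and> partition_on (space M) \<V>"
  let ?S = "{(\<Sum>U\<in>\<U>. \<Sum>V\<in>\<V>. ?d U V) | \<U> \<V>. ?P \<U> \<V>}"
  have one: "(\<Sum>V\<in>\<V>. prob (U \<inter> V)) = prob U"
    if "finite \<V>" "\<V> \<subseteq> events" "partition_on (space M) \<V>" "U \<in> events" for U \<V>
  proof -
    have "(\<Sum>V\<in>\<V>. prob (U \<inter> V)) = prob (\<Union>V\<in>\<V>. U \<inter> V)"
      using that by (intro finite_measure_finite_Union[symmetric])
        (auto simp: disjoint_family_on_def partition_on_def dest: disjointD)
    also have "(\<Union>V\<in>\<V>. U \<inter> V) = U"
      using sets.sets_into_space[OF that(4)] partition_onD1[OF that(3)] by auto
    finally show ?thesis .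
  qed
  have one': "(\<Sum>V\<in>\<V>. prob V) = 1"
    if "finite \<V>" "\<V> \<subseteq> events" "partition_on (space M) \<V>" for \<V>
  proof -
    have "(\<Sum>V\<in>\<V>. prob (space M \<inter> V)) = (\<Sum>V\<in>\<V>. prob V)"
      using that(2) sets.sets_into_space by (intro sum.cong refl arg_cong[of _ _ prob]) blast
    then show ?thesis using one[OF that sets.top] by (simp add: prob_space)
  qed
  have "bdd_above ?S"
  proof (rule bdd_aboveI)
    fix s assume "s \<in> ?S"
    then obtain \<U> \<V> where s: "s = (\<Sum>U\<in>\<U>. \<Sum>V\<in>\<V>. ?d U V)" and p: "?P \<U> \<V>" by blast
    have sub: "\<U> \<subseteq> events" "\<V> \<subseteq> events" using p A B by auto
    have "s \<le> (\<Sum>U\<in>\<U>. \<Sum>V\<in>\<V>. prob (U \<inter> V) + prob U * prob V)"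
      unfolding s by (intro sum_mono) (simp add: abs_le_iff)
    also have "\<dots> = (\<Sum>U\<in>\<U>. prob U + prob U * 1)"
      using p sub one one' by (intro sum.cong) (auto simp: sum.distrib simp flip: sum_distrib_left)
    also have "\<dots> = 2" using p sub one'[of \<U>] by (simp flip: sum_distrib_left)
    finally show "s \<le> 2" .
  qed
  moreover have "(\<Sum>i\<in>f ` space M. \<Sum>j\<in>g ` space M. ?d (f -` {i} \<inter> space M) (g -` {j} \<inter> space M)) \<in> ?S"
  proof -
    have inj: "inj_on (\<lambda>i. h -` {i} \<inter> space M) (h ` space M)" for h :: "'a \<Rightarrow> nat"
      by (auto simp: inj_on_def)
    have part: "partition_on (space M) ((\<lambda>i. h -` {i} \<inter> space M) ` (h ` space M))" for h :: "'a \<Rightarrow> nat"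
      by (auto simp: partition_on_def disjoint_def)
    have sub: "(\<lambda>i. f -` {i} \<inter> space M) ` (f ` space M) \<subseteq> sets A"
      using measurable_sets[OF f(1), of "{_}"] A by auto
    have sub': "(\<lambda>i. g -` {i} \<inter> space M) ` (g ` space M) \<subseteq> sets B"
      using measurable_sets[OF g(1), of "{_}"] B by auto
    have fin: "finite (f ` space M)" "finite (g ` space M)"
      using f(2) g(2) by (auto intro: finite_image_if_finite_range)
    have "(\<Sum>i\<in>f ` space M. \<Sum>j\<in>g ` space M. ?d (f -` {i} \<inter> space M) (g -` {j} \<inter> space M))
      = (\<Sum>U\<in>(\<lambda>i. f -` {i} \<inter> space M) ` (f ` space M). \<Sum>V\<in>(\<lambda>i. g -` {i} \<inter> space M) ` (g ` space M). ?d U V)"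
      by (simp add: sum.reindex[OF inj])
    then show ?thesis
      using sub sub' fin part[of f] part[of g] by blast
  qed
  ultimately have "(\<Sum>i\<in>f ` space M. \<Sum>j\<in>g ` space M. ?d (f -` {i} \<inter> space M) (g -` {j} \<inter> space M)) \<le> Sup ?S"
    by (intro cSup_upper)
  then show ?thesis by (simp add: beta_coefficient_def)
qed

text \<open>
  Finite unions of rectangles, encoded by two functions with finitely many values and a set of
  pairs of values. In this encoding the complement is the complement of \<open>T\<close>, and
  unions are obtained by pairing the codes, so that no rectangles have to be refined.
\<close>

definition finite_rect :: "'a measure \<Rightarrow> 'b measure \<Rightarrow> ('a \<Rightarrow> nat) \<Rightarrow> ('b \<Rightarrow> nat) \<Rightarrow> (nat \<times> nat) set \<Rightarrow> ('a \<times> 'b) set" where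
  "finite_rect A B f g T = {p \<in> space (A \<Otimes>\<^sub>M B). (f (fst p), g (snd p)) \<in> T}"

lemma sets_finite_rect:
  assumes [measurable]: "f \<in> A \<rightarrow>\<^sub>M count_space UNIV" "g \<in> B \<rightarrow>\<^sub>M count_space UNIV"
  shows "finite_rect A B f g T \<in> sets (A \<Otimes>\<^sub>M B)"
  unfolding finite_rect_def by measurable

definition rect_approx :: "'a measure \<Rightarrow> 'b measure \<Rightarrow> ('a \<times> 'b) measure \<Rightarrow> ('a \<times> 'b) set \<Rightarrow> bool" where
  "rect_approx A B Q E \<longleftrightarrow> E \<in> sets (A \<Otimes>\<^sub>M B) \<and>
     (\<forall>\<epsilon>>0. \<exists>f g T. f \<in> A \<rightarrow>\<^sub>M count_space UNIV \<and> finite (range f) \<and> g \<in> B \<rightarrow>\<^sub>M count_space UNIV \<and> finite (range g) \<and>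
        measure Q (sym_diff E (finite_rect A B f g T)) < \<epsilon>)"

lemma rect_approx_Un:
  assumes "finite_measure Q" "sets Q = sets (A \<Otimes>\<^sub>M B)" and E: "rect_approx A B Q E1" "rect_approx A B Q E2"
  shows "rect_approx A B Q (E1 \<union> E2)"
  unfolding rect_approx_def
proof (intro conjI allI impI)
  interpret finite_measure Q by fact
  show "E1 \<union> E2 \<in> sets (A \<Otimes>\<^sub>M B)" using E by (auto simp: rect_approx_def)
  fix \<epsilon> :: real assume "0 < \<epsilon>"
  obtain f1 g1 T1 where 1: "f1 \<in> A \<rightarrow>\<^sub>M count_space UNIV" "finite (range f1)" "g1 \<in> B \<rightarrow>\<^sub>M count_space UNIV" "finite (range g1)"
        "measure Q (sym_diff E1 (finite_rect A B f1 g1 T1)) < \<epsilon> / 2"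
    using E(1) \<open>0 < \<epsilon>\<close> unfolding rect_approx_def by (meson half_gt_zero)
  obtain f2 g2 T2 where 2: "f2 \<in> A \<rightarrow>\<^sub>M count_space UNIV" "finite (range f2)" "g2 \<in> B \<rightarrow>\<^sub>M count_space UNIV" "finite (range g2)"
        "measure Q (sym_diff E2 (finite_rect A B f2 g2 T2)) < \<epsilon> / 2"
    using E(2) \<open>0 < \<epsilon>\<close> unfolding rect_approx_def by (meson half_gt_zero)
  note [measurable] = 1(1,3) 2(1,3)
  define f where "f x = prod_encode (f1 x, f2 x)" for x
  define g where "g x = prod_encode (g1 x, g2 x)" for x
  define T where "T = {(a, b). (fst (prod_decode a), fst (prod_decode b)) \<in> T1 \<or> (snd (prod_decode a), snd (prod_decode b)) \<in> T2}"
  have rect: "finite_rect A B f g T = finite_rect A B f1 g1 T1 \<union> finite_rect A B f2 g2 T2"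
    by (auto simp: finite_rect_def f_def g_def T_def)
  have fm: "f \<in> A \<rightarrow>\<^sub>M count_space UNIV" "g \<in> B \<rightarrow>\<^sub>M count_space UNIV" unfolding f_def g_def by measurable
  have ff: "finite (range f)" "finite (range g)"
    by (rule finite_subset[OF _ finite_imageI[OF finite_cartesian_product[OF 1(2) 2(2)]]]; auto simp: f_def)
       (rule finite_subset[OF _ finite_imageI[OF finite_cartesian_product[OF 1(4) 2(4)]]]; auto simp: g_def)
  have s: "sym_diff E1 (finite_rect A B f1 g1 T1) \<in> sets Q" "sym_diff E2 (finite_rect A B f2 g2 T2) \<in> sets Q"
    using E sets_finite_rect[OF 1(1,3)] sets_finite_rect[OF 2(1,3)] by (simp_all add: assms(2) rect_approx_def sets.Un sets.Diff)
  have "measure Q (sym_diff (E1 \<union> E2) (finite_rect A B f g T))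
    \<le> measure Q (sym_diff E1 (finite_rect A B f1 g1 T1) \<union> sym_diff E2 (finite_rect A B f2 g2 T2))"
    unfolding rect using s by (intro finite_measure_mono) auto
  also have "\<dots> \<le> measure Q (sym_diff E1 (finite_rect A B f1 g1 T1)) + measure Q (sym_diff E2 (finite_rect A B f2 g2 T2))"
    using s by (intro measure_Un_le) auto
  also have "\<dots> < \<epsilon>" using 1(5) 2(5) by linarith
  finally show "\<exists>f g T. f \<in> A \<rightarrow>\<^sub>M count_space UNIV \<and> finite (range f) \<and> g \<in> B \<rightarrow>\<^sub>M count_space UNIV \<and> finite (range g) \<and>
        measure Q (sym_diff (E1 \<union> E2) (finite_rect A B f g T)) < \<epsilon>"
    using fm ff by blast
qed

text \<open>
  The sets that can be approximated in measure by finite unions of rectangles form a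
  \<open>\<sigma>\<close>-algebra: a countable union is first replaced by a finite one.
\<close>

lemma rect_approx_all:
  assumes "finite_measure Q" "sets Q = sets (A \<Otimes>\<^sub>M B)" and E: "E \<in> sets (A \<Otimes>\<^sub>M B)"
  shows "rect_approx A B Q E"
proof -
  interpret finite_measure Q by fact
  have emp: "rect_approx A B Q {}"
    unfolding rect_approx_def
  proof (intro conjI allI impI)
    fix \<epsilon> :: real assume "0 < \<epsilon>"
    show "\<exists>f g T. f \<in> A \<rightarrow>\<^sub>M count_space UNIV \<and> finite (range f) \<and> g \<in> B \<rightarrow>\<^sub>M count_space UNIV \<and> finite (range g) \<and>
        measure Q (sym_diff {} (finite_rect A B f g T)) < \<epsilon>"
      by (rule exI[of _ "\<lambda>_. 0"], rule exI[of _ "\<lambda>_. 0"], rule exI[of _ "{}"])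
         (use \<open>0 < \<epsilon>\<close> in \<open>simp add: finite_rect_def\<close>)
  qed simp
  from E have "E \<in> sigma_sets (space A \<times> space B) {a \<times> b | a b. a \<in> sets A \<and> b \<in> sets B}"
    by (simp add: sets_pair_measure)
  then show ?thesis
  proof induction
    case (Basic R)
    then obtain a b where R: "R = a \<times> b" and [measurable]: "a \<in> sets A" "b \<in> sets B" by blast
    have sub: "a \<times> b \<subseteq> space (A \<Otimes>\<^sub>M B)"
      using sets.sets_into_space[of a A] sets.sets_into_space[of b B] by (auto simp: space_pair_measure)
    define f :: "'a \<Rightarrow> nat" where "f x = (if x \<in> a then 1 else 0)" for x
    define g :: "'b \<Rightarrow> nat" where "g x = (if x \<in> b then 1 else 0)" for x
    have "finite_rect A B f g {(1, 1)} = R" using sub by (auto simp: finite_rect_def f_def g_def R)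
    moreover have "f \<in> A \<rightarrow>\<^sub>M count_space UNIV" "g \<in> B \<rightarrow>\<^sub>M count_space UNIV" unfolding f_def g_def by measurable
    moreover have "finite (range f)" "finite (range g)"
      by (rule finite_subset[of _ "{0, 1}"]; auto simp: f_def g_def)+
    ultimately show ?case unfolding rect_approx_def R
      by (intro conjI allI impI exI[of _ f] exI[of _ g] exI[of _ "{(1,1)}"]) auto
  next
    case Empty
    show ?case by (rule emp)
  next
    case (Compl R)
    have sp: "space A \<times> space B = space (A \<Otimes>\<^sub>M B)" by (simp add: space_pair_measure)
    have "sym_diff (space A \<times> space B - R) (finite_rect A B f g (- T)) = sym_diff R (finite_rect A B f g T)" for f g T
      using Compl(2) sets.sets_into_space[of R "A \<Otimes>\<^sub>M B"] unfolding sp rect_approx_def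
      by (auto simp: finite_rect_def)
    then show ?case using Compl(2) unfolding rect_approx_def sp
      by (metis sets.compl_sets)
  next
    case (Union a)
    show ?case
      unfolding rect_approx_def
    proof (intro conjI allI impI)
      have a: "a i \<in> sets (A \<Otimes>\<^sub>M B)" for i using Union(2)[of i] by (simp add: rect_approx_def)
      then show "\<Union> (range a) \<in> sets (A \<Otimes>\<^sub>M B)" by auto
      fix \<epsilon> :: real assume "0 < \<epsilon>"
      have fin: "rect_approx A B Q (\<Union>i<n. a i)" for n
      proof (induction n)
        case (Suc n)
        have "(\<Union>i<Suc n. a i) = (\<Union>i<n. a i) \<union> a n" by (auto simp: less_Suc_eq)
        then show ?case using rect_approx_Un[OF assms(1,2) Suc Union(2)[of n]] by simp
      qed (simp add: emp)
      have "(\<lambda>n. measure Q (\<Union>i<n. a i)) \<longlonglongrightarrow> measure Q (\<Union>n. \<Union>i<n. a i)"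
        using a assms(2) by (intro finite_Lim_measure_incseq) (auto simp: incseq_def intro: less_le_trans)
      moreover have "(\<Union>n. \<Union>i<n. a i) = \<Union> (range a)" by (auto intro: lessI)
      ultimately have "\<forall>\<^sub>F n in sequentially. dist (measure Q (\<Union>i<n. a i)) (measure Q (\<Union> (range a))) < \<epsilon> / 2"
        using \<open>0 < \<epsilon>\<close> by (auto dest!: tendstoD[of _ _ _ "\<epsilon> / 2"])
      then obtain n where n: "dist (measure Q (\<Union>i<n. a i)) (measure Q (\<Union> (range a))) < \<epsilon> / 2"
        by (auto simp: eventually_sequentially)
      obtain f g T where fg: "f \<in> A \<rightarrow>\<^sub>M count_space UNIV" "finite (range f)" "g \<in> B \<rightarrow>\<^sub>M count_space UNIV" "finite (range g)"
        "measure Q (sym_diff (\<Union>i<n. a i) (finite_rect A B f g T)) < \<epsilon> / 2"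
        using fin[of n] \<open>0 < \<epsilon>\<close> unfolding rect_approx_def by (meson half_gt_zero)
      let ?U = "\<Union>i<n. a i"
      have sU: "?U \<in> sets Q" "\<Union> (range a) \<in> sets Q" "finite_rect A B f g T \<in> sets Q"
        using a assms(2) fg by (auto intro!: sets_finite_rect)
      have "measure Q (\<Union> (range a) - ?U) = measure Q (\<Union> (range a)) - measure Q ?U"
        using sU by (intro finite_measure_Diff) auto
      also have "\<dots> < \<epsilon> / 2" using n unfolding dist_real_def by linarith
      finally have d: "measure Q (\<Union> (range a) - ?U) < \<epsilon> / 2" .
      have "measure Q (sym_diff (\<Union> (range a)) (finite_rect A B f g T))
        \<le> measure Q ((\<Union> (range a) - ?U) \<union> sym_diff ?U (finite_rect A B f g T))"
        using sU by (intro finite_measure_mono) auto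
      also have "\<dots> \<le> measure Q (\<Union> (range a) - ?U) + measure Q (sym_diff ?U (finite_rect A B f g T))"
        using sU by (intro measure_Un_le) auto
      also have "\<dots> < \<epsilon>" using d fg(5) by linarith
      finally show "\<exists>f g T. f \<in> A \<rightarrow>\<^sub>M count_space UNIV \<and> finite (range f) \<and> g \<in> B \<rightarrow>\<^sub>M count_space UNIV \<and> finite (range g) \<and>
        measure Q (sym_diff (\<Union> (range a)) (finite_rect A B f g T)) < \<epsilon>"
        using fg by blast
    qed
  qed
qed

text \<open>
  These two maps carry \<open>M\<close> and \<open>M \<Otimes> M\<close> to the joint law of
  \<open>A\<close> and \<open>B\<close> and to the law under which they are independent.
\<close>

lemma (in prob_space) measurable_diagonal_product_subalgebra:
  assumes A: "space A = space M" "sets A \<subseteq> events" and B: "space B = space M" "sets B \<subseteq> events"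
  shows "(\<lambda>\<omega>. (\<omega>, \<omega>)) \<in> M \<rightarrow>\<^sub>M A \<Otimes>\<^sub>M B" "(\<lambda>p. p) \<in> M \<Otimes>\<^sub>M M \<rightarrow>\<^sub>M A \<Otimes>\<^sub>M B"
proof -
  have idA: "(\<lambda>\<omega>. \<omega>) \<in> M \<rightarrow>\<^sub>M A" and idB: "(\<lambda>\<omega>. \<omega>) \<in> M \<rightarrow>\<^sub>M B"
    using A B by (auto simp: measurable_def)
  then show "(\<lambda>\<omega>. (\<omega>, \<omega>)) \<in> M \<rightarrow>\<^sub>M A \<Otimes>\<^sub>M B" by (rule measurable_Pair)
  show "(\<lambda>p. p) \<in> M \<Otimes>\<^sub>M M \<rightarrow>\<^sub>M A \<Otimes>\<^sub>M B"
    using measurable_compose[OF measurable_fst idA] measurable_compose[OF measurable_snd idB]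
    by (intro measurable_pair) (simp_all add: comp_def)
qed

text \<open>
  On a finite union of rectangles the difference of the two laws is a part of the sum in the
  definition of the coefficient, and such unions approximate \<open>E\<close> for both laws.
\<close>

lemma (in prob_space) total_variation_le_beta_coefficient:
  assumes A: "space A = space M" "sets A \<subseteq> events" and B: "space B = space M" "sets B \<subseteq> events"
    and E: "E \<in> sets (A \<Otimes>\<^sub>M B)"
  shows "\<bar>measure (distr M (A \<Otimes>\<^sub>M B) (\<lambda>\<omega>. (\<omega>, \<omega>))) E - measure (distr (M \<Otimes>\<^sub>M M) (A \<Otimes>\<^sub>M B) (\<lambda>p. p)) E\<bar>
         \<le> 2 * beta_coefficient M (sets A) (sets B)"
proof -
  note [measurable] = measurable_diagonal_product_subalgebra[OF A B]
  interpret MM: pair_prob_space M M ..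
  define J where "J = distr M (A \<Otimes>\<^sub>M B) (\<lambda>\<omega>. (\<omega>, \<omega>))"
  define N where "N = distr (M \<Otimes>\<^sub>M M) (A \<Otimes>\<^sub>M B) (\<lambda>p. p)"
  interpret J: prob_space J unfolding J_def by (rule prob_space_distr) simp
  interpret N: prob_space N unfolding N_def by (rule MM.prob_space_distr) simp
  have sJ: "sets J = sets (A \<Otimes>\<^sub>M B)" and sN: "sets N = sets (A \<Otimes>\<^sub>M B)" by (auto simp: J_def N_def)
  let ?b = "beta_coefficient M (sets A) (sets B)"
  have rect: "\<bar>J.prob (finite_rect A B f g T) - N.prob (finite_rect A B f g T)\<bar> \<le> 2 * ?b"
    if f: "f \<in> A \<rightarrow>\<^sub>M count_space UNIV" "finite (range f)" and g: "g \<in> B \<rightarrow>\<^sub>M count_space UNIV" "finite (range g)" for f g T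
  proof -
    define F where "F i = f -` {i} \<inter> space M" for i
    define G where "G i = g -` {i} \<inter> space M" for i
    let ?I = "(f ` space M \<times> g ` space M) \<inter> T"
    have FA: "F i \<in> sets A" and GB: "G i \<in> sets B" for i
      using measurable_sets[OF f(1), of "{i}"] measurable_sets[OF g(1), of "{i}"] A B by (auto simp: F_def G_def)
    then have FG: "F i \<in> events" "G i \<in> events" for i using A B by auto
    have fin: "finite ?I" using f(2) g(2)
      by (intro finite_Int disjI1 finite_cartesian_product) (auto intro: finite_image_if_finite_range)
    have eq: "finite_rect A B f g T = (\<Union>p\<in>?I. F (fst p) \<times> G (snd p))" (is "?L = ?R")
    proof (rule set_eqI)
      fix p :: "'a \<times> 'a"
      have "p \<in> ?L \<longleftrightarrow> fst p \<in> space M \<and> snd p \<in> space M \<and> (f (fst p), g (snd p)) \<in> T"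
        using A B by (simp add: finite_rect_def space_pair_measure mem_Times_iff)
      also have "\<dots> \<longleftrightarrow> (\<exists>i j. (i, j) \<in> ?I \<and> fst p \<in> F i \<and> snd p \<in> G j)"
        unfolding F_def G_def by auto
      also have "\<dots> \<longleftrightarrow> p \<in> ?R"
        by (simp add: mem_Times_iff Bex_def split_paired_Ex)
      finally show "p \<in> ?L \<longleftrightarrow> p \<in> ?R" .
    qed
    have dec: "measure Q (finite_rect A B f g T) = (\<Sum>p\<in>?I. measure Q (F (fst p) \<times> G (snd p)))"
      if "finite_measure Q" "sets Q = sets (A \<Otimes>\<^sub>M B)" for Q
    proof -
      interpret Q: finite_measure Q by fact
      have "measure Q (\<Union>p\<in>?I. F (fst p) \<times> G (snd p)) = (\<Sum>p\<in>?I. measure Q (F (fst p) \<times> G (snd p)))"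
        using fin FA GB that(2)
        by (intro Q.finite_measure_finite_Union) (auto simp: disjoint_family_on_def F_def G_def)
      then show ?thesis by (simp only: eq)
    qed
    have J1: "J.prob (F i \<times> G j) = prob (F i \<inter> G j)" for i j
    proof -
      have "J.prob (F i \<times> G j) = prob ((\<lambda>\<omega>. (\<omega>, \<omega>)) -` (F i \<times> G j) \<inter> space M)"
        unfolding J_def using FA GB by (intro measure_distr) auto
      also have "(\<lambda>\<omega>. (\<omega>, \<omega>)) -` (F i \<times> G j) \<inter> space M = F i \<inter> G j" by (auto simp: F_def G_def)
      finally show ?thesis .
    qed
    have N1: "N.prob (F i \<times> G j) = prob (F i) * prob (G j)" for i j
    proof -
      have "N.prob (F i \<times> G j) = measure (M \<Otimes>\<^sub>M M) ((\<lambda>p. p) -` (F i \<times> G j) \<inter> space (M \<Otimes>\<^sub>M M))"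
        unfolding N_def using FA GB by (intro measure_distr) auto
      also have "(\<lambda>p. p) -` (F i \<times> G j) \<inter> space (M \<Otimes>\<^sub>M M) = F i \<times> G j"
        by (auto simp: F_def G_def space_pair_measure)
      also have "measure (M \<Otimes>\<^sub>M M) (F i \<times> G j) = prob (F i) * prob (G j)"
        unfolding measure_def using FG by (simp add: emeasure_pair_measure_Times enn2real_mult)
      finally show ?thesis .
    qed
    have "\<bar>J.prob (finite_rect A B f g T) - N.prob (finite_rect A B f g T)\<bar>
      = \<bar>\<Sum>p\<in>?I. prob (F (fst p) \<inter> G (snd p)) - prob (F (fst p)) * prob (G (snd p))\<bar>"
      using dec[OF J.finite_measure_axioms sJ] dec[OF N.finite_measure_axioms sN] by (simp add: J1 N1 sum_subtractf)
    also have "\<dots> \<le> (\<Sum>p\<in>?I. \<bar>prob (F (fst p) \<inter> G (snd p)) - prob (F (fst p)) * prob (G (snd p))\<bar>)"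
      by (rule sum_abs)
    also have "\<dots> \<le> (\<Sum>p\<in>f ` space M \<times> g ` space M. \<bar>prob (F (fst p) \<inter> G (snd p)) - prob (F (fst p)) * prob (G (snd p))\<bar>)"
      using f(2) g(2) by (intro sum_mono2) (auto intro: finite_image_if_finite_range)
    also have "\<dots> = (\<Sum>i\<in>f ` space M. \<Sum>j\<in>g ` space M. \<bar>prob (F i \<inter> G j) - prob (F i) * prob (G j)\<bar>)"
      by (simp add: sum.cartesian_product case_prod_beta)
    also have "\<dots> \<le> 2 * ?b"
      unfolding F_def G_def by (rule sum_le_beta_coefficient[OF A B f g])
    finally show ?thesis .
  qed
  have "\<bar>J.prob E - N.prob E\<bar> \<le> 2 * ?b + e" if "0 < e" for e
  proof -
    \<comment> \<open>One approximation has to serve both laws, so it is taken with respect to their sum.\<close>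
    define Q where "Q = measure_of (space (A \<Otimes>\<^sub>M B)) (sets (A \<Otimes>\<^sub>M B)) (\<lambda>S. emeasure J S + emeasure N S)"
    have sQ: "sets Q = sets (A \<Otimes>\<^sub>M B)" by (simp add: Q_def sets.sets_measure_of_eq)
    have Q: "emeasure Q S = emeasure J S + emeasure N S" if "S \<in> sets (A \<Otimes>\<^sub>M B)" for S
      unfolding Q_def
    proof (rule emeasure_measure_of_sigma)
      show "countably_additive (sets (A \<Otimes>\<^sub>M B)) (\<lambda>S. emeasure J S + emeasure N S)"
        unfolding countably_additive_def
        using suminf_emeasure[of _ J] suminf_emeasure[of _ N] sJ sN by (auto simp: suminf_add[symmetric])
    qed (use that in \<open>auto simp: positive_def sets.sigma_algebra_axioms\<close>)
    have "finite_measure Q"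
      by (rule finite_measureI) (use Q[OF sets.top] in \<open>simp add: sets_eq_imp_space_eq[OF sQ] J.emeasure_eq_measure N.emeasure_eq_measure\<close>)
    then interpret Q: finite_measure Q .
    have mQ: "measure Q S = J.prob S + N.prob S" if "S \<in> sets (A \<Otimes>\<^sub>M B)" for S
      using Q[OF that] by (simp add: Q.emeasure_eq_measure J.emeasure_eq_measure N.emeasure_eq_measure flip: ennreal_plus)
    obtain f g T where fg: "f \<in> A \<rightarrow>\<^sub>M count_space UNIV" "finite (range f)" "g \<in> B \<rightarrow>\<^sub>M count_space UNIV" "finite (range g)"
        "measure Q (sym_diff E (finite_rect A B f g T)) < e"
      using rect_approx_all[OF Q.finite_measure_axioms sQ E] \<open>0 < e\<close> unfolding rect_approx_def by blast
    let ?R = "finite_rect A B f g T"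
    have R: "?R \<in> sets (A \<Otimes>\<^sub>M B)" using fg by (intro sets_finite_rect)
    have sd: "\<bar>measure L E - measure L ?R\<bar> \<le> measure L (sym_diff E ?R)"
      if "finite_measure L" "sets L = sets (A \<Otimes>\<^sub>M B)" for L
    proof -
      interpret L: finite_measure L by fact
      have "measure L E \<le> measure L (?R \<union> sym_diff E ?R)" "measure L ?R \<le> measure L (E \<union> sym_diff E ?R)"
        using E R that(2) by (auto intro!: L.finite_measure_mono)
      moreover have "measure L (?R \<union> sym_diff E ?R) \<le> measure L ?R + measure L (sym_diff E ?R)"
        "measure L (E \<union> sym_diff E ?R) \<le> measure L E + measure L (sym_diff E ?R)"
        using E R that(2) by (auto intro!: measure_Un_le)
      ultimately show ?thesis by linarith
    qed
    have "sym_diff E ?R \<in> sets (A \<Otimes>\<^sub>M B)" using E R by auto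
    then show ?thesis
      using sd[OF J.finite_measure_axioms sJ] sd[OF N.finite_measure_axioms sN] mQ[of "sym_diff E ?R"] fg(5) rect[OF fg(1-4), of T]
      by linarith
  qed
  then have "\<bar>J.prob E - N.prob E\<bar> \<le> 2 * ?b" by (rule field_le_epsilon)
  then show ?thesis unfolding J_def N_def .
qed

text \<open>
  The covariance inequality behind the whole proof. The function \<open>G\<close> of the two
  \<open>\<sigma>\<close>-algebras is arbitrary; for a product \<open>G(x, y) = s(x)
  t(y)\<close> it becomes a bound of Davydov type for the covariance of \<open>s\<close> and
  \<open>t\<close>.
\<close>

lemma (in prob_space) beta_mixing_integral_diff:
  fixes G :: "'a \<times> 'a \<Rightarrow> real"
  assumes A: "space A = space M" "sets A \<subseteq> events" and B: "space B = space M" "sets B \<subseteq> events"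
    and G[measurable]: "G \<in> borel_measurable (A \<Otimes>\<^sub>M B)" and q: "1 < q" and "0 \<le> K"
    and K1: "(\<integral>\<^sup>+\<omega>. ennreal (\<bar>G (\<omega>, \<omega>)\<bar> powr q) \<partial>M) \<le> ennreal K"
    and K2: "(\<integral>\<^sup>+p. ennreal (\<bar>G p\<bar> powr q) \<partial>(M \<Otimes>\<^sub>M M)) \<le> ennreal K"
  shows "\<bar>(\<integral>\<omega>. G (\<omega>, \<omega>) \<partial>M) - (\<integral>p. G p \<partial>(M \<Otimes>\<^sub>M M))\<bar>
         \<le> 2 * (1 + K) * (2 * beta_coefficient M (sets A) (sets B)) powr (1 - 1 / q)"
proof -
  note [measurable] = measurable_diagonal_product_subalgebra[OF A B]
  interpret MM: pair_prob_space M M ..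
  define J where "J = distr M (A \<Otimes>\<^sub>M B) (\<lambda>\<omega>. (\<omega>, \<omega>))"
  define N where "N = distr (M \<Otimes>\<^sub>M M) (A \<Otimes>\<^sub>M B) (\<lambda>p. p)"
  have ps: "prob_space J" "prob_space N"
    unfolding J_def N_def by (auto intro!: prob_space_distr MM.prob_space_distr)
  have [measurable_cong]: "sets J = sets (A \<Otimes>\<^sub>M B)" "sets N = sets (A \<Otimes>\<^sub>M B)" by (auto simp: J_def N_def)
  have tv: "\<bar>measure J E - measure N E\<bar> \<le> 2 * beta_coefficient M (sets A) (sets B)" if "E \<in> sets N" for E
    using total_variation_le_beta_coefficient[OF A B, of E] that by (simp add: J_def N_def)
  have pos: "0 \<le> 2 * beta_coefficient M (sets A) (sets B)"
    using tv[of "{}"] by simp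
  have "\<bar>(\<integral>x. G x \<partial>J) - (\<integral>x. G x \<partial>N)\<bar> \<le> 2 * (1 + K) * (2 * beta_coefficient M (sets A) (sets B)) powr (1 - 1 / q)"
    using K1 K2 pos
    by (intro integral_diff_le_total_variation[OF ps _ _ tv _ q \<open>0 \<le> K\<close>])
       (auto simp: J_def N_def nn_integral_distr)
  then show ?thesis by (simp add: J_def N_def integral_distr)
qed

section \<open>Measurable functionals of counting measures\<close>

lemma measurable_measure_algebraI:
  assumes "\<And>x. x \<in> space N \<Longrightarrow> sets (\<psi> x) = sets K"
    and "\<And>A. A \<in> sets K \<Longrightarrow> (\<lambda>x. emeasure (\<psi> x) A) \<in> borel_measurable N"
  shows "\<psi> \<in> N \<rightarrow>\<^sub>M measure_algebra K"
  unfolding measure_algebra_def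
  using assms by (intro measurable_SUP2 measurable_vimage_algebra2) auto

lemma measurable_emeasure_measure_algebra:
  "A \<in> sets K \<Longrightarrow> (\<lambda>\<mu>. emeasure \<mu> A) \<in> borel_measurable (measure_algebra K)"
  unfolding measure_algebra_def
  by (intro measurable_SUP1[of A] measurable_vimage_algebra1) auto

text \<open>
  Division by the total mass plus one turns a kernel of finite measures into a subprobability
  kernel, for which measurability of parametric integrals is known.
\<close>

lemma borel_measurable_integral_finite_kernel:
  fixes f :: "'a \<Rightarrow> 'b \<Rightarrow> real"
  assumes f[measurable]: "(\<lambda>(x, y). f x y) \<in> borel_measurable (M \<Otimes>\<^sub>M N)"
    and sets: "\<And>x. x \<in> space M \<Longrightarrow> sets (\<kappa> x) = sets N"
    and fin: "\<And>x. x \<in> space M \<Longrightarrow> emeasure (\<kappa> x) (space N) < \<infinity>"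
    and meas: "\<And>A. A \<in> sets N \<Longrightarrow> (\<lambda>x. emeasure (\<kappa> x) A) \<in> borel_measurable M"
    and "space N \<noteq> {}"
  shows "(\<lambda>x. \<integral>y. f x y \<partial>\<kappa> x) \<in> borel_measurable M"
proof -
  define c where "c x = 1 / (measure (\<kappa> x) (space N) + 1)" for x
  have c: "0 < c x" for x by (simp add: c_def add_nonneg_pos)
  have [measurable]: "(\<lambda>x. measure (\<kappa> x) (space N)) \<in> borel_measurable M"
    unfolding measure_def using meas[OF sets.top] by measurable
  have [measurable]: "c \<in> borel_measurable M" unfolding c_def by measurable
  define L where "L x = density (\<kappa> x) (\<lambda>_. ennreal (c x))" for x
  have em: "emeasure (L x) A = ennreal (c x) * emeasure (\<kappa> x) A" if "x \<in> space M" "A \<in> sets N" for x A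
    unfolding L_def using that sets by (intro emeasure_density_const) auto
  have L: "L \<in> M \<rightarrow>\<^sub>M subprob_algebra N"
  proof (rule measurable_subprob_algebra)
    fix x assume x: "x \<in> space M"
    have sp: "space (\<kappa> x) = space N" using sets[OF x] by (rule sets_eq_imp_space_eq)
    have "emeasure (\<kappa> x) (space N) = ennreal (measure (\<kappa> x) (space N))"
      using fin[OF x] by (simp add: emeasure_eq_ennreal_measure)
    then have "emeasure (L x) (space N) \<le> 1"
      using em[OF x sets.top] by (simp add: c_def add_nonneg_pos flip: ennreal_mult)
    then show "subprob_space (L x)"
      using \<open>space N \<noteq> {}\<close> by (intro subprob_spaceI) (simp_all add: L_def sp)
    show "sets (L x) = sets N" using sets[OF x] by (simp add: L_def)
  next
    fix A assume "A \<in> sets N"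
    then show "(\<lambda>x. emeasure (L x) A) \<in> borel_measurable M"
      using meas by (subst measurable_cong[OF em]) auto
  qed
  note [measurable] = L measurable_distr2
  have "(\<lambda>x. \<integral>p. (case p of (x, y) \<Rightarrow> f x y) \<partial>distr (L x) (M \<Otimes>\<^sub>M N) (\<lambda>y. (x, y))) \<in> borel_measurable M"
    by (rule measurable_compose[OF _ integral_measurable_subprob_algebra]) measurable
  then have "(\<lambda>x. (1 / c x) * (\<integral>p. (case p of (x, y) \<Rightarrow> f x y) \<partial>distr (L x) (M \<Otimes>\<^sub>M N) (\<lambda>y. (x, y)))) \<in> borel_measurable M"
    by measurable
  then show ?thesis
  proof (rule measurable_cong[THEN iffD1, rotated])
    fix x assume x: "x \<in> space M"
    have px: "Pair x \<in> N \<rightarrow>\<^sub>M M \<Otimes>\<^sub>M N" using x by simp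
    have fx: "f x \<in> borel_measurable (\<kappa> x)"
      using measurable_compose[OF px f] by (simp add: measurable_cong_sets[OF sets[OF x] refl])
    have pL: "Pair x \<in> L x \<rightarrow>\<^sub>M M \<Otimes>\<^sub>M N"
      using px by (simp add: L_def measurable_cong_sets[OF sets[OF x] refl])
    have "(\<integral>p. (case p of (x, y) \<Rightarrow> f x y) \<partial>distr (L x) (M \<Otimes>\<^sub>M N) (Pair x)) = (\<integral>y. f x y \<partial>L x)"
      using integral_distr[OF pL f] by simp
    also have "\<dots> = c x * (\<integral>y. f x y \<partial>\<kappa> x)"
      unfolding L_def using fx c[of x] by (subst integral_density) (auto simp: less_imp_le)
    finally show "1 / c x * (\<integral>p. (case p of (x, y) \<Rightarrow> f x y) \<partial>distr (L x) (M \<Otimes>\<^sub>M N) (\<lambda>y. (x, y))) = (\<integral>y. f x y \<partial>\<kappa> x)"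
      using c[of x] by simp
  qed
qed

text \<open>
  On a null set a bounded window may hold infinitely many points. The null measure is used
  there, so that the restriction is always finite and integrals against it agree with sums over
  infinite index sets, which are \<open>0\<close> by convention.
\<close>

definition restrict_to_window :: "(real ^ 'd) set \<Rightarrow> ((real ^ 'd) \<times> 'm::polish_space) measure \<Rightarrow> ((real ^ 'd) \<times> 'm) measure" where
  "restrict_to_window B \<mu> = (if emeasure \<mu> (B \<times> UNIV) < \<infinity> then density \<mu> (indicator (B \<times> UNIV)) else null_measure borel)"

definition window_integral :: "(real ^ 'd) set \<Rightarrow> ((real ^ 'd) \<times> 'm::polish_space \<Rightarrow> real) \<Rightarrow> ((real ^ 'd) \<times> 'm) measure \<Rightarrow> real" where
  "window_integral B f \<mu> = integral\<^sup>L (restrict_to_window B \<mu>) f"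

lemma sets_strip:
  fixes B :: "(real ^ 'd) set"
  assumes "B \<in> sets borel" "C \<in> sets borel"
  shows "B \<times> (C :: 'm::polish_space set) \<in> sets borel"
  using pair_measureI[OF assms] by (simp only: borel_prod)

lemma borel_measurable_window_integral:
  fixes f :: "'a \<Rightarrow> (real ^ 'd) \<times> 'm::polish_space \<Rightarrow> real"
  assumes \<psi>: "\<psi> \<in> N \<rightarrow>\<^sub>M measure_algebra borel" and B: "B \<in> sets borel"
    and f: "(\<lambda>(x, e). f x e) \<in> borel_measurable (N \<Otimes>\<^sub>M borel)"
  shows "(\<lambda>x. window_integral B (f x) (\<psi> x)) \<in> borel_measurable N"
proof -
  have S: "B \<times> UNIV \<in> sets (borel :: ((real ^ 'd) \<times> 'm) measure)" using B by (intro sets_strip) auto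
  have s: "sets (\<psi> x) = sets borel" if "x \<in> space N" for x
    using measurable_space[OF \<psi> that] by (simp add: space_measure_algebra)
  have em: "emeasure (restrict_to_window B (\<psi> x)) A =
      (if emeasure (\<psi> x) (B \<times> UNIV) < \<infinity> then emeasure (\<psi> x) ((B \<times> UNIV) \<inter> A) else 0)"
    if "x \<in> space N" "A \<in> sets borel" for x A
    using s[OF that(1)] S that(2) by (auto simp: restrict_to_window_def emeasure_restricted)
  have evm: "(\<lambda>x. emeasure (\<psi> x) A) \<in> borel_measurable N" if "A \<in> sets borel" for A
    by (rule measurable_compose[OF \<psi> measurable_emeasure_measure_algebra[OF that]])
  show ?thesis
    unfolding window_integral_def
  proof (rule borel_measurable_integral_finite_kernel[OF f])
    fix x assume x: "x \<in> space N"
    show "sets (restrict_to_window B (\<psi> x)) = sets borel" using s[OF x] by (simp add: restrict_to_window_def)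
    show "emeasure (restrict_to_window B (\<psi> x)) (space borel) < \<infinity>" using em[OF x, of UNIV] by simp
  next
    fix A :: "((real ^ 'd) \<times> 'm) set" assume A: "A \<in> sets borel"
    note [measurable] = evm[OF S] evm[OF sets.Int[OF S A]]
    have "(\<lambda>x. if emeasure (\<psi> x) (B \<times> UNIV) < \<infinity> then emeasure (\<psi> x) ((B \<times> UNIV) \<inter> A) else 0) \<in> borel_measurable N"
      by measurable
    then show "(\<lambda>x. emeasure (restrict_to_window B (\<psi> x)) A) \<in> borel_measurable N"
      by (subst measurable_cong[OF em[OF _ A]])
  qed simp
qed

definition labels :: "('w \<Rightarrow> nat set) \<Rightarrow> (nat \<Rightarrow> 'w \<Rightarrow> real ^ 'd) \<Rightarrow> (real ^ 'd) set \<Rightarrow> 'w \<Rightarrow> nat set" where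
  "labels I X B \<omega> = {n \<in> I \<omega>. X n \<omega> \<in> B}"

text \<open>
  Integrals against the counting measure are measurable and depend only on its law; sums over
  labels can be split and rearranged. This identity, valid at every \<open>\<omega>\<close>,
  links both.
\<close>

lemma window_integral_mpp:
  fixes f :: "(real ^ 'd) \<times> 'm::polish_space \<Rightarrow> real"
  assumes B: "B \<in> sets borel" and f[measurable]: "f \<in> borel_measurable borel"
  shows "window_integral B f (mpp I X M \<omega>) = (\<Sum>n\<in>labels I X B \<omega>. f (X n \<omega>, M n \<omega>))"
proof -
  have S[measurable]: "B \<times> UNIV \<in> sets (borel :: ((real ^ 'd) \<times> 'm) measure)" using B by (intro sets_strip) auto
  have [measurable_cong]: "sets (mpp I X M \<omega>) = sets borel" by (simp add: mpp_def)
  have em: "emeasure (mpp I X M \<omega>) (B \<times> UNIV) = emeasure (count_space UNIV) (labels I X B \<omega>)"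
    by (simp add: emeasure_mpp[OF S] labels_def)
  show ?thesis
  proof (cases "finite (labels I X B \<omega>)")
    case True
    then have "window_integral B f (mpp I X M \<omega>) = (\<integral>e. f e \<partial>density (mpp I X M \<omega>) (\<lambda>e. ennreal (indicator (B \<times> UNIV) e)))"
      using em by (simp add: window_integral_def restrict_to_window_def ennreal_indicator of_nat_less_top)
    also have "\<dots> = (\<integral>e. indicator (B \<times> UNIV) e * f e \<partial>mpp I X M \<omega>)"
      by (subst integral_density) auto
    also have "\<dots> = (\<integral>n. indicator (B \<times> UNIV) (X n \<omega>, M n \<omega>) * f (X n \<omega>, M n \<omega>) \<partial>count_space (I \<omega>))"
      unfolding mpp_def by (subst integral_distr) auto
    also have "\<dots> = (\<Sum>n | n \<in> I \<omega> \<and> indicator (B \<times> UNIV) (X n \<omega>, M n \<omega>) * f (X n \<omega>, M n \<omega>) \<noteq> 0.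
        indicator (B \<times> UNIV) (X n \<omega>, M n \<omega>) * f (X n \<omega>, M n \<omega>))"
      by (rule lebesgue_integral_count_space_finite_support, rule finite_subset[OF _ True])
         (auto simp: labels_def indicator_def)
    also have "\<dots> = (\<Sum>n\<in>labels I X B \<omega>. f (X n \<omega>, M n \<omega>))"
      using True by (intro sum.mono_neutral_cong_left) (auto simp: labels_def indicator_def)
    finally show ?thesis .
  next
    case False
    then show ?thesis
      using em by (simp add: window_integral_def restrict_to_window_def)
  qed
qed

lemma labels_labels: "S \<subseteq> B \<Longrightarrow> labels (labels I X B) X S \<omega> = labels I X S \<omega>"
  by (auto simp: labels_def)

lemma labels_mono: "S \<subseteq> B \<Longrightarrow> labels I X S \<omega> \<subseteq> labels I X B \<omega>"
  by (auto simp: labels_def)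

text \<open>
  The set \<open>B + z\<close>, written as a preimage.
\<close>

definition translate :: "real ^ 'd \<Rightarrow> (real ^ 'd) set \<Rightarrow> (real ^ 'd) set" where
  "translate z B = {x. x - z \<in> B}"

lemma labels_shift: "labels I (\<lambda>n \<omega>. X n \<omega> - z) B \<omega> = labels I X (translate z B) \<omega>"
  by (simp add: labels_def translate_def)

lemma sets_translate: "B \<in> sets borel \<Longrightarrow> translate z B \<in> sets borel"
proof -
  assume [measurable]: "B \<in> sets borel"
  have "{x \<in> space borel. x - z \<in> B} \<in> sets borel" by measurable
  then show ?thesis by (simp add: translate_def)
qed

text \<open>
  The arguments \<open>\<omega>\<close> and \<open>\<omega>'\<close> govern the first and the
  second point of the pair. Taken equal they give the pair sum of the process, taken independent
  the pair sum of two independent copies.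
\<close>

definition pair_sum :: "('w \<Rightarrow> nat set) \<Rightarrow> (nat \<Rightarrow> 'w \<Rightarrow> real ^ 'd) \<Rightarrow> (nat \<Rightarrow> 'w \<Rightarrow> 'm::polish_space) \<Rightarrow>
    ('m \<Rightarrow> real) \<Rightarrow> ('m \<Rightarrow> real) \<Rightarrow> (real ^ 'd \<Rightarrow> real) \<Rightarrow> (real ^ 'd) set \<Rightarrow> (real ^ 'd) set \<Rightarrow> 'w \<Rightarrow> 'w \<Rightarrow> real" where
  "pair_sum I X M f1 f2 h B1 B2 \<omega> \<omega>' =
     (\<Sum>p\<in>labels I X B1 \<omega>. \<Sum>q\<in>labels I X B2 \<omega>'. f1 (M p \<omega>) * f2 (M q \<omega>') * h (X q \<omega>' - X p \<omega>))"

definition pair_functional :: "('m::polish_space \<Rightarrow> real) \<Rightarrow> ('m \<Rightarrow> real) \<Rightarrow> (real ^ 'd \<Rightarrow> real) \<Rightarrow> (real ^ 'd) set \<Rightarrow> (real ^ 'd) set \<Rightarrow>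
    ((real ^ 'd) \<times> 'm) measure \<Rightarrow> ((real ^ 'd) \<times> 'm) measure \<Rightarrow> real" where
  "pair_functional f1 f2 h B1 B2 \<mu> \<nu> =
     window_integral B1 (\<lambda>e. window_integral B2 (\<lambda>e'. f1 (snd e) * f2 (snd e') * h (fst e' - fst e)) \<nu>) \<mu>"

lemma borel_measurable_pair_functional:
  fixes f1 f2 :: "'m::polish_space \<Rightarrow> real" and h :: "real ^ 'd \<Rightarrow> real"
  assumes [measurable]: "f1 \<in> borel_measurable borel" "f2 \<in> borel_measurable borel" "h \<in> borel_measurable borel"
    and B: "B1 \<in> sets borel" "B2 \<in> sets borel"
    and \<psi>: "\<psi>1 \<in> N \<rightarrow>\<^sub>M measure_algebra borel" "\<psi>2 \<in> N \<rightarrow>\<^sub>M measure_algebra borel"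
  shows "(\<lambda>x. pair_functional f1 f2 h B1 B2 (\<psi>1 x) (\<psi>2 x)) \<in> borel_measurable N"
  unfolding pair_functional_def
proof (rule borel_measurable_window_integral[OF \<psi>(1) B(1)])
  have eq: "sets (borel \<Otimes>\<^sub>M borel) = sets (borel :: ((real ^ 'd) \<times> 'm) measure)" by (simp only: borel_prod)
  note [measurable_cong] = eq[symmetric]
  have "(\<lambda>p. window_integral B2 (\<lambda>e'. f1 (snd (snd p)) * f2 (snd e') * h (fst e' - fst (snd p))) (\<psi>2 (fst p)))
      \<in> borel_measurable (N \<Otimes>\<^sub>M borel)"
    by (rule borel_measurable_window_integral[OF measurable_compose[OF measurable_fst \<psi>(2)] B(2)]) measurable
  then show "(\<lambda>(x, e). window_integral B2 (\<lambda>e'. f1 (snd e) * f2 (snd e') * h (fst e' - fst e)) (\<psi>2 x))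
      \<in> borel_measurable (N \<Otimes>\<^sub>M borel)"
    by (simp add: case_prod_beta)
qed

lemma pair_functional_mpp:
  fixes f1 f2 :: "'m::polish_space \<Rightarrow> real" and h :: "real ^ 'd \<Rightarrow> real"
  assumes [measurable]: "f1 \<in> borel_measurable borel" "f2 \<in> borel_measurable borel" "h \<in> borel_measurable borel"
    and B: "B1 \<in> sets borel" "B2 \<in> sets borel"
  shows "pair_functional f1 f2 h B1 B2 (mpp I X M \<omega>) (mpp I' X M \<omega>') =
    (\<Sum>p\<in>labels I X B1 \<omega>. \<Sum>q\<in>labels I' X B2 \<omega>'. f1 (M p \<omega>) * f2 (M q \<omega>') * h (X q \<omega>' - X p \<omega>))"
proof -
  have eq: "sets (borel \<Otimes>\<^sub>M borel) = sets (borel :: ((real ^ 'd) \<times> 'm) measure)" by (simp only: borel_prod)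
  note [measurable_cong] = eq[symmetric]
  have inner: "window_integral B2 (\<lambda>e'. f1 (snd e) * f2 (snd e') * h (fst e' - fst e)) (mpp I' X M \<omega>')
     = (\<Sum>q\<in>labels I' X B2 \<omega>'. f1 (snd e) * f2 (M q \<omega>') * h (X q \<omega>' - fst e))" for e
    by (subst window_integral_mpp[OF B(2)]) auto
  show ?thesis
    unfolding pair_functional_def inner by (subst window_integral_mpp[OF B(1)]) auto
qed

section \<open>Unit cubes and blocks of unit cubes\<close>

definition ivec :: "int ^ 'd \<Rightarrow> real ^ 'd" where
  "ivec z = (\<chi> i. of_int (z $ i))"

lemma ivec_simps [simp]: "ivec z $ i = of_int (z $ i)" "ivec (- z) = - ivec z" "ivec (z + z') = ivec z + ivec z'" "ivec 0 = 0"
  by (auto simp: ivec_def vec_eq_iff)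

definition lattice_block :: "nat \<Rightarrow> int ^ 'd \<Rightarrow> (int ^ 'd) set" where
  "lattice_block A v = {u. \<forall>i. \<bar>u $ i - v $ i\<bar> \<le> int A}"

definition floor_vec :: "real ^ 'd \<Rightarrow> int ^ 'd" where
  "floor_vec x = (\<chi> i. \<lfloor>x $ i\<rfloor>)"

text \<open>
  The half-open unit cube with lower corner \<open>z\<close>.
\<close>

definition lattice_cube :: "int ^ 'd \<Rightarrow> (real ^ 'd) set" where
  "lattice_cube z = {x. floor_vec x = z}"

definition cube_block :: "nat \<Rightarrow> int ^ 'd \<Rightarrow> (real ^ 'd) set" where
  "cube_block A z = {x. floor_vec x \<in> lattice_block A z}"

definition sup_norm :: "int ^ 'd \<Rightarrow> nat" where
  "sup_norm u = nat (Max (range (\<lambda>i. \<bar>u $ i\<bar>)))"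

lemma sup_norm_le_iff: "sup_norm u \<le> n \<longleftrightarrow> (\<forall>i. \<bar>u $ i\<bar> \<le> int n)"
  by (simp add: sup_norm_def nat_le_iff)

lemma sup_norm_attained: "\<exists>i. \<bar>u $ i\<bar> = int (sup_norm u)"
proof -
  have "Max (range (\<lambda>i. \<bar>u $ i\<bar>)) \<in> range (\<lambda>i. \<bar>u $ i\<bar>)" by (rule Max_in) auto
  then obtain i where "Max (range (\<lambda>i. \<bar>u $ i\<bar>)) = \<bar>u $ i\<bar>" by blast
  then show ?thesis by (auto simp: sup_norm_def intro: exI[of _ i])
qed

lemma lattice_block_iff: "u \<in> lattice_block A v \<longleftrightarrow> sup_norm (u - v) \<le> A"
  by (simp add: lattice_block_def sup_norm_le_iff)

lemma lattice_block_0: "lattice_block 0 v = {v}"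
  by (auto simp: lattice_block_def vec_eq_iff)

lemma card_lattice_block: 
  fixes v :: "int ^ 'd"
  shows "finite (lattice_block A v)" "card (lattice_block A v) = (2 * A + 1) ^ CARD('d)"
proof -
  have "bij_betw vec_nth (lattice_block A v) (PiE UNIV (\<lambda>i. {v $ i - int A..v $ i + int A}))"
  proof (rule bij_betwI[of _ _ _ vec_lambda])
    show "vec_nth \<in> lattice_block A v \<rightarrow> (\<Pi>\<^sub>E i\<in>UNIV. {v $ i - int A..v $ i + int A})"
    proof
      fix u assume u: "u \<in> lattice_block A v"
      have "v $ i - int A \<le> u $ i \<and> u $ i \<le> v $ i + int A" for i
      proof -
        have "\<bar>u $ i - v $ i\<bar> \<le> int A" using u by (simp add: lattice_block_def)
        then show ?thesis by linarith
      qed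
      then show "vec_nth u \<in> (\<Pi>\<^sub>E i\<in>UNIV. {v $ i - int A..v $ i + int A})" by auto
    qed
    show "vec_lambda \<in> (\<Pi>\<^sub>E i\<in>UNIV. {v $ i - int A..v $ i + int A}) \<rightarrow> lattice_block A v"
    proof (rule funcsetI)
      fix f assume "f \<in> (\<Pi>\<^sub>E i\<in>UNIV. {v $ i - int A..v $ i + int A})"
      then have f: "f i \<in> {v $ i - int A..v $ i + int A}" for i by blast
      have "\<bar>f i - v $ i\<bar> \<le> int A" for i using f[of i] by (simp add: abs_le_iff)
      then show "vec_lambda f \<in> lattice_block A v" by (simp add: lattice_block_def)
    qed
  qed (auto simp: vec_lambda_inverse)
  moreover have "finite (PiE UNIV (\<lambda>i. {v $ i - int A..v $ i + int A}))" by (intro finite_PiE) auto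
  ultimately show "finite (lattice_block A v)" "card (lattice_block A v) = (2 * A + 1) ^ CARD('d)"
    by (auto simp: bij_betw_finite bij_betw_same_card card_PiE prod_constant nat_add_distrib nat_mult_distrib)
qed

lemma lattice_cube_eq_translate: "lattice_cube z = translate (ivec z) unit_cube"
  unfolding lattice_cube_def translate_def unit_cube_def floor_vec_def
  by (simp add: vec_eq_iff floor_eq_iff algebra_simps)

lemma translate_lattice_cube: "translate (ivec z) (lattice_cube u) = lattice_cube (u + z)"
  unfolding lattice_cube_eq_translate translate_def by (simp add: algebra_simps)

lemma cube_block_eq: "cube_block A z = (\<Union>u\<in>lattice_block A z. lattice_cube u)"
  by (auto simp: cube_block_def lattice_cube_def)

lemma cube_block_0: "cube_block 0 z = lattice_cube z"
  by (simp add: cube_block_eq lattice_block_0)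

lemma translate_cube_block: "translate (ivec z) (cube_block A u) = cube_block A (u + z)"
proof -
  have eq: "floor_vec (x - ivec z) = floor_vec x - z" for x
    by (simp add: floor_vec_def vec_eq_iff)
  then show ?thesis
    unfolding translate_def cube_block_def lattice_block_iff by (simp add: eq diff_diff_eq add.commute)
qed

lemma sets_unit_cube: "(unit_cube :: (real ^ 'd) set) \<in> sets borel"
proof -
  have "{x :: real ^ 'd. \<forall>i. x $ i \<in> {0..<1}} = (\<Inter>i. (\<lambda>x. x $ i) -` {0..<1} \<inter> space borel)" by auto
  moreover have "(\<lambda>x :: real ^ 'd. x $ i) -` {0..<1} \<inter> space borel \<in> sets borel" for i
    by (rule measurable_sets[of _ borel borel]) (auto intro!: borel_measurable_continuous_onI continuous_intros)
  then have "(\<Inter>i. (\<lambda>x :: real ^ 'd. x $ i) -` {0..<1} \<inter> space borel) \<in> sets borel"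
    by (intro sets.finite_INT) auto
  ultimately show ?thesis by (simp add: unit_cube_def)
qed

lemma sets_lattice_cube: "lattice_cube z \<in> sets borel"
  unfolding lattice_cube_eq_translate by (intro sets_translate sets_unit_cube)

lemma sets_cube_block: "cube_block A z \<in> sets borel"
  unfolding cube_block_eq by (intro sets.finite_UN card_lattice_block sets_lattice_cube)

lemma sets_cube: "(cube a :: (real ^ 'd) set) \<in> sets borel"
proof -
  have "(cube a :: (real ^ 'd) set) = cbox (\<chi> i. - a) (\<chi> i. a)" by (auto simp: cube_def mem_box_cart)
  then show ?thesis by simp
qed

lemma mem_cube_iff: "x \<in> cube a \<longleftrightarrow> (\<forall>i. \<bar>x $ i\<bar> \<le> a)"
  unfolding cube_def mem_Collect_eq by (intro iff_allI) linarith

lemma abs_floor_bounds: "\<bar>x\<bar> \<le> \<bar>of_int \<lfloor>x\<rfloor>\<bar> + (1::real)" "\<bar>of_int \<lfloor>x\<rfloor>\<bar> \<le> \<bar>x\<bar> + (1::real)"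
  by linarith+

lemma cube_block_subset_cube: "cube_block A 0 \<subseteq> cube (real A + 1)"
proof
  fix x :: "real ^ 'd" assume "x \<in> cube_block A 0"
  then have "\<bar>\<lfloor>x $ i\<rfloor>\<bar> \<le> int A" for i by (simp add: cube_block_def lattice_block_def floor_vec_def)
  then have "\<bar>x $ i\<bar> \<le> real A + 1" for i
  proof -
    have "of_int \<bar>\<lfloor>x $ i\<rfloor>\<bar> \<le> (of_int (int A) :: real)" using \<open>\<bar>\<lfloor>x $ i\<rfloor>\<bar> \<le> int A\<close> by (simp only: of_int_le_iff)
    then show ?thesis using abs_floor_bounds(1)[of "x $ i"] by simp
  qed
  then show "x \<in> cube (real A + 1)" by (simp add: mem_cube_iff)
qed

text \<open>
  The block lies outside \<open>cube (n - A - 1)\<close> for \<open>n = sup_norm v\<close>. The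
  condition \<open>n > 3 (A + 1)\<close> leaves a third of the distance \<open>n\<close> as gap
  between this block and the block around the origin.
\<close>

lemma cube_block_subset_Compl_cube:
  fixes v :: "int ^ 'd"
  assumes "3 * (real A + 1) < real (sup_norm v)"
  shows "cube_block A v \<subseteq> - cube (real A + 1 + real (sup_norm v) / 3)"
proof
  fix x :: "real ^ 'd" assume x: "x \<in> cube_block A v"
  have arith: "a + 1 + n / 3 < y" if "n - a - 1 \<le> y" "3 * (a + 1) < n" for a n y :: real
  proof -
    have "a + 1 < n / 3" using that(2) by (simp add: less_divide_eq)
    moreover have "n = n / 3 + n / 3 + n / 3" by simp
    ultimately show ?thesis using that(1) by linarith
  qed
  obtain i where i: "\<bar>v $ i\<bar> = int (sup_norm v)" using sup_norm_attained by blast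
  have "\<bar>\<lfloor>x $ i\<rfloor> - v $ i\<bar> \<le> int A" using x by (simp add: cube_block_def lattice_block_def floor_vec_def)
  then have "int (sup_norm v) - int A \<le> \<bar>\<lfloor>x $ i\<rfloor>\<bar>" using i by linarith
  then have "real (sup_norm v) - real A \<le> \<bar>of_int \<lfloor>x $ i\<rfloor>\<bar>"
  proof -
    have "(of_int (int (sup_norm v) - int A) :: real) \<le> of_int \<bar>\<lfloor>x $ i\<rfloor>\<bar>"
      using \<open>int (sup_norm v) - int A \<le> \<bar>\<lfloor>x $ i\<rfloor>\<bar>\<close> by (simp only: of_int_le_iff)
    then show ?thesis by simp
  qed
  then have "real (sup_norm v) - real A - 1 \<le> \<bar>x $ i\<bar>" using abs_floor_bounds(2)[of "x $ i"] by linarith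
  then have "real A + 1 + real (sup_norm v) / 3 < \<bar>x $ i\<bar>" using assms arith by blast
  then show "x \<in> - cube (real A + 1 + real (sup_norm v) / 3)"
    unfolding Compl_iff mem_cube_iff not_all not_le by (intro exI[of _ i])
qed

lemma bounded_cube_block:
  fixes v :: "int ^ 'd"
  shows "bounded (cube_block A v)"
proof -
  have "bounded (cube (real A + 1) :: (real ^ 'd) set)"
  proof (rule boundedI)
    fix x :: "real ^ 'd" assume "x \<in> cube (real A + 1)"
    then have "(\<Sum>i\<in>UNIV. \<bar>x $ i\<bar>) \<le> (\<Sum>i\<in>(UNIV :: 'd set). real A + 1)"
      by (intro sum_mono) (simp add: mem_cube_iff)
    then show "norm x \<le> (\<Sum>i\<in>(UNIV :: 'd set). real A + 1)" using norm_le_l1_cart[of x] by linarith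
  qed
  then have b: "bounded (cube_block A 0 :: (real ^ 'd) set)"
    by (rule bounded_subset[OF _ cube_block_subset_cube])
  have "cube_block A v = translate (ivec v) (cube_block A 0)" by (simp add: translate_cube_block)
  also have "\<dots> \<subseteq> (\<lambda>x. ivec v + x) ` cube_block A 0"
  proof
    fix x assume "x \<in> translate (ivec v) (cube_block A 0)"
    then show "x \<in> (\<lambda>x. ivec v + x) ` cube_block A 0"
      by (intro image_eqI[of _ _ "x - ivec v"]) (simp_all add: translate_def)
  qed
  finally show ?thesis using bounded_subset[OF bounded_translation[OF b]] by blast
qed

lemma lattice_cube_subset_block: "lattice_cube z \<subseteq> cube_block A z"
  unfolding cube_block_eq by (intro UN_upper) (simp add: lattice_block_def)

lemma translate_mono: "B \<subseteq> B' \<Longrightarrow> translate z B \<subseteq> translate z B'"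
  by (auto simp: translate_def)

lemma translate_back:
  assumes "B \<subseteq> cube_block A (z + u)" shows "translate (ivec (- z)) B \<subseteq> cube_block A u"
  using translate_mono[OF assms, of "ivec (- z)"] unfolding translate_cube_block by simp

lemma floor_diff_le:
  fixes a b :: real
  assumes "\<bar>a - b\<bar> \<le> real n" shows "\<bar>\<lfloor>a\<rfloor> - \<lfloor>b\<rfloor>\<bar> \<le> int n"
proof -
  have "\<lfloor>a\<rfloor> \<le> \<lfloor>b + of_int (int n)\<rfloor>" "\<lfloor>b\<rfloor> \<le> \<lfloor>a + of_int (int n)\<rfloor>"
    using assms by (intro floor_mono; simp add: abs_le_iff; linarith)+
  then show ?thesis unfolding floor_add_int[symmetric] by linarith
qed

lemma bounded_unit_cube: "bounded (unit_cube :: (real ^ 'd) set)"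
proof -
  have eq: "(unit_cube :: (real ^ 'd) set) = cube_block 0 0"
    by (simp add: cube_block_0 lattice_cube_eq_translate translate_def)
  show ?thesis unfolding eq by (rule bounded_cube_block)
qed

section \<open>Moments and mixing for a stationary marked point process\<close>

text \<open>
  With \<open>m\<close> the mean of the \<open>a i\<close>, sum the tangent bound
  \<open>x\<^bsup>s\<^esup> \<ge> s x - s + 1\<close> over \<open>x = a i / m\<close>. The
  tangent bound is Young's inequality.
\<close>

lemma power_mean_inequality:
  fixes a :: "'i \<Rightarrow> real"
  assumes "finite S" "\<And>i. i \<in> S \<Longrightarrow> 0 \<le> a i" and s: "1 \<le> s"
  shows "(\<Sum>i\<in>S. a i) powr s \<le> real (card S) powr (s - 1) * (\<Sum>i\<in>S. a i powr s)"
proof (cases "(\<Sum>i\<in>S. a i) = 0")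
  case False
  define n where "n = real (card S)"
  define m where "m = (\<Sum>i\<in>S. a i) / n"
  have "S \<noteq> {}" using False by auto
  then have n: "0 < n" using assms(1) by (simp add: n_def card_gt_0_iff)
  have sum: "0 < (\<Sum>i\<in>S. a i)" using False sum_nonneg[OF assms(2)] by (simp add: less_le)
  then have m: "0 < m" using n by (simp add: m_def)
  have bern: "s * x - s + 1 \<le> x powr s" if "0 \<le> x" for x
  proof (cases "x = 0")
    case False
    then have "(x powr s) powr (1 / s) * 1 powr (1 - 1 / s) \<le> 1 / s * x powr s + (1 - 1 / s) * 1"
      using that s by (intro Youngs_inequality_0) auto
    moreover have "(x powr s) powr (1 / s) = x" using that s by (simp add: powr_powr)
    moreover have "1 / s * x powr s + (1 - 1 / s) * 1 = (x powr s + s - 1) / s" using s by (simp add: field_simps)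
    ultimately have "x \<le> (x powr s + s - 1) / s" by simp
    then have "x * s \<le> x powr s + s - 1" using s by (simp add: pos_le_divide_eq)
    then show ?thesis by (simp add: mult.commute)
  qed (use s in simp)
  have "(\<Sum>i\<in>S. s * (a i / m) - s + 1) \<le> (\<Sum>i\<in>S. (a i / m) powr s)"
    using m assms(2) by (intro sum_mono bern) auto
  also have "(\<Sum>i\<in>S. s * (a i / m) - s + 1) = n"
  proof -
    have "(\<Sum>i\<in>S. s * (a i / m) - s + 1) = (\<Sum>i\<in>S. s * (a i / m)) - n * s + n"
      by (simp add: sum.distrib sum_subtractf n_def)
    also have "(\<Sum>i\<in>S. s * (a i / m)) = s * ((\<Sum>i\<in>S. a i) / m)"
      by (simp only: sum_distrib_left sum_divide_distrib)
    also have "(\<Sum>i\<in>S. a i) / m = n" using m n sum by (simp add: m_def)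
    finally show ?thesis by simp
  qed
  also have "(\<Sum>i\<in>S. (a i / m) powr s) = (\<Sum>i\<in>S. a i powr s) / m powr s"
    using m assms(2) by (simp add: powr_divide sum_divide_distrib)
  finally have "n * m powr s \<le> (\<Sum>i\<in>S. a i powr s)" using m by (simp add: field_simps)
  moreover have "n * m powr s = n powr (1 - s) * (\<Sum>i\<in>S. a i) powr s"
  proof -
    have "n powr (1 - s) = n / n powr s" using n by (simp add: powr_diff)
    moreover have "m powr s = (\<Sum>i\<in>S. a i) powr s / n powr s" unfolding m_def by (rule powr_divide)
    ultimately show ?thesis by simp
  qed
  ultimately have "n powr (s - 1) * (n powr (1 - s) * (\<Sum>i\<in>S. a i) powr s) \<le> n powr (s - 1) * (\<Sum>i\<in>S. a i powr s)"
    using n by (intro mult_left_mono) simp_all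
  moreover have "n powr (s - 1) * n powr (1 - s) = 1" using n by (simp flip: powr_add)
  ultimately show ?thesis by (simp add: n_def mult.assoc[symmetric])
next
  case True
  have "0 \<le> real (card S) powr (s - 1) * (\<Sum>i\<in>S. a i powr s)"
    by (intro mult_nonneg_nonneg sum_nonneg) auto
  then show ?thesis unfolding True by simp
qed

lemma powr_le_one_plus_powr:
  fixes m :: real
  assumes "0 \<le> m" "0 \<le> r" "r \<le> s"
  shows "m powr r \<le> 1 + m powr s"
proof (cases "m \<le> 1")
  case True
  then have "m powr r \<le> 1" using assms by (simp add: powr_le1)
  then show ?thesis by (simp add: add_increasing2)
next
  case False
  then have "m powr r \<le> m powr s" using assms by (intro powr_mono) auto
  then show ?thesis by simp
qed

text \<open>
  Everything is compared with the larger factor. These crude bounds replace Hoelder's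
  inequality: only the moment of order \<open>s = 4 + \<delta>\<close> of the counts has to be
  known.
\<close>

lemma product_powr_bounds:
  fixes x y :: real
  assumes "0 \<le> x" "0 \<le> y" "4 \<le> s"
  shows "(x * y) powr (s / 4) \<le> 1 + x powr s + y powr s"
    and "(x * y)\<^sup>2 \<le> 1 + x powr s + y powr s"
    and "x * y \<le> 1 + x powr s + y powr s"
proof -
  define m where "m = max x y"
  have m: "0 \<le> m" using assms by (simp add: m_def)
  have xy: "x * y \<le> m powr 2" "0 \<le> x * y"
    using assms m mult_mono[of x m y m] by (auto simp: m_def power2_eq_square powr_numeral)
  have ms: "m powr s \<le> x powr s + y powr s" by (cases "x \<le> y") (auto simp: m_def max_def)
  have "(x * y) powr r \<le> 1 + x powr s + y powr s" if "0 \<le> r" "2 * r \<le> s" for r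
  proof -
    have "(x * y) powr r \<le> (m powr 2) powr r" using xy that by (intro powr_mono2) auto
    also have "\<dots> \<le> 1 + m powr s" unfolding powr_powr using m that by (intro powr_le_one_plus_powr) auto
    finally show ?thesis using ms by linarith
  qed
  from this[of "s / 4"] this[of 2] this[of 1] assms xy
  show "(x * y) powr (s / 4) \<le> 1 + x powr s + y powr s"
    and "(x * y)\<^sup>2 \<le> 1 + x powr s + y powr s"
    and "x * y \<le> 1 + x powr s + y powr s" by (simp_all add: powr_numeral)
qed

lemma product4_powr_bound:
  fixes x y u v :: real
  assumes "0 \<le> x" "0 \<le> y" "0 \<le> u" "0 \<le> v" "4 \<le> s"
  shows "(x * y * (u * v)) powr (s / 4) \<le> x powr s + y powr s + (u powr s + v powr s)"
proof -
  define m where "m = max (max x y) (max u v)"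
  have m: "0 \<le> m" using assms by (simp add: m_def le_max_iff_disj)
  have "x * y * (u * v) \<le> m * m * (m * m)"
    using assms m by (intro mult_mono mult_nonneg_nonneg) (auto simp: m_def)
  then have "x * y * (u * v) \<le> m powr 4" using m by (simp add: powr_numeral power4_eq_xxxx mult.assoc)
  then have "(x * y * (u * v)) powr (s / 4) \<le> (m powr 4) powr (s / 4)"
    using assms by (intro powr_mono2) auto
  also have "\<dots> = m powr s" by (simp add: powr_powr)
  also have "\<dots> \<le> x powr s + y powr s + (u powr s + v powr s)"
  proof -
    have "m = x \<or> m = y \<or> m = u \<or> m = v" by (auto simp: m_def max_def)
    then show ?thesis by (auto simp: add_increasing add_increasing2)
  qed
  finally show ?thesis .
qed

text \<open>
  The standing hypotheses on the process, with \<open>K\<close> a bound for the moment of order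
  \<open>4 + \<delta>\<close> of the number of points in a unit cube and the witness
  \<open>c0\<close> of the mixing rate made explicit.
\<close>

locale mixing_mpp = prob_space P for P :: "'w measure" +
  fixes I :: "'w \<Rightarrow> nat set" and X :: "nat \<Rightarrow> 'w \<Rightarrow> real ^ 'd" and M :: "nat \<Rightarrow> 'w \<Rightarrow> 'm::polish_space"
    and \<delta> K c0 :: real and \<beta> :: "real \<Rightarrow> real"
  assumes mpp_measurable: "mpp I X M \<in> P \<rightarrow>\<^sub>M measure_algebra borel"
    and locally_finite: "AE \<omega> in P. \<forall>B. bounded B \<longrightarrow> finite (labels I X B \<omega>)"
    and stationary: "stationary_mpp P I X M"
    and delta_pos: "0 < \<delta>" and K_nonneg: "0 \<le> K"
    and moment: "(\<integral>\<^sup>+\<omega>. ennreal (real (card (labels I X unit_cube \<omega>)) powr (4 + \<delta>)) \<partial>P) \<le> ennreal K"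
    and \<beta>_nonneg: "\<And>r. 1 / 2 \<le> r \<Longrightarrow> 0 \<le> \<beta> r"
    and \<beta>_antimono: "\<And>r s. 1 / 2 \<le> r \<Longrightarrow> r \<le> s \<Longrightarrow> \<beta> s \<le> \<beta> r"
    and c0: "1 \<le> c0"
    and mixing: "\<And>a b. 1 / 2 \<le> a \<Longrightarrow> a \<le> b / c0 \<Longrightarrow>
        beta_coefficient P (sigma_algebra_on P I X M (cube a)) (sigma_algebra_on P I X M (- cube (a + b))) \<le> \<beta> b"
begin

text \<open>
  The \<open>\<sigma>\<close>-algebra of events determined by the process in \<open>B\<close>.
\<close>

definition window_algebra :: "(real ^ 'd) set \<Rightarrow> 'w measure" where
  "window_algebra B = vimage_algebra (space P) (mpp (labels I X B) X M) (measure_algebra borel)"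

lemma sets_window_algebra: "sets (window_algebra B) = sigma_algebra_on P I X M B"
proof -
  have "labels I X B = (\<lambda>\<omega>. {n \<in> I \<omega>. X n \<omega> \<in> B})" by (simp add: fun_eq_iff labels_def)
  then show ?thesis by (simp add: window_algebra_def sigma_algebra_on_def)
qed

lemma space_window_algebra [simp]: "space (window_algebra B) = space P" by (simp add: window_algebra_def)

lemma emeasure_mpp_measurable:
  "A \<in> sets borel \<Longrightarrow> (\<lambda>\<omega>. emeasure (mpp I X M \<omega>) A) \<in> borel_measurable P"
  by (rule measurable_compose[OF mpp_measurable measurable_emeasure_measure_algebra])

lemma mpp_labels_measurable:
  assumes B: "B \<in> sets borel"
  shows "mpp (labels I X B) X M \<in> P \<rightarrow>\<^sub>M measure_algebra borel"
proof (rule measurable_measure_algebraI)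
  fix A :: "((real ^ 'd) \<times> 'm) set" assume A: "A \<in> sets borel"
  have S: "A \<inter> B \<times> UNIV \<in> sets borel" using A sets_strip[OF B, of UNIV] by auto
  have "emeasure (mpp (labels I X B) X M \<omega>) A = emeasure (mpp I X M \<omega>) (A \<inter> B \<times> UNIV)" for \<omega>
    by (simp add: emeasure_mpp[OF A] emeasure_mpp[OF S] labels_def) (simp add: conj_ac)
  then show "(\<lambda>\<omega>. emeasure (mpp (labels I X B) X M \<omega>) A) \<in> borel_measurable P"
    using emeasure_mpp_measurable[OF S] by simp
qed (simp add: mpp_def)

lemma mpp_window_algebra_measurable: "mpp (labels I X B) X M \<in> window_algebra B \<rightarrow>\<^sub>M measure_algebra borel"
  unfolding window_algebra_def by (rule measurable_vimage_algebra1) (auto simp: space_measure_algebra mpp_def)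

lemma sets_window_algebra_subset: "B \<in> sets borel \<Longrightarrow> sets (window_algebra B) \<subseteq> events"
  unfolding window_algebra_def using mpp_labels_measurable[of B]
  by (subst sets_vimage_algebra2) (auto simp: space_measure_algebra mpp_def)

lemma mpp_shift_measurable: "mpp I (\<lambda>n \<omega>. X n \<omega> - z) M \<in> P \<rightarrow>\<^sub>M measure_algebra borel"
proof (rule measurable_measure_algebraI)
  fix A :: "((real ^ 'd) \<times> 'm) set" assume A: "A \<in> sets borel"
  have eq: "sets (borel \<Otimes>\<^sub>M borel) = sets (borel :: ((real ^ 'd) \<times> 'm) measure)" by (simp only: borel_prod)
  have "(\<lambda>e. (fst e - z, snd e)) \<in> (borel \<Otimes>\<^sub>M borel) \<rightarrow>\<^sub>M (borel \<Otimes>\<^sub>M borel :: ((real ^ 'd) \<times> 'm) measure)" by measurable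
  then have "(\<lambda>e. (fst e - z, snd e)) \<in> borel \<rightarrow>\<^sub>M (borel :: ((real ^ 'd) \<times> 'm) measure)"
    by (simp only: borel_prod)
  from measurable_sets[OF this A] have S: "{e. (fst e - z, snd e) \<in> A} \<in> sets borel" by (simp add: vimage_def)
  have "emeasure (mpp I (\<lambda>n \<omega>. X n \<omega> - z) M \<omega>) A = emeasure (mpp I X M \<omega>) {e. (fst e - z, snd e) \<in> A}" for \<omega>
    by (simp add: emeasure_mpp[OF A] emeasure_mpp[OF S])
  then show "(\<lambda>\<omega>. emeasure (mpp I (\<lambda>n \<omega>. X n \<omega> - z) M \<omega>) A) \<in> borel_measurable P"
    using emeasure_mpp_measurable[OF S] by simp
qed (simp add: mpp_def)

text \<open>
  Stationarity in the form in which it is used: expectations of measurable functionals of the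
  counting measure do not change if all locations are shifted.
\<close>

lemma stationary_integral:
  fixes F :: "((real ^ 'd) \<times> 'm) measure \<Rightarrow> real"
  assumes F: "F \<in> borel_measurable (measure_algebra borel)"
  shows "expectation (\<lambda>\<omega>. F (mpp I (\<lambda>n \<omega>. X n \<omega> - z) M \<omega>)) = expectation (\<lambda>\<omega>. F (mpp I X M \<omega>))"
  using integral_distr[OF mpp_measurable F] integral_distr[OF mpp_shift_measurable F, of z] stationary
  unfolding stationary_mpp_def by metis

lemma stationary_nn_integral:
  assumes F: "F \<in> borel_measurable (measure_algebra borel)"
  shows "(\<integral>\<^sup>+\<omega>. F (mpp I (\<lambda>n \<omega>. X n \<omega> - z) M \<omega>) \<partial>P) = (\<integral>\<^sup>+\<omega>. F (mpp I X M \<omega>) \<partial>P)"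
proof -
  have "(\<integral>\<^sup>+\<mu>. F \<mu> \<partial>distr P (measure_algebra borel) (mpp I X M)) = (\<integral>\<^sup>+\<omega>. F (mpp I X M \<omega>) \<partial>P)"
    using F by (intro nn_integral_distr mpp_measurable) simp
  moreover have "(\<integral>\<^sup>+\<mu>. F \<mu> \<partial>distr P (measure_algebra borel) (mpp I (\<lambda>n \<omega>. X n \<omega> - z) M)) = (\<integral>\<^sup>+\<omega>. F (mpp I (\<lambda>n \<omega>. X n \<omega> - z) M \<omega>) \<partial>P)"
    using F by (intro nn_integral_distr mpp_shift_measurable) simp
  ultimately show ?thesis using stationary unfolding stationary_mpp_def by metis
qed

definition npoints :: "(real ^ 'd) set \<Rightarrow> 'w \<Rightarrow> real" where "npoints B \<omega> = real (card (labels I X B \<omega>))"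

lemma npoints_nonneg [simp]: "0 \<le> npoints B \<omega>" by (simp add: npoints_def)

lemma window_integral_1_measurable:
  fixes B :: "(real ^ 'd) set"
  assumes "B \<in> sets borel"
  shows "window_integral B (\<lambda>_. 1) \<in> borel_measurable (measure_algebra (borel :: ((real ^ 'd) \<times> 'm) measure))"
  by (rule borel_measurable_window_integral[OF measurable_ident_sets[OF refl] assms]) simp

lemma npoints_measurable: "B \<in> sets borel \<Longrightarrow> npoints B \<in> borel_measurable P"
  using measurable_compose[OF mpp_measurable window_integral_1_measurable[of B]]
  by (simp add: window_integral_mpp npoints_def[abs_def])

lemma moment_lattice_cube:
  "(\<integral>\<^sup>+\<omega>. ennreal (npoints (lattice_cube z) \<omega> powr (4 + \<delta>)) \<partial>P) \<le> ennreal K"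
proof -
  let ?F = "\<lambda>\<mu>. ennreal (window_integral unit_cube (\<lambda>_. 1) \<mu> powr (4 + \<delta>))"
  have F: "?F \<in> borel_measurable (measure_algebra (borel :: ((real ^ 'd) \<times> 'm) measure))"
    using window_integral_1_measurable[OF sets_unit_cube] by measurable
  have "(\<integral>\<^sup>+\<omega>. ennreal (npoints (lattice_cube z) \<omega> powr (4 + \<delta>)) \<partial>P) = (\<integral>\<^sup>+\<omega>. ?F (mpp I (\<lambda>n \<omega>. X n \<omega> - ivec z) M \<omega>) \<partial>P)"
    by (simp add: window_integral_mpp[OF sets_unit_cube] labels_shift npoints_def lattice_cube_eq_translate)
  also have "\<dots> = (\<integral>\<^sup>+\<omega>. ?F (mpp I X M \<omega>) \<partial>P)" by (rule stationary_nn_integral[OF F])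
  also have "\<dots> = (\<integral>\<^sup>+\<omega>. ennreal (real (card (labels I X unit_cube \<omega>)) powr (4 + \<delta>)) \<partial>P)"
    by (simp add: window_integral_mpp[OF sets_unit_cube])
  finally show ?thesis using moment by simp
qed

definition block_size :: "nat \<Rightarrow> real" where "block_size A = real ((2 * A + 1) ^ CARD('d))"

lemma block_size_pos [simp]: "0 < block_size A" "0 \<le> block_size A" by (simp_all add: block_size_def)

lemma block_size_0 [simp]: "block_size 0 = 1" by (simp add: block_size_def)

text \<open>
  The average number of points per unit cube of a block. By the power mean inequality its moment
  of order \<open>4 + \<delta>\<close> is at most \<open>K\<close> for every block.
\<close>

definition mean_count :: "nat \<Rightarrow> int ^ 'd \<Rightarrow> 'w \<Rightarrow> real" where "mean_count A z \<omega> = npoints (cube_block A z) \<omega> / block_size A"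

lemma mean_count_nonneg [simp]: "0 \<le> mean_count A z \<omega>" by (simp add: mean_count_def)

lemma mean_count_measurable [measurable]: "mean_count A z \<in> borel_measurable P"
  unfolding mean_count_def[abs_def] using npoints_measurable[OF sets_cube_block] by measurable

lemma npoints_cube_block_le: "npoints (cube_block A z) \<omega> \<le> (\<Sum>u\<in>lattice_block A z. npoints (lattice_cube u) \<omega>)"
proof -
  have "labels I X (cube_block A z) \<omega> = (\<Union>u\<in>lattice_block A z. labels I X (lattice_cube u) \<omega>)"
    by (auto simp: labels_def cube_block_eq)
  then have "card (labels I X (cube_block A z) \<omega>) \<le> (\<Sum>u\<in>lattice_block A z. card (labels I X (lattice_cube u) \<omega>))"
    by (simp add: card_UN_le card_lattice_block)
  then show ?thesis unfolding npoints_def by (metis of_nat_le_iff of_nat_sum)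
qed

lemma moment_block: "(\<integral>\<^sup>+\<omega>. ennreal (mean_count A z \<omega> powr (4 + \<delta>)) \<partial>P) \<le> ennreal K"
proof -
  let ?s = "4 + \<delta>" and ?S = "lattice_block A z"
  have card: "real (card ?S) = block_size A" by (simp add: card_lattice_block block_size_def)
  have le: "mean_count A z \<omega> powr ?s \<le> (1 / block_size A) * (\<Sum>u\<in>?S. npoints (lattice_cube u) \<omega> powr ?s)" for \<omega>
  proof -
    have "npoints (cube_block A z) \<omega> powr ?s \<le> (\<Sum>u\<in>?S. npoints (lattice_cube u) \<omega>) powr ?s"
      using npoints_cube_block_le delta_pos by (intro powr_mono2) auto
    also have "\<dots> \<le> block_size A powr (?s - 1) * (\<Sum>u\<in>?S. npoints (lattice_cube u) \<omega> powr ?s)"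
      using power_mean_inequality[of ?S "\<lambda>u. npoints (lattice_cube u) \<omega>" ?s] delta_pos by (simp add: card card_lattice_block(1))
    finally have "mean_count A z \<omega> powr ?s \<le> block_size A powr (?s - 1) * (\<Sum>u\<in>?S. npoints (lattice_cube u) \<omega> powr ?s) / block_size A powr ?s"
      unfolding mean_count_def by (simp add: powr_divide divide_right_mono)
    also have "block_size A powr (?s - 1) = block_size A powr ?s / block_size A" using powr_diff[of "block_size A" ?s 1] by simp
    finally show ?thesis using less_imp_neq[OF block_size_pos(1)[of A]] by simp
  qed
  note [measurable] = npoints_measurable[OF sets_lattice_cube]
  have "(\<integral>\<^sup>+\<omega>. ennreal (mean_count A z \<omega> powr ?s) \<partial>P) \<le> (\<integral>\<^sup>+\<omega>. ennreal (1 / block_size A) * (\<Sum>u\<in>?S. ennreal (npoints (lattice_cube u) \<omega> powr ?s)) \<partial>P)"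
  proof (intro nn_integral_mono)
    fix \<omega>
    have "ennreal (1 / block_size A * (\<Sum>u\<in>?S. npoints (lattice_cube u) \<omega> powr ?s)) = ennreal (1 / block_size A) * (\<Sum>u\<in>?S. ennreal (npoints (lattice_cube u) \<omega> powr ?s))"
      by (subst ennreal_mult) (auto intro: sum_nonneg simp: sum_ennreal)
    then show "ennreal (mean_count A z \<omega> powr ?s) \<le> ennreal (1 / block_size A) * (\<Sum>u\<in>?S. ennreal (npoints (lattice_cube u) \<omega> powr ?s))"
      using ennreal_leI[OF le] by metis
  qed
  also have "\<dots> = ennreal (1 / block_size A) * (\<Sum>u\<in>?S. (\<integral>\<^sup>+\<omega>. ennreal (npoints (lattice_cube u) \<omega> powr ?s) \<partial>P))"
    by (simp add: nn_integral_cmult nn_integral_sum del: sum_ennreal)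
  also have "\<dots> \<le> ennreal (1 / block_size A) * (\<Sum>u\<in>?S. ennreal K)"
    by (intro mult_left_mono sum_mono moment_lattice_cube) auto
  also have "\<dots> = ennreal (1 / block_size A) * (ennreal (block_size A) * ennreal K)"
    by (simp add: card_lattice_block block_size_def ennreal_of_nat_eq_real_of_nat)
  also have "\<dots> = ennreal K" using K_nonneg less_imp_neq[OF block_size_pos(1)[of A]]
    by (simp flip: ennreal_mult)
  finally show ?thesis .
qed

lemma nn_integral_fst_snd:
  assumes "f \<in> borel_measurable P"
  shows "(\<integral>\<^sup>+p. f (fst p) \<partial>(P \<Otimes>\<^sub>M P)) = (\<integral>\<^sup>+x. f x \<partial>P)" "(\<integral>\<^sup>+p. f (snd p) \<partial>(P \<Otimes>\<^sub>M P)) = (\<integral>\<^sup>+x. f x \<partial>P)"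
proof -
  interpret PP: pair_prob_space P P ..
  note [measurable] = assms
  show "(\<integral>\<^sup>+p. f (fst p) \<partial>(P \<Otimes>\<^sub>M P)) = (\<integral>\<^sup>+x. f x \<partial>P)"
    by (subst nn_integral_fst[symmetric]) (auto simp: emeasure_space_1)
  show "(\<integral>\<^sup>+p. f (snd p) \<partial>(P \<Otimes>\<^sub>M P)) = (\<integral>\<^sup>+x. f x \<partial>P)"
    by (subst nn_integral_fst[symmetric]) (auto simp: emeasure_space_1)
qed



text \<open>
  The blocks of radius \<open>A\<close> around \<open>0\<close> and \<open>u\<close> are so far
  apart that the mixing rate applies to \<open>cube (A + 1)\<close> with gap
  \<open>|u|/3\<close>; this requires \<open>A + 1 \<le> |u| / (3 c0)\<close>, and the added
  \<open>1\<close> makes the separation of the blocks strict.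
\<close>

definition far :: "nat \<Rightarrow> int ^ 'd \<Rightarrow> bool" where
  "far A u \<longleftrightarrow> 3 * c0 * (real A + 1) + 1 \<le> real (sup_norm u)"

definition \<theta> :: real where "\<theta> = \<delta> / (4 + \<delta>)"

text \<open>
  Bound for the correlation of normalised functionals of the blocks around \<open>0\<close> and
  \<open>u\<close>. The first constant comes from \<open>far_integral_diff\<close>, the second
  bounds second moments of near blocks.
\<close>

definition cov_bound :: "nat \<Rightarrow> int ^ 'd \<Rightarrow> real" where
  "cov_bound A u = (if far A u then 2 * (2 + 4 * K) * (2 * \<beta> (real (sup_norm u) / 3)) powr \<theta> else 2 * (1 + 2 * K)\<^sup>2)"

lemma cov_bound_nonneg: "0 \<le> cov_bound A u" using K_nonneg by (simp add: cov_bound_def)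

text \<open>
  The mixing inequality for two distant blocks, with \<open>q = (4 + \<delta>) / 4\<close>.
\<close>

lemma far_integral_diff:
  assumes far: "far A u" and G: "G \<in> borel_measurable (window_algebra (cube (real A + 1)) \<Otimes>\<^sub>M window_algebra (- cube (real A + 1 + real (sup_norm u) / 3)))"
    and K1: "(\<integral>\<^sup>+\<omega>. ennreal (\<bar>G (\<omega>, \<omega>)\<bar> powr ((4 + \<delta>) / 4)) \<partial>P) \<le> ennreal (1 + 4 * K)"
    and K2: "(\<integral>\<^sup>+p. ennreal (\<bar>G p\<bar> powr ((4 + \<delta>) / 4)) \<partial>(P \<Otimes>\<^sub>M P)) \<le> ennreal (1 + 4 * K)"
  shows "\<bar>expectation (\<lambda>\<omega>. G (\<omega>, \<omega>)) - (\<integral>p. G p \<partial>(P \<Otimes>\<^sub>M P))\<bar> \<le> cov_bound A u"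
proof -
  let ?a = "real A + 1" and ?b = "real (sup_norm u) / 3"
  let ?A = "window_algebra (cube ?a)" and ?B = "window_algebra (- cube (?a + ?b))"
  let ?c = "beta_coefficient P (sets ?A) (sets ?B)"
  have sub: "sets ?A \<subseteq> events" "sets ?B \<subseteq> events" using sets_window_algebra_subset[OF sets_cube] sets_window_algebra_subset[OF borel_comp[OF sets_cube]] by blast+
  have "c0 * ?a \<le> ?b" using far unfolding far_def mult.assoc by linarith
  then have ac: "?a * c0 \<le> ?b" by (simp only: mult.commute)
  have ab: "?a \<le> ?b / c0"
  proof (subst pos_le_divide_eq)
    show "0 < c0" using c0 by simp
    show "?a * c0 \<le> ?b" by (rule ac)
  qed
  have \<beta>: "?c \<le> \<beta> ?b" using mixing[OF _ ab] by (simp add: sets_window_algebra)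
  have pos: "0 \<le> ?c" using total_variation_le_beta_coefficient[of ?A ?B "{}"] sub by simp
  have q: "1 - 1 / ((4 + \<delta>) / 4) = \<theta>" using delta_pos by (simp add: \<theta>_def field_simps)
  have "\<bar>expectation (\<lambda>\<omega>. G (\<omega>, \<omega>)) - (\<integral>p. G p \<partial>(P \<Otimes>\<^sub>M P))\<bar> \<le> 2 * (1 + (1 + 4 * K)) * (2 * ?c) powr (1 - 1 / ((4 + \<delta>) / 4))"
    using sub delta_pos K_nonneg by (intro beta_mixing_integral_diff[OF _ _ _ _ G _ _ K1 K2]) auto
  also have "\<dots> \<le> 2 * (1 + (1 + 4 * K)) * (2 * \<beta> ?b) powr \<theta>"
    unfolding q using \<beta> pos K_nonneg delta_pos by (intro mult_left_mono powr_mono2) (auto simp: \<theta>_def)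
  finally show ?thesis using far by (simp add: cov_bound_def)
qed

lemma far_block_subsets:
  fixes u :: "int ^ 'd"
  assumes "far A u"
  shows "cube_block A u \<subseteq> - cube (real A + 1 + real (sup_norm u) / 3)"
proof (rule cube_block_subset_Compl_cube)
  have "3 * (real A + 1) \<le> 3 * c0 * (real A + 1)" using c0 by (intro mult_right_mono) auto
  then show "3 * (real A + 1) < real (sup_norm u)" using assms unfolding far_def by linarith
qed

definition loc_finite :: "'w \<Rightarrow> bool" where
  "loc_finite \<omega> \<longleftrightarrow> (\<forall>B. bounded B \<longrightarrow> finite (labels I X B \<omega>))"

lemma AE_loc_finite: "AE \<omega> in P. loc_finite \<omega>" using locally_finite by (simp add: loc_finite_def)

text \<open>
  The set of locally finite realisations need not be measurable, so it is replaced by the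
  complement of a null set that contains all exceptions.
\<close>

lemma AE_loc_finite_pair: "AE p in P \<Otimes>\<^sub>M P. loc_finite (fst p) \<and> loc_finite (snd p)"
proof -
  interpret PP: pair_prob_space P P ..
  obtain N0 where N0: "{\<omega> \<in> space P. \<not> loc_finite \<omega>} \<subseteq> N0" "N0 \<in> null_sets P" using AE_loc_finite by (auto elim!: AE_E)
  have [measurable]: "N0 \<in> sets P" using N0 by auto
  have nn: "AE \<omega> in P. \<omega> \<notin> N0" using N0(2) by (rule AE_not_in)
  have "AE p in P \<Otimes>\<^sub>M P. fst p \<notin> N0 \<and> snd p \<notin> N0"
  proof (rule PP.AE_pair_measure)
    show "AE x in P. AE y in P. fst (x, y) \<notin> N0 \<and> snd (x, y) \<notin> N0"
      using nn by (rule eventually_mono) (use nn in auto)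
  qed measurable
  then show ?thesis
    by (rule AE_mp) (use N0(1) in \<open>auto simp: space_pair_measure intro!: AE_I2\<close>)
qed

lemma npoints_mono:
  assumes "loc_finite \<omega>" "bounded B'" "B \<subseteq> B'"
  shows "npoints B \<omega> \<le> npoints B' \<omega>"
  using assms labels_mono[of B B' I X \<omega>] by (auto simp: npoints_def loc_finite_def intro!: card_mono)

lemma mean_count_integrable: "integrable P (mean_count A z)"
  by (rule integrable_of_powr[OF prob_space_axioms mean_count_measurable, of "4 + \<delta>" _ _ K])
     (use moment_block[of A z] delta_pos in auto)

lemma npoints_cube_block: "npoints (cube_block A z) \<omega> = block_size A * mean_count A z \<omega>"
  using less_imp_neq[OF block_size_pos(1)[of A]] by (simp add: mean_count_def)

text \<open>
  The right-hand sides of \<open>product_powr_bounds\<close> and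
  \<open>product4_powr_bound\<close>, integrated under the law of the process and under the
  product law.
\<close>

lemma mean_count_moments2:
  shows "(\<integral>\<^sup>+\<omega>. ennreal (1 + mean_count A z \<omega> powr (4 + \<delta>) + mean_count A' z' \<omega> powr (4 + \<delta>)) \<partial>P) \<le> ennreal (1 + 2 * K)"
    and "(\<integral>\<^sup>+p. ennreal (1 + mean_count A z (fst p) powr (4 + \<delta>) + mean_count A' z' (snd p) powr (4 + \<delta>)) \<partial>(P \<Otimes>\<^sub>M P)) \<le> ennreal (1 + 2 * K)"
proof -
  interpret PP: pair_prob_space P P ..
  have e: "ennreal (1 + 2 * K) = 1 + ennreal K + ennreal K"
    using K_nonneg by (simp flip: ennreal_plus ennreal_1)
  have "(\<integral>\<^sup>+\<omega>. ennreal (1 + mean_count A z \<omega> powr (4 + \<delta>) + mean_count A' z' \<omega> powr (4 + \<delta>)) \<partial>P)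
     = 1 + (\<integral>\<^sup>+\<omega>. ennreal (mean_count A z \<omega> powr (4 + \<delta>)) \<partial>P) + (\<integral>\<^sup>+\<omega>. ennreal (mean_count A' z' \<omega> powr (4 + \<delta>)) \<partial>P)"
    by (simp add: nn_integral_add emeasure_space_1)
  then show "(\<integral>\<^sup>+\<omega>. ennreal (1 + mean_count A z \<omega> powr (4 + \<delta>) + mean_count A' z' \<omega> powr (4 + \<delta>)) \<partial>P) \<le> ennreal (1 + 2 * K)"
    unfolding e by (auto intro!: add_mono moment_block)
  have "(\<integral>\<^sup>+p. ennreal (1 + mean_count A z (fst p) powr (4 + \<delta>) + mean_count A' z' (snd p) powr (4 + \<delta>)) \<partial>(P \<Otimes>\<^sub>M P))
     = 1 + (\<integral>\<^sup>+p. ennreal (mean_count A z (fst p) powr (4 + \<delta>)) \<partial>(P \<Otimes>\<^sub>M P)) + (\<integral>\<^sup>+p. ennreal (mean_count A' z' (snd p) powr (4 + \<delta>)) \<partial>(P \<Otimes>\<^sub>M P))"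
    by (simp add: nn_integral_add PP.emeasure_space_1)
  then show "(\<integral>\<^sup>+p. ennreal (1 + mean_count A z (fst p) powr (4 + \<delta>) + mean_count A' z' (snd p) powr (4 + \<delta>)) \<partial>(P \<Otimes>\<^sub>M P)) \<le> ennreal (1 + 2 * K)"
    unfolding e using nn_integral_fst_snd(1)[of "\<lambda>\<omega>. ennreal (mean_count A z \<omega> powr (4 + \<delta>))"] nn_integral_fst_snd(2)[of "\<lambda>\<omega>. ennreal (mean_count A' z' \<omega> powr (4 + \<delta>))"]
    by (auto intro!: add_mono moment_block)
qed

lemma mean_count_moments4:
  shows "(\<integral>\<^sup>+\<omega>. ennreal (mean_count 0 z \<omega> powr (4 + \<delta>) + mean_count A z \<omega> powr (4 + \<delta>) + (mean_count 0 z' \<omega> powr (4 + \<delta>) + mean_count A z' \<omega> powr (4 + \<delta>))) \<partial>P) \<le> ennreal (1 + 4 * K)"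
    and "(\<integral>\<^sup>+p. ennreal (mean_count 0 z (fst p) powr (4 + \<delta>) + mean_count A z (fst p) powr (4 + \<delta>) + (mean_count 0 z' (snd p) powr (4 + \<delta>) + mean_count A z' (snd p) powr (4 + \<delta>))) \<partial>(P \<Otimes>\<^sub>M P)) \<le> ennreal (1 + 4 * K)"
proof -
  have e: "(ennreal K + ennreal K) + (ennreal K + ennreal K) \<le> ennreal (1 + 4 * K)"
    using K_nonneg by (simp flip: ennreal_plus)
  note m = nn_integral_fst_snd[of "\<lambda>\<omega>. ennreal (mean_count _ _ \<omega> powr (4 + \<delta>))", simplified]
  show "(\<integral>\<^sup>+\<omega>. ennreal (mean_count 0 z \<omega> powr (4 + \<delta>) + mean_count A z \<omega> powr (4 + \<delta>) + (mean_count 0 z' \<omega> powr (4 + \<delta>) + mean_count A z' \<omega> powr (4 + \<delta>))) \<partial>P) \<le> ennreal (1 + 4 * K)"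
    by (rule order.trans[OF _ e]) (simp add: nn_integral_add, intro add_mono moment_block)
  show "(\<integral>\<^sup>+p. ennreal (mean_count 0 z (fst p) powr (4 + \<delta>) + mean_count A z (fst p) powr (4 + \<delta>) + (mean_count 0 z' (snd p) powr (4 + \<delta>) + mean_count A z' (snd p) powr (4 + \<delta>))) \<partial>(P \<Otimes>\<^sub>M P)) \<le> ennreal (1 + 4 * K)"
    by (rule order.trans[OF _ e]) (simp add: nn_integral_add m, intro add_mono moment_block)
qed

lemma window_sum_measurable:
  fixes g :: "(real ^ 'd) \<times> 'm \<Rightarrow> real"
  assumes "B \<in> sets borel" "g \<in> borel_measurable borel"
  shows "(\<lambda>\<omega>. \<Sum>n\<in>labels I X B \<omega>. g (X n \<omega>, M n \<omega>)) \<in> borel_measurable P"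
proof -
  have "(\<lambda>\<omega>. window_integral B g (mpp I X M \<omega>)) \<in> borel_measurable P"
    by (rule borel_measurable_window_integral[OF mpp_measurable assms(1)]) (use assms(2) in simp)
  then show ?thesis by (simp add: window_integral_mpp[OF assms])
qed

end

text \<open>
  Pair sums are studied for two arbitrary bounded mark functions. Centring is a separate
  hypothesis of the lemmas on means.
\<close>

locale bounded_marks = mixing_mpp P I X M \<delta> K c0 \<beta>
  for P :: "'w measure" and I :: "'w \<Rightarrow> nat set" and X :: "nat \<Rightarrow> 'w \<Rightarrow> real ^ 'd" and M :: "nat \<Rightarrow> 'w \<Rightarrow> 'm::polish_space"
    and \<delta> K c0 :: real and \<beta> :: "real \<Rightarrow> real" +
  fixes f1 f2 :: "'m \<Rightarrow> real"
  assumes f_measurable [measurable]: "f1 \<in> borel_measurable borel" "f2 \<in> borel_measurable borel"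
    and f_le: "\<And>m. \<bar>f1 m\<bar> \<le> 1" "\<And>m. \<bar>f2 m\<bar> \<le> 1"
begin

abbreviation pairs :: "(real ^ 'd \<Rightarrow> real) \<Rightarrow> (real ^ 'd) set \<Rightarrow> (real ^ 'd) set \<Rightarrow> 'w \<Rightarrow> 'w \<Rightarrow> real" where
  "pairs \<equiv> pair_sum I X M f1 f2"

lemma pairs_abs_le:
  assumes h: "\<And>x. \<bar>h x\<bar> \<le> H"
  shows "\<bar>pairs h B1 B2 \<omega> \<omega>'\<bar> \<le> H * (npoints B1 \<omega> * npoints B2 \<omega>')"
proof -
  have H: "0 \<le> H" using h[of 0] by linarith
  have term_le: "\<bar>f1 m * f2 m' * h x\<bar> \<le> H" for m m' x
  proof -
    have "\<bar>f1 m\<bar> * \<bar>f2 m'\<bar> * \<bar>h x\<bar> \<le> 1 * 1 * H"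
      using f_le h H by (intro mult_mono) auto
    then show ?thesis by (simp add: abs_mult)
  qed
  have "\<bar>pairs h B1 B2 \<omega> \<omega>'\<bar> \<le> (\<Sum>p\<in>labels I X B1 \<omega>. \<Sum>q\<in>labels I X B2 \<omega>'. H)"
    unfolding pair_sum_def by (intro order.trans[OF sum_abs] sum_mono term_le)
  then show ?thesis by (simp add: npoints_def mult.commute mult.left_commute)
qed

text \<open>
  A pair sum in two windows depends only on the restrictions of the process to larger sets
  \<open>B\<close> and \<open>B'\<close>; this gives its measurability for the corresponding
  \<open>\<sigma>\<close>-algebras.
\<close>

lemma pairs_eq_functional:
  assumes h: "h \<in> borel_measurable borel" and B: "B1 \<in> sets borel" "B2 \<in> sets borel" "B1 \<subseteq> B" "B2 \<subseteq> B'"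
  shows "pairs h B1 B2 \<omega> \<omega>' = pair_functional f1 f2 h B1 B2 (mpp (labels I X B) X M \<omega>) (mpp (labels I X B') X M \<omega>')"
  by (subst pair_functional_mpp[OF f_measurable h B(1,2)]) (simp add: pair_sum_def labels_labels B(3,4))

lemma pairs_eq_functional0:
  assumes h: "h \<in> borel_measurable borel" and B: "B1 \<in> sets borel" "B2 \<in> sets borel"
  shows "pairs h B1 B2 \<omega> \<omega>' = pair_functional f1 f2 h B1 B2 (mpp I X M \<omega>) (mpp I X M \<omega>')"
  by (subst pair_functional_mpp[OF f_measurable h B]) (simp add: pair_sum_def)

lemma pairs_measurable:
  assumes h: "h \<in> borel_measurable borel" and B: "B1 \<in> sets borel" "B2 \<in> sets borel"
  shows "(\<lambda>\<omega>. pairs h B1 B2 \<omega> \<omega>) \<in> borel_measurable P"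
  unfolding pairs_eq_functional0[OF h B]
  by (rule borel_measurable_pair_functional[OF f_measurable h B mpp_measurable mpp_measurable])

lemma pairs_measurable_pair:
  assumes h: "h \<in> borel_measurable borel" and B: "B1 \<in> sets borel" "B2 \<in> sets borel"
  shows "(\<lambda>p. pairs h B1 B2 (fst p) (snd p)) \<in> borel_measurable (P \<Otimes>\<^sub>M P)"
  unfolding pairs_eq_functional0[OF h B]
  by (rule borel_measurable_pair_functional[OF f_measurable h B
        measurable_compose[OF measurable_fst mpp_measurable] measurable_compose[OF measurable_snd mpp_measurable]])

lemma pairs_window_algebra_measurable:
  assumes h: "h \<in> borel_measurable borel" and B: "B1 \<in> sets borel" "B2 \<in> sets borel" "B1 \<subseteq> B" "B2 \<subseteq> B"
  shows "(\<lambda>\<omega>. pairs h B1 B2 \<omega> \<omega>) \<in> borel_measurable (window_algebra B)"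
  unfolding pairs_eq_functional[OF h B]
  by (rule borel_measurable_pair_functional[OF f_measurable h B(1,2) mpp_window_algebra_measurable mpp_window_algebra_measurable])

lemma pairs_window_algebra_measurable_pair:
  assumes h: "h \<in> borel_measurable borel" and B: "B1 \<in> sets borel" "B2 \<in> sets borel" "B1 \<subseteq> B" "B2 \<subseteq> B'"
  shows "(\<lambda>p. pairs h B1 B2 (fst p) (snd p)) \<in> borel_measurable (window_algebra B \<Otimes>\<^sub>M window_algebra B')"
  unfolding pairs_eq_functional[OF h B]
  by (rule borel_measurable_pair_functional[OF f_measurable h B(1,2)
        measurable_compose[OF measurable_fst mpp_window_algebra_measurable] measurable_compose[OF measurable_snd mpp_window_algebra_measurable]])

lemma pairs_product_translate:
  assumes h: "h \<in> borel_measurable borel" "h' \<in> borel_measurable borel"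
    and B: "B1 \<in> sets borel" "B2 \<in> sets borel" and B': "B1' \<in> sets borel" "B2' \<in> sets borel"
  shows "expectation (\<lambda>\<omega>. pairs h (translate z B1) (translate z B2) \<omega> \<omega> * pairs h' (translate z B1') (translate z B2') \<omega> \<omega>)
     = expectation (\<lambda>\<omega>. pairs h B1 B2 \<omega> \<omega> * pairs h' B1' B2' \<omega> \<omega>)"
proof -
  let ?F = "\<lambda>\<mu>. pair_functional f1 f2 h B1 B2 \<mu> \<mu> * pair_functional f1 f2 h' B1' B2' \<mu> \<mu>"
  have F: "?F \<in> borel_measurable (measure_algebra borel)"
    by (intro borel_measurable_times borel_measurable_pair_functional f_measurable h B B' measurable_ident_sets[OF refl])
  have 1: "pair_functional f1 f2 h B1 B2 (mpp I (\<lambda>n \<omega>. X n \<omega> - z) M \<omega>) (mpp I (\<lambda>n \<omega>. X n \<omega> - z) M \<omega>) = pairs h (translate z B1) (translate z B2) \<omega> \<omega>"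
    if "h \<in> borel_measurable borel" "B1 \<in> sets borel" "B2 \<in> sets borel" for h B1 B2 \<omega>
    by (subst pair_functional_mpp[OF f_measurable that]) (simp add: pair_sum_def labels_shift)
  show ?thesis
    using stationary_integral[OF F, of z] h B B' by (simp add: 1 pairs_eq_functional0)
qed

text \<open>
  The summand depends on the locations only through their difference, so shifting the process is
  the same as shifting both windows.
\<close>

lemma pairs_translate:
  assumes h: "h \<in> borel_measurable borel" and B: "B1 \<in> sets borel" "B2 \<in> sets borel"
  shows "expectation (\<lambda>\<omega>. pairs h (translate z B1) (translate z B2) \<omega> \<omega>) = expectation (\<lambda>\<omega>. pairs h B1 B2 \<omega> \<omega>)"
proof -
  let ?F = "\<lambda>\<mu>. pair_functional f1 f2 h B1 B2 \<mu> \<mu>"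
  have F: "?F \<in> borel_measurable (measure_algebra borel)"
    by (intro borel_measurable_pair_functional f_measurable h B measurable_ident_sets[OF refl])
  have 1: "?F (mpp I (\<lambda>n \<omega>. X n \<omega> - z) M \<omega>) = pairs h (translate z B1) (translate z B2) \<omega> \<omega>" for \<omega>
    by (subst pair_functional_mpp[OF f_measurable h B]) (simp add: pair_sum_def labels_shift)
  show ?thesis
    using stationary_integral[OF F, of z] h B by (simp add: 1 pairs_eq_functional0)
qed

lemma pairs_block_le:
  assumes "loc_finite \<omega>" "loc_finite \<omega>'" and h: "\<And>x. \<bar>h x\<bar> \<le> 1" and B: "B1 \<subseteq> cube_block A z" "B2 \<subseteq> cube_block A' z'"
  shows "\<bar>pairs h B1 B2 \<omega> \<omega>'\<bar> \<le> block_size A * block_size A' * (mean_count A z \<omega> * mean_count A' z' \<omega>')"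
proof -
  have "\<bar>pairs h B1 B2 \<omega> \<omega>'\<bar> \<le> 1 * (npoints B1 \<omega> * npoints B2 \<omega>')" by (rule pairs_abs_le[OF h])
  also have "\<dots> \<le> npoints (cube_block A z) \<omega> * npoints (cube_block A' z') \<omega>'"
    using npoints_mono[OF assms(1) bounded_cube_block B(1)] npoints_mono[OF assms(2) bounded_cube_block B(2)] by (simp add: mult_mono)
  finally show ?thesis by (simp add: npoints_cube_block mult_ac)
qed

lemma pairs_pair_moments:
  assumes h: "h \<in> borel_measurable borel" "\<And>x. \<bar>h x\<bar> \<le> 1"
    and B: "B1 \<subseteq> lattice_cube z" "B2 \<subseteq> lattice_cube z'" "B1 \<in> sets borel" "B2 \<in> sets borel"
  shows "(\<integral>\<^sup>+\<omega>. ennreal (\<bar>pairs h B1 B2 \<omega> \<omega>\<bar> powr ((4 + \<delta>) / 4)) \<partial>P) \<le> ennreal (1 + 2 * K)"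
    and "(\<integral>\<^sup>+p. ennreal (\<bar>pairs h B1 B2 (fst p) (snd p)\<bar> powr ((4 + \<delta>) / 4)) \<partial>(P \<Otimes>\<^sub>M P)) \<le> ennreal (1 + 2 * K)"
    and "expectation (\<lambda>\<omega>. \<bar>pairs h B1 B2 \<omega> \<omega>\<bar>) \<le> 1 + 2 * K"
proof -
  have le: "\<bar>pairs h B1 B2 \<omega> \<omega>'\<bar> \<le> mean_count 0 z \<omega> * mean_count 0 z' \<omega>'" if "loc_finite \<omega>" "loc_finite \<omega>'" for \<omega> \<omega>'
    using pairs_block_le[OF that h(2), of B1 0 z B2 0 z'] B(1,2) by (simp add: cube_block_0)
  have le': "\<bar>pairs h B1 B2 \<omega> \<omega>'\<bar> powr ((4 + \<delta>) / 4) \<le> 1 + mean_count 0 z \<omega> powr (4 + \<delta>) + mean_count 0 z' \<omega>' powr (4 + \<delta>)" if "loc_finite \<omega>" "loc_finite \<omega>'" for \<omega> \<omega>'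
  proof -
    have "\<bar>pairs h B1 B2 \<omega> \<omega>'\<bar> powr ((4 + \<delta>) / 4) \<le> (mean_count 0 z \<omega> * mean_count 0 z' \<omega>') powr ((4 + \<delta>) / 4)"
      using le[OF that] delta_pos by (intro powr_mono2) auto
    also have "\<dots> \<le> 1 + mean_count 0 z \<omega> powr (4 + \<delta>) + mean_count 0 z' \<omega>' powr (4 + \<delta>)"
      using delta_pos by (intro product_powr_bounds) auto
    finally show ?thesis .
  qed
  show 1: "(\<integral>\<^sup>+\<omega>. ennreal (\<bar>pairs h B1 B2 \<omega> \<omega>\<bar> powr ((4 + \<delta>) / 4)) \<partial>P) \<le> ennreal (1 + 2 * K)"
    by (rule order.trans[OF nn_integral_mono_AE mean_count_moments2(1)[of 0 z 0 z']])
       (rule eventually_mono[OF AE_loc_finite], rule ennreal_leI, rule le', assumption+)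
  show "(\<integral>\<^sup>+p. ennreal (\<bar>pairs h B1 B2 (fst p) (snd p)\<bar> powr ((4 + \<delta>) / 4)) \<partial>(P \<Otimes>\<^sub>M P)) \<le> ennreal (1 + 2 * K)"
    by (rule order.trans[OF nn_integral_mono_AE mean_count_moments2(2)[of 0 z 0 z']])
       (rule eventually_mono[OF AE_loc_finite_pair], rule ennreal_leI, rule le', blast+)
  have "integrable P (\<lambda>\<omega>. pairs h B1 B2 \<omega> \<omega>)"
    by (rule integrable_of_powr[OF prob_space_axioms pairs_measurable[OF h(1) B(3,4)] _ 1]) (use delta_pos in simp)
  then have "ennreal (expectation (\<lambda>\<omega>. \<bar>pairs h B1 B2 \<omega> \<omega>\<bar>)) = (\<integral>\<^sup>+\<omega>. ennreal \<bar>pairs h B1 B2 \<omega> \<omega>\<bar> \<partial>P)"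
    by (intro nn_integral_eq_integral[symmetric]) auto
  also have "\<dots> \<le> ennreal (1 + 2 * K)"
  proof (rule order.trans[OF nn_integral_mono_AE mean_count_moments2(1)[of 0 z 0 z']])
    have "\<bar>pairs h B1 B2 \<omega> \<omega>\<bar> \<le> 1 + mean_count 0 z \<omega> powr (4 + \<delta>) + mean_count 0 z' \<omega> powr (4 + \<delta>)" if "loc_finite \<omega>" for \<omega>
      using le[OF that that] product_powr_bounds(3)[of "mean_count 0 z \<omega>" "mean_count 0 z' \<omega>" "4 + \<delta>"] delta_pos by simp
    then show "AE \<omega> in P. ennreal \<bar>pairs h B1 B2 \<omega> \<omega>\<bar> \<le> ennreal (1 + mean_count 0 z \<omega> powr (4 + \<delta>) + mean_count 0 z' \<omega> powr (4 + \<delta>))"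
      by (intro eventually_mono[OF AE_loc_finite] ennreal_leI)
  qed
  finally show "expectation (\<lambda>\<omega>. \<bar>pairs h B1 B2 \<omega> \<omega>\<bar>) \<le> 1 + 2 * K"
    by (subst (asm) ennreal_le_iff) (use K_nonneg in auto)
qed

lemma pairs_integrable:
  assumes h: "h \<in> borel_measurable borel" "\<And>x. \<bar>h x\<bar> \<le> 1"
    and B: "B1 \<subseteq> lattice_cube z" "B2 \<subseteq> lattice_cube z'" "B1 \<in> sets borel" "B2 \<in> sets borel"
  shows "integrable P (\<lambda>\<omega>. pairs h B1 B2 \<omega> \<omega>)" "integrable (P \<Otimes>\<^sub>M P) (\<lambda>p. pairs h B1 B2 (fst p) (snd p))"
proof -
  interpret PP: pair_prob_space P P ..
  show "integrable P (\<lambda>\<omega>. pairs h B1 B2 \<omega> \<omega>)"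
    by (rule integrable_of_powr[OF prob_space_axioms pairs_measurable[OF h(1) B(3,4)] _ pairs_pair_moments(1)[OF h B]]) (use delta_pos in simp)
  show "integrable (P \<Otimes>\<^sub>M P) (\<lambda>p. pairs h B1 B2 (fst p) (snd p))"
    by (rule integrable_of_powr[OF PP.prob_space_axioms pairs_measurable_pair[OF h(1) B(3,4)] _ pairs_pair_moments(2)[OF h B]]) (use delta_pos in simp)
qed

end

section \<open>Expectations and covariances of pair sums in blocks\<close>

context mixing_mpp
begin

text \<open>
  The mark function has mean zero at every location: its sum has expectation zero even when
  points are weighted by a bounded function of their location.
\<close>

definition centred :: "('m \<Rightarrow> real) \<Rightarrow> bool" where
  "centred f \<longleftrightarrow> (\<forall>B h. B \<in> sets borel \<longrightarrow> bounded B \<longrightarrow> h \<in> borel_measurable borel \<longrightarrow> (\<forall>x. \<bar>h x\<bar> \<le> 1) \<longrightarrow>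
     expectation (\<lambda>\<omega>. \<Sum>q\<in>labels I X B \<omega>. f (M q \<omega>) * h (X q \<omega>)) = 0)"

lemma window_sum_integrable:
  fixes g :: "(real ^ 'd) \<times> 'm \<Rightarrow> real"
  assumes "B \<in> sets borel" "g \<in> borel_measurable borel" "\<And>e. \<bar>g e\<bar> \<le> 1" "B \<subseteq> cube_block A z"
  shows "integrable P (\<lambda>\<omega>. \<Sum>n\<in>labels I X B \<omega>. g (X n \<omega>, M n \<omega>))"
proof (rule Bochner_Integration.integrable_bound)
  show "integrable P (\<lambda>\<omega>. block_size A * mean_count A z \<omega>)" using mean_count_integrable by simp
  show "(\<lambda>\<omega>. \<Sum>n\<in>labels I X B \<omega>. g (X n \<omega>, M n \<omega>)) \<in> borel_measurable P"
    by (rule window_sum_measurable[OF assms(1,2)])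
  have "\<bar>\<Sum>n\<in>labels I X B \<omega>. g (X n \<omega>, M n \<omega>)\<bar> \<le> block_size A * mean_count A z \<omega>" if "loc_finite \<omega>" for \<omega>
  proof -
    have "\<bar>\<Sum>n\<in>labels I X B \<omega>. g (X n \<omega>, M n \<omega>)\<bar> \<le> (\<Sum>n\<in>labels I X B \<omega>. 1)"
      by (intro order.trans[OF sum_abs] sum_mono assms(3))
    also have "\<dots> = npoints B \<omega>" by (simp add: npoints_def)
    also have "\<dots> \<le> npoints (cube_block A z) \<omega>" by (rule npoints_mono[OF that bounded_cube_block assms(4)])
    finally show ?thesis by (simp add: npoints_cube_block)
  qed
  then show "AE \<omega> in P. norm (\<Sum>n\<in>labels I X B \<omega>. g (X n \<omega>, M n \<omega>)) \<le> norm (block_size A * mean_count A z \<omega>)"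
    by (intro eventually_mono[OF AE_loc_finite]) (simp add: abs_mult)
qed

lemma integral_product_independent:
  fixes t t' :: "'w \<Rightarrow> real"
  assumes "integrable (P \<Otimes>\<^sub>M P) (\<lambda>p. t (fst p) * t' (snd p))"
  shows "(\<integral>p. t (fst p) * t' (snd p) \<partial>(P \<Otimes>\<^sub>M P)) = expectation t * expectation t'"
proof -
  interpret PP: pair_prob_space P P ..
  have "(\<integral>p. t (fst p) * t' (snd p) \<partial>(P \<Otimes>\<^sub>M P)) = (\<integral>x. (\<integral>y. t x * t' y \<partial>P) \<partial>P)"
    using PP.integral_fst'[OF assms] by simp
  then show ?thesis by simp
qed

end

context bounded_marks
begin

text \<open>
  For independent copies, fix the first configuration. For each of its points the sum over the
  second configuration has expectation zero since \<open>f2\<close> is centred.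
\<close>

lemma pairs_independent_mean_zero:
  assumes cen: "centred f2" and h: "h \<in> borel_measurable borel" "\<And>x. \<bar>h x\<bar> \<le> 1"
    and B: "B1 \<subseteq> lattice_cube z" "B2 \<subseteq> lattice_cube z'" "B1 \<in> sets borel" "B2 \<in> sets borel"
  shows "(\<integral>p. pairs h B1 B2 (fst p) (snd p) \<partial>(P \<Otimes>\<^sub>M P)) = 0"
proof -
  interpret PP: pair_prob_space P P ..
  note [measurable] = h(1)
  have eq: "sets (borel \<Otimes>\<^sub>M borel) = sets (borel :: ((real ^ 'd) \<times> 'm) measure)" by (simp only: borel_prod)
  note [measurable_cong] = eq[symmetric]
  have bB: "bounded B2" "B2 \<subseteq> cube_block 0 z'" using B(2) bounded_subset[OF bounded_cube_block[of 0 z']] by (auto simp: cube_block_0)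
  have inner: "(\<integral>\<omega>'. pairs h B1 B2 \<omega> \<omega>' \<partial>P) = 0" for \<omega>
  proof -
    have int: "integrable P (\<lambda>\<omega>'. \<Sum>q\<in>labels I X B2 \<omega>'. f2 (M q \<omega>') * h (X q \<omega>' - x))" for x
    proof -
      have "\<bar>f2 (snd e) * h (fst e - x)\<bar> \<le> 1" for e
        using mult_mono[OF f_le(2)[of "snd e"] h(2)[of "fst e - x"]] by (simp add: abs_mult)
      then show ?thesis
        using window_sum_integrable[OF B(4) _ _ bB(2), of "\<lambda>e. f2 (snd e) * h (fst e - x)"] by simp
    qed
    have z: "(\<integral>\<omega>'. (\<Sum>q\<in>labels I X B2 \<omega>'. f2 (M q \<omega>') * h (X q \<omega>' - x)) \<partial>P) = 0" for x
      using cen[unfolded centred_def, rule_format, OF B(4) bB(1), of "\<lambda>y. h (y - x)"] h(2) by simp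
    have "(\<integral>\<omega>'. pairs h B1 B2 \<omega> \<omega>' \<partial>P) = (\<integral>\<omega>'. (\<Sum>p\<in>labels I X B1 \<omega>. f1 (M p \<omega>) * (\<Sum>q\<in>labels I X B2 \<omega>'. f2 (M q \<omega>') * h (X q \<omega>' - X p \<omega>))) \<partial>P)"
      by (simp add: pair_sum_def sum_distrib_left mult.assoc)
    also have "\<dots> = (\<Sum>p\<in>labels I X B1 \<omega>. \<integral>\<omega>'. f1 (M p \<omega>) * (\<Sum>q\<in>labels I X B2 \<omega>'. f2 (M q \<omega>') * h (X q \<omega>' - X p \<omega>)) \<partial>P)"
      using int by (intro Bochner_Integration.integral_sum integrable_mult_right)
    also have "\<dots> = 0" by (simp add: z)
    finally show ?thesis .
  qed
  have "(\<integral>p. pairs h B1 B2 (fst p) (snd p) \<partial>(P \<Otimes>\<^sub>M P)) = (\<integral>\<omega>. (\<integral>\<omega>'. pairs h B1 B2 \<omega> \<omega>' \<partial>P) \<partial>P)"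
    using PP.integral_fst'[OF pairs_integrable(2)[OF h B]] by simp
  then show ?thesis by (simp add: inner)
qed

text \<open>
  After a shift the first cube is at the origin. For distant cubes the mixing inequality
  compares the expectation with its value \<open>0\<close> for independent copies; otherwise
  moments suffice.
\<close>

lemma pair_expectation_bound:
  assumes cen: "centred f2" and h: "h \<in> borel_measurable borel" "\<And>x. \<bar>h x\<bar> \<le> 1"
    and B: "B1 \<subseteq> lattice_cube z" "B2 \<subseteq> lattice_cube z'" "B1 \<in> sets borel" "B2 \<in> sets borel"
  shows "\<bar>expectation (\<lambda>\<omega>. pairs h B1 B2 \<omega> \<omega>)\<bar> \<le> cov_bound 0 (z' - z)"
proof (cases "far 0 (z' - z)")
  case True
  define u where "u = z' - z"
  define B1' where "B1' = translate (ivec (- z)) B1"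
  define B2' where "B2' = translate (ivec (- z)) B2"
  have sub: "B1' \<subseteq> lattice_cube 0" "B2' \<subseteq> lattice_cube u"
    using translate_back[of B1 0 z 0] translate_back[of B2 0 z u] B(1,2) by (simp_all add: cube_block_0 B1'_def B2'_def u_def)
  have S: "B1' \<in> sets borel" "B2' \<in> sets borel" using B by (simp_all add: B1'_def B2'_def sets_translate)
  note B' = sub S
  have le: "ennreal (1 + 2 * K) \<le> ennreal (1 + 4 * K)" using K_nonneg by (intro ennreal_leI) simp
  have "\<bar>expectation (\<lambda>\<omega>. pairs h B1' B2' (fst (\<omega>, \<omega>)) (snd (\<omega>, \<omega>))) - (\<integral>p. pairs h B1' B2' (fst p) (snd p) \<partial>(P \<Otimes>\<^sub>M P))\<bar> \<le> cov_bound 0 u"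
  proof (rule far_integral_diff)
    show "far 0 u" using True by (simp add: u_def)
    have "B1' \<subseteq> cube (real 0 + 1)" using sub(1) cube_block_subset_cube[of 0] by (auto simp: cube_block_0)
    moreover have "B2' \<subseteq> - cube (real 0 + 1 + real (sup_norm u) / 3)"
      using sub(2) far_block_subsets[OF \<open>far 0 u\<close>] by (auto simp: cube_block_0)
    ultimately show "(\<lambda>p. pairs h B1' B2' (fst p) (snd p)) \<in> borel_measurable (window_algebra (cube (real 0 + 1)) \<Otimes>\<^sub>M window_algebra (- cube (real 0 + 1 + real (sup_norm u) / 3)))"
      by (rule pairs_window_algebra_measurable_pair[OF h(1) S])
    show "(\<integral>\<^sup>+\<omega>. ennreal (\<bar>pairs h B1' B2' (fst (\<omega>, \<omega>)) (snd (\<omega>, \<omega>))\<bar> powr ((4 + \<delta>) / 4)) \<partial>P) \<le> ennreal (1 + 4 * K)"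
      using pairs_pair_moments(1)[OF h B'] le by simp
    show "(\<integral>\<^sup>+p. ennreal (\<bar>pairs h B1' B2' (fst p) (snd p)\<bar> powr ((4 + \<delta>) / 4)) \<partial>(P \<Otimes>\<^sub>M P)) \<le> ennreal (1 + 4 * K)"
      using pairs_pair_moments(2)[OF h B'] le by simp
  qed
  then show ?thesis
    using pairs_independent_mean_zero[OF cen h B'] pairs_translate[OF h(1) B(3,4), of "ivec (- z)"]
    by (simp add: B1'_def B2'_def u_def)
next
  case False
  have "\<bar>expectation (\<lambda>\<omega>. pairs h B1 B2 \<omega> \<omega>)\<bar> \<le> expectation (\<lambda>\<omega>. \<bar>pairs h B1 B2 \<omega> \<omega>\<bar>)"
    using integral_abs_bound[of P "\<lambda>\<omega>. pairs h B1 B2 \<omega> \<omega>"] by simp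
  also have "\<dots> \<le> 1 + 2 * K" by (rule pairs_pair_moments(3)[OF h B])
  also have "\<dots> \<le> (1 + 2 * K)\<^sup>2" using K_nonneg by (intro self_le_power) auto
  finally show ?thesis using False by (simp add: cov_bound_def)
qed

text \<open>
  The pairs with first point in one unit cube and second point in the block around it, divided
  by the number of cubes in the block. The bound does not depend on the block radius.
\<close>

lemma block_sum_second_moment:
  assumes h: "h \<in> borel_measurable borel" "\<And>x. \<bar>h x\<bar> \<le> 1"
    and B: "B1 \<subseteq> lattice_cube z" "B2 \<subseteq> cube_block A z" "B1 \<in> sets borel" "B2 \<in> sets borel"
  defines "t \<equiv> \<lambda>\<omega>. pairs h B1 B2 \<omega> \<omega> / block_size A"
  shows "integrable P t" "integrable P (\<lambda>\<omega>. (t \<omega>)\<^sup>2)" "expectation (\<lambda>\<omega>. (t \<omega>)\<^sup>2) \<le> 1 + 2 * K"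
    and "loc_finite \<omega> \<Longrightarrow> \<bar>t \<omega>\<bar> \<le> mean_count 0 z \<omega> * mean_count A z \<omega>"
proof -
  have le: "\<bar>t \<omega>\<bar> \<le> mean_count 0 z \<omega> * mean_count A z \<omega>" if "loc_finite \<omega>" for \<omega>
    using pairs_block_le[OF that that h(2), of B1 0 z B2 A z] B(1,2)
    by (simp add: cube_block_0 t_def abs_mult divide_le_eq mult_ac)
  then show "loc_finite \<omega> \<Longrightarrow> \<bar>t \<omega>\<bar> \<le> mean_count 0 z \<omega> * mean_count A z \<omega>" .
  have m[measurable]: "t \<in> borel_measurable P" unfolding t_def using pairs_measurable[OF h(1) B(3,4)] by measurable
  have le2: "(t \<omega>)\<^sup>2 \<le> 1 + mean_count 0 z \<omega> powr (4 + \<delta>) + mean_count A z \<omega> powr (4 + \<delta>)" if "loc_finite \<omega>" for \<omega>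
  proof -
    have "\<bar>t \<omega>\<bar>\<^sup>2 \<le> (mean_count 0 z \<omega> * mean_count A z \<omega>)\<^sup>2" by (rule power_mono[OF le[OF that]]) simp
    also have "\<dots> \<le> 1 + mean_count 0 z \<omega> powr (4 + \<delta>) + mean_count A z \<omega> powr (4 + \<delta>)"
      using delta_pos by (intro product_powr_bounds) auto
    finally show ?thesis by simp
  qed
  have nn: "(\<integral>\<^sup>+\<omega>. ennreal ((t \<omega>)\<^sup>2) \<partial>P) \<le> ennreal (1 + 2 * K)"
    by (rule order.trans[OF nn_integral_mono_AE mean_count_moments2(1)[of 0 z A z]])
       (rule eventually_mono[OF AE_loc_finite], rule ennreal_leI, rule le2)
  then show i2: "integrable P (\<lambda>\<omega>. (t \<omega>)\<^sup>2)"
    by (intro integrableI_nonneg) (auto intro: le_less_trans)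
  then show "integrable P t" by (rule square_integrable_imp_integrable[OF m])
  have "ennreal (expectation (\<lambda>\<omega>. (t \<omega>)\<^sup>2)) \<le> ennreal (1 + 2 * K)"
    using nn nn_integral_eq_integral[OF i2] by simp
  then show "expectation (\<lambda>\<omega>. (t \<omega>)\<^sup>2) \<le> 1 + 2 * K"
    by (subst (asm) ennreal_le_iff) (use K_nonneg in auto)
qed

lemma block_sum_covariance_far:
  assumes h: "h \<in> borel_measurable borel" "\<And>x. \<bar>h x\<bar> \<le> 1" and far: "far A u"
    and B: "B1 \<subseteq> lattice_cube 0" "B2 \<subseteq> cube_block A 0" "B1 \<in> sets borel" "B2 \<in> sets borel"
    and B': "B1' \<subseteq> lattice_cube u" "B2' \<subseteq> cube_block A u" "B1' \<in> sets borel" "B2' \<in> sets borel"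
  defines "t \<equiv> \<lambda>\<omega>. pairs h B1 B2 \<omega> \<omega> / block_size A" and "t' \<equiv> \<lambda>\<omega>. pairs h B1' B2' \<omega> \<omega> / block_size A"
  shows "\<bar>expectation (\<lambda>\<omega>. t \<omega> * t' \<omega>) - expectation t * expectation t'\<bar> \<le> cov_bound A u"
proof -
  interpret PP: pair_prob_space P P ..
  let ?q = "(4 + \<delta>) / 4" and ?s = "4 + \<delta>"
  have s1: "B1 \<subseteq> cube (real A + 1)" "B2 \<subseteq> cube (real A + 1)"
    using B(1,2) cube_block_subset_cube[of A] lattice_cube_subset_block[of 0 A] by blast+
  have s2: "B1' \<subseteq> - cube (real A + 1 + real (sup_norm u) / 3)" "B2' \<subseteq> - cube (real A + 1 + real (sup_norm u) / 3)"
    using B'(1,2) far_block_subsets[OF far] lattice_cube_subset_block[of u A] by blast+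
  have ta: "t \<in> borel_measurable (window_algebra (cube (real A + 1)))"
    unfolding t_def using pairs_window_algebra_measurable[OF h(1) B(3,4) s1] by measurable
  have ta': "t' \<in> borel_measurable (window_algebra (- cube (real A + 1 + real (sup_norm u) / 3)))"
    unfolding t'_def using pairs_window_algebra_measurable[OF h(1) B'(3,4) s2] by measurable
  have G: "(\<lambda>p. t (fst p) * t' (snd p)) \<in> borel_measurable (window_algebra (cube (real A + 1)) \<Otimes>\<^sub>M window_algebra (- cube (real A + 1 + real (sup_norm u) / 3)))"
    using measurable_compose[OF measurable_fst ta] measurable_compose[OF measurable_snd ta'] by measurable
  note tm = borel_measurable_integrable[OF block_sum_second_moment(1)[OF h B], folded t_def]
    borel_measurable_integrable[OF block_sum_second_moment(1)[OF h B'], folded t'_def]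
  have GP: "(\<lambda>p. t (fst p) * t' (snd p)) \<in> borel_measurable (P \<Otimes>\<^sub>M P)"
    using measurable_compose[OF measurable_fst tm(1)] measurable_compose[OF measurable_snd tm(2)] by measurable
  have le: "\<bar>t \<omega> * t' \<omega>'\<bar> powr ?q \<le> mean_count 0 0 \<omega> powr ?s + mean_count A 0 \<omega> powr ?s + (mean_count 0 u \<omega>' powr ?s + mean_count A u \<omega>' powr ?s)"
    if "loc_finite \<omega>" "loc_finite \<omega>'" for \<omega> \<omega>'
  proof -
    have "\<bar>t \<omega> * t' \<omega>'\<bar> \<le> mean_count 0 0 \<omega> * mean_count A 0 \<omega> * (mean_count 0 u \<omega>' * mean_count A u \<omega>')"
      unfolding abs_mult t_def t'_def
      by (intro mult_mono block_sum_second_moment(4)[OF h B] block_sum_second_moment(4)[OF h B'] that) auto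
    then have "\<bar>t \<omega> * t' \<omega>'\<bar> powr ?q \<le> (mean_count 0 0 \<omega> * mean_count A 0 \<omega> * (mean_count 0 u \<omega>' * mean_count A u \<omega>')) powr ?q"
      using delta_pos by (intro powr_mono2) auto
    also have "\<dots> \<le> mean_count 0 0 \<omega> powr ?s + mean_count A 0 \<omega> powr ?s + (mean_count 0 u \<omega>' powr ?s + mean_count A u \<omega>' powr ?s)"
      using delta_pos by (intro product4_powr_bound) auto
    finally show ?thesis .
  qed
  have K1: "(\<integral>\<^sup>+\<omega>. ennreal (\<bar>t (fst (\<omega>, \<omega>)) * t' (snd (\<omega>, \<omega>))\<bar> powr ?q) \<partial>P) \<le> ennreal (1 + 4 * K)"
    unfolding fst_conv snd_conv
    by (rule order.trans[OF nn_integral_mono_AE mean_count_moments4(1)[of 0 A u]])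
       (rule eventually_mono[OF AE_loc_finite], rule ennreal_leI, rule le, assumption+)
  have K2: "(\<integral>\<^sup>+p. ennreal (\<bar>t (fst p) * t' (snd p)\<bar> powr ?q) \<partial>(P \<Otimes>\<^sub>M P)) \<le> ennreal (1 + 4 * K)"
    by (rule order.trans[OF nn_integral_mono_AE mean_count_moments4(2)[of 0 A u]])
       (rule eventually_mono[OF AE_loc_finite_pair], rule ennreal_leI, rule le, blast+)
  have "integrable (P \<Otimes>\<^sub>M P) (\<lambda>p. t (fst p) * t' (snd p))"
    by (rule integrable_of_powr[OF PP.prob_space_axioms GP _ K2]) (use delta_pos in simp)
  then have "(\<integral>p. t (fst p) * t' (snd p) \<partial>(P \<Otimes>\<^sub>M P)) = expectation t * expectation t'"
    by (rule integral_product_independent)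
  then show ?thesis using far_integral_diff[OF far G K1 K2] by simp
qed

text \<open>
  Shift one block to the origin and apply the mixing inequality to the product of both
  functionals, or bound the covariance by second moments if the blocks are near.
\<close>

lemma block_sum_covariance:
  assumes h: "h \<in> borel_measurable borel" "\<And>x. \<bar>h x\<bar> \<le> 1"
    and B: "B1 \<subseteq> lattice_cube z" "B2 \<subseteq> cube_block A z" "B1 \<in> sets borel" "B2 \<in> sets borel"
    and B': "B1' \<subseteq> lattice_cube z'" "B2' \<subseteq> cube_block A z'" "B1' \<in> sets borel" "B2' \<in> sets borel"
  shows "\<bar>expectation (\<lambda>\<omega>. pairs h B1 B2 \<omega> \<omega> * pairs h B1' B2' \<omega> \<omega>)
      - expectation (\<lambda>\<omega>. pairs h B1 B2 \<omega> \<omega>) * expectation (\<lambda>\<omega>. pairs h B1' B2' \<omega> \<omega>)\<bar> \<le> (block_size A)\<^sup>2 * cov_bound A (z' - z)"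
    (is "?C \<le> _")
proof -
  define t where "t = (\<lambda>\<omega>. pairs h B1 B2 \<omega> \<omega> / block_size A)"
  define t' where "t' = (\<lambda>\<omega>. pairs h B1' B2' \<omega> \<omega> / block_size A)"
  have c: "block_size A \<noteq> 0" using less_imp_neq[OF block_size_pos(1)[of A]] by simp
  have pairs: "pairs h B1 B2 \<omega> \<omega> = block_size A * t \<omega>" "pairs h B1' B2' \<omega> \<omega> = block_size A * t' \<omega>" for \<omega>
    using c by (simp_all add: t_def t'_def)
  have e: "expectation (\<lambda>\<omega>. (block_size A * t \<omega>) * (block_size A * t' \<omega>)) = (block_size A)\<^sup>2 * expectation (\<lambda>\<omega>. t \<omega> * t' \<omega>)"
    by (simp add: power2_eq_square mult_ac flip: Bochner_Integration.integral_mult_right_zero)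
  have C: "?C = (block_size A)\<^sup>2 * \<bar>expectation (\<lambda>\<omega>. t \<omega> * t' \<omega>) - expectation t * expectation t'\<bar>"
  proof -
    have "(block_size A)\<^sup>2 * expectation (\<lambda>\<omega>. t \<omega> * t' \<omega>) - (block_size A * expectation t) * (block_size A * expectation t')
       = (block_size A)\<^sup>2 * (expectation (\<lambda>\<omega>. t \<omega> * t' \<omega>) - expectation t * expectation t')"
      by (simp add: power2_eq_square algebra_simps)
    then show ?thesis unfolding pairs e Bochner_Integration.integral_mult_right_zero by (simp only: abs_mult abs_power2)
  qed
  have "\<bar>expectation (\<lambda>\<omega>. t \<omega> * t' \<omega>) - expectation t * expectation t'\<bar> \<le> cov_bound A (z' - z)"
  proof (cases "far A (z' - z)")
    case True
    let ?w = "ivec (- z)"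
    have sub: "translate ?w B1 \<subseteq> lattice_cube 0" "translate ?w B2 \<subseteq> cube_block A 0"
      "translate ?w B1' \<subseteq> lattice_cube (z' - z)" "translate ?w B2' \<subseteq> cube_block A (z' - z)"
      using translate_back[of B1 0 z 0] translate_back[of B2 A z 0] translate_back[of B1' 0 z "z' - z"] translate_back[of B2' A z "z' - z"]
        B(1,2) B'(1,2) by (simp_all add: cube_block_0)
    have S: "translate ?w B1 \<in> sets borel" "translate ?w B2 \<in> sets borel" "translate ?w B1' \<in> sets borel" "translate ?w B2' \<in> sets borel"
      using B(3,4) B'(3,4) by (simp_all add: sets_translate)
    show ?thesis
      using block_sum_covariance_far[OF h True sub(1,2) S(1,2) sub(3,4) S(3,4)]
        pairs_translate[OF h(1) B(3,4), of ?w] pairs_translate[OF h(1) B'(3,4), of ?w]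
        pairs_product_translate[OF h(1) h(1) B(3,4) B'(3,4), of ?w]
      by (simp add: t_def t'_def)
  next
    case False
    have m: "integrable P t" "integrable P (\<lambda>\<omega>. (t \<omega>)\<^sup>2)" "expectation (\<lambda>\<omega>. (t \<omega>)\<^sup>2) \<le> 1 + 2 * K"
      using block_sum_second_moment(1-3)[OF h B] unfolding t_def by simp_all
    have m': "integrable P t'" "integrable P (\<lambda>\<omega>. (t' \<omega>)\<^sup>2)" "expectation (\<lambda>\<omega>. (t' \<omega>)\<^sup>2) \<le> 1 + 2 * K"
      using block_sum_second_moment(1-3)[OF h B'] unfolding t'_def by simp_all
    have K1: "\<bar>expectation s\<bar> \<le> 1 + 2 * K" if "integrable P s" "integrable P (\<lambda>\<omega>. (s \<omega>)\<^sup>2)" "expectation (\<lambda>\<omega>. (s \<omega>)\<^sup>2) \<le> 1 + 2 * K" for s :: "'w \<Rightarrow> real"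
    proof -
      have "\<bar>expectation s\<bar> \<le> expectation (\<lambda>\<omega>. \<bar>s \<omega>\<bar>)" by (rule integral_abs_bound)
      also have "\<dots> \<le> expectation (\<lambda>\<omega>. (1 + (s \<omega>)\<^sup>2) / 2)"
      proof (rule integral_mono)
        fix \<omega> show "\<bar>s \<omega>\<bar> \<le> (1 + (s \<omega>)\<^sup>2) / 2"
          using zero_le_power2[of "\<bar>s \<omega>\<bar> - 1"] by (simp add: power2_diff)
      qed (use that in auto)
      also have "\<dots> = (1 + expectation (\<lambda>\<omega>. (s \<omega>)\<^sup>2)) / 2" using that by (simp add: prob_space)
      also have "\<dots> \<le> (1 + (1 + 2 * K)) / 2" using that(3) by (intro divide_right_mono add_left_mono) auto
      also have "\<dots> \<le> 1 + 2 * K" using K_nonneg by simp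
      finally show ?thesis .
    qed
    have tt: "\<bar>t \<omega> * t' \<omega>\<bar> \<le> ((t \<omega>)\<^sup>2 + (t' \<omega>)\<^sup>2) / 2" for \<omega>
      using zero_le_power2[of "\<bar>t \<omega>\<bar> - \<bar>t' \<omega>\<bar>"] by (simp add: power2_diff abs_mult)
    have int: "integrable P (\<lambda>\<omega>. t \<omega> * t' \<omega>)"
    proof (rule Bochner_Integration.integrable_bound)
      show "integrable P (\<lambda>\<omega>. ((t \<omega>)\<^sup>2 + (t' \<omega>)\<^sup>2) / 2)" using m(2) m'(2) by simp
      show "(\<lambda>\<omega>. t \<omega> * t' \<omega>) \<in> borel_measurable P" using m(1) m'(1) by measurable
      show "AE \<omega> in P. norm (t \<omega> * t' \<omega>) \<le> norm (((t \<omega>)\<^sup>2 + (t' \<omega>)\<^sup>2) / 2)"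
        using tt by (intro AE_I2) simp
    qed
    have "\<bar>expectation (\<lambda>\<omega>. t \<omega> * t' \<omega>)\<bar> \<le> expectation (\<lambda>\<omega>. \<bar>t \<omega> * t' \<omega>\<bar>)" by (rule integral_abs_bound)
    also have "\<dots> \<le> expectation (\<lambda>\<omega>. ((t \<omega>)\<^sup>2 + (t' \<omega>)\<^sup>2) / 2)"
      using int m(2) m'(2) tt by (intro integral_mono) auto
    also have "\<dots> \<le> 1 + 2 * K" using m(2,3) m'(2,3) by simp
    finally have "\<bar>expectation (\<lambda>\<omega>. t \<omega> * t' \<omega>)\<bar> \<le> 1 + 2 * K" .
    moreover have "\<bar>expectation t * expectation t'\<bar> \<le> (1 + 2 * K) * (1 + 2 * K)"
      unfolding abs_mult using K_nonneg by (intro mult_mono K1 m m') auto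
    moreover have "1 + 2 * K \<le> (1 + 2 * K)\<^sup>2" using K_nonneg by (intro self_le_power) auto
    ultimately have "\<bar>expectation (\<lambda>\<omega>. t \<omega> * t' \<omega>) - expectation t * expectation t'\<bar> \<le> 2 * (1 + 2 * K)\<^sup>2"
      unfolding power2_eq_square by linarith
    then show ?thesis using False by (simp add: cov_bound_def)
  qed
  then show ?thesis unfolding C by (rule mult_left_mono) simp
qed

end

section \<open>Summation over the lattice and convex windows\<close>

text \<open>
  The sphere of radius \<open>n\<close> is the difference of two lattice cubes of sides
  \<open>2n + 1\<close> and \<open>2n - 1\<close>.
\<close>

lemma card_sup_norm_sphere:
  assumes "1 \<le> n"
  shows "real (card {u :: int ^ 'd. sup_norm u = n}) \<le> 2 * real CARD('d) * real (2 * n + 1) ^ (CARD('d) - 1)"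
proof -
  let ?d = "CARD('d)"
  have eq: "{u :: int ^ 'd. sup_norm u = n} = lattice_block n 0 - lattice_block (n - 1) 0"
    using assms by (auto simp: lattice_block_iff)
  have sub: "lattice_block (n - 1) 0 \<subseteq> (lattice_block n 0 :: (int ^ 'd) set)"
    by (auto simp: lattice_block_iff)
  define x y where "x = real (2 * n + 1)" and "y = real (2 * (n - 1) + 1)"
  have xy: "0 \<le> y" "y \<le> x" "x - y = 2" using assms by (auto simp: x_def y_def of_nat_diff)
  have "real (card {u :: int ^ 'd. sup_norm u = n}) = x ^ ?d - y ^ ?d"
    unfolding eq using sub
    by (subst card_Diff_subset)
       (auto simp: card_lattice_block x_def y_def of_nat_diff power_mono)
  also have "\<dots> = (x - y) * (\<Sum>i<?d. y ^ (?d - Suc i) * x ^ i)" by (rule power_diff_sumr2)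
  also have "\<dots> \<le> (x - y) * (\<Sum>i<?d. x ^ (?d - 1))"
  proof (intro mult_left_mono sum_mono)
    fix i assume i: "i \<in> {..<?d}"
    have "y ^ (?d - Suc i) * x ^ i \<le> x ^ (?d - Suc i) * x ^ i"
      using xy by (intro mult_right_mono power_mono) auto
    also have "\<dots> = x ^ (?d - 1)" using i by (simp flip: power_add)
    finally show "y ^ (?d - Suc i) * x ^ i \<le> x ^ (?d - 1)" .
  qed (use xy in simp)
  also have "\<dots> = 2 * real ?d * x ^ (?d - 1)" using xy by simp
  finally show ?thesis by (simp add: x_def)
qed

text \<open>
  Comparison with the integral on the intervals \<open>[(n-1)/3, n/3)\<close>. The antitone
  \<open>\<phi>\<close> is smallest at the right end, the power at the left end.
\<close>

lemma sum_le_nn_integral_steps: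
  fixes \<phi> :: "real \<Rightarrow> real"
  assumes nonneg: "\<And>r. 1 / 2 \<le> r \<Longrightarrow> 0 \<le> \<phi> r" and anti: "\<And>r s. 1 / 2 \<le> r \<Longrightarrow> r \<le> s \<Longrightarrow> \<phi> s \<le> \<phi> r"
  shows "ennreal (\<Sum>n=4..m. ((real n - 1) / 3) ^ k * \<phi> (real n / 3) / 3)
     \<le> (\<integral>\<^sup>+ r\<in>{1..}. ennreal (r ^ k * \<phi> r) \<partial>lborel)"
proof -
  define c where "c n = ((real n - 1) / 3) ^ k * \<phi> (real n / 3)" for n
  let ?J = "\<lambda>n. {(real n - 1) / 3..<real n / 3}"
  have c: "0 \<le> c n" if "4 \<le> n" for n using that nonneg[of "real n / 3"] by (simp add: c_def)
  have "ennreal (\<Sum>n=4..m. c n / 3) = (\<Sum>n=4..m. ennreal (c n) * emeasure lborel (?J n))"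
  proof -
    have e: "emeasure lborel (?J n) = ennreal (1 / 3)" for n
      by (subst emeasure_lborel_Ico) (auto simp: field_simps)
    have "(\<Sum>n=4..m. ennreal (c n) * emeasure lborel (?J n)) = (\<Sum>n=4..m. ennreal (c n / 3))"
      unfolding e using c by (intro sum.cong) (auto simp flip: ennreal_mult)
    also have "\<dots> = ennreal (\<Sum>n=4..m. c n / 3)" using c by (intro sum_ennreal) auto
    finally show ?thesis by simp
  qed
  also have "\<dots> = (\<integral>\<^sup>+ r. (\<Sum>n=4..m. ennreal (c n) * indicator (?J n) r) \<partial>lborel)"
    by (subst nn_integral_sum) (auto simp: nn_integral_cmult_indicator)
  also have "\<dots> \<le> (\<integral>\<^sup>+ r\<in>{1..}. ennreal (r ^ k * \<phi> r) \<partial>lborel)"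
  proof (intro nn_integral_mono)
    fix r :: real
    show "(\<Sum>n=4..m. ennreal (c n) * indicator (?J n) r) \<le> ennreal (r ^ k * \<phi> r) * indicator {1..} r"
    proof (cases "\<exists>n\<in>{4..m}. r \<in> ?J n")
      case True
      then obtain n where n: "n \<in> {4..m}" "r \<in> ?J n" by blast
      have uniq: "r \<notin> ?J n'" if "n' \<noteq> n" for n'
      proof
        assume "r \<in> ?J n'"
        with n(2) have "real n - 1 < real n'" "real n' - 1 < real n" by auto
        then show False using that by linarith
      qed
      have "(\<Sum>n=4..m. ennreal (c n) * indicator (?J n) r) = (\<Sum>n'=4..m. if n' = n then ennreal (c n) else 0)"
        using n(2) uniq by (intro sum.cong) (auto simp: indicator_def)
      also have "\<dots> = ennreal (c n)" using n(1) by simp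
      also have "\<dots> \<le> ennreal (r ^ k * \<phi> r)"
        unfolding c_def using n nonneg[of "real n / 3"] by (intro ennreal_leI mult_mono power_mono anti) auto
      also have "\<dots> = ennreal (r ^ k * \<phi> r) * indicator {1..} r" using n by (auto simp: indicator_def)
      finally show ?thesis .
    next
      case False
      then have "(\<Sum>n=4..m. ennreal (c n) * indicator (?J n) r) = 0" by (intro sum.neutral) auto
      then show ?thesis by (simp only: zero_le)
    qed
  qed
  finally show ?thesis by (simp add: c_def)
qed

text \<open>
  There are at most \<open>c n\<^bsup>d-1\<^esup>\<close> lattice points of norm
  \<open>n\<close>, and for \<open>n \<ge> 4\<close> this is at most a constant times \<open>((n
  - 1) / 3)\<^bsup>d-1\<^esup>\<close>, the smallest value of
  \<open>r\<^bsup>d-1\<^esup>\<close> on the interval attached to \<open>n\<close>.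
\<close>

lemma lattice_sum_bounded:
  fixes \<phi> :: "real \<Rightarrow> real"
  assumes nonneg: "\<And>r. 1 / 2 \<le> r \<Longrightarrow> 0 \<le> \<phi> r" and anti: "\<And>r s. 1 / 2 \<le> r \<Longrightarrow> r \<le> s \<Longrightarrow> \<phi> s \<le> \<phi> r"
    and fin: "(\<integral>\<^sup>+ r\<in>{1..}. ennreal (r ^ (CARD('d) - 1) * \<phi> r) \<partial>lborel) < \<infinity>"
  shows "\<exists>S\<ge>0. \<forall>F :: (int ^ 'd) set. finite F \<longrightarrow> (\<forall>u\<in>F. 4 \<le> sup_norm u) \<longrightarrow> (\<Sum>u\<in>F. \<phi> (real (sup_norm u) / 3)) \<le> S"
proof -
  let ?d = "CARD('d)"
  define J where "J = enn2real (\<integral>\<^sup>+ r\<in>{1..}. ennreal (r ^ (?d - 1) * \<phi> r) \<partial>lborel)"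
  have J: "(\<integral>\<^sup>+ r\<in>{1..}. ennreal (r ^ (?d - 1) * \<phi> r) \<partial>lborel) = ennreal J" "0 \<le> J"
    using fin by (simp_all add: J_def)
  define L where "L = 2 * real ?d * 12 ^ (?d - 1) * 3"
  have "(\<Sum>u\<in>F. \<phi> (real (sup_norm u) / 3)) \<le> L * J"
    if F: "finite F" "\<forall>u\<in>F. 4 \<le> sup_norm u" for F :: "(int ^ 'd) set"
  proof -
    define m where "m = Max (insert 4 (sup_norm ` F))"
    have m: "sup_norm u \<in> {4..m}" if "u \<in> F" for u using F that by (auto simp: m_def)
    have finS: "finite {u :: int ^ 'd. sup_norm u = n}" for n
      by (rule finite_subset[of _ "lattice_block n 0"]) (auto simp: lattice_block_iff card_lattice_block)
    have "(\<Sum>u\<in>F. \<phi> (real (sup_norm u) / 3)) = (\<Sum>n=4..m. \<Sum>u\<in>{u\<in>F. sup_norm u = n}. \<phi> (real (sup_norm u) / 3))"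
      using F m by (intro sum.group[symmetric]) auto
    also have "\<dots> \<le> (\<Sum>n=4..m. L * (((real n - 1) / 3) ^ (?d - 1) * \<phi> (real n / 3) / 3))"
    proof (rule sum_mono)
      fix n assume n: "n \<in> {4..m}"
      have p: "0 \<le> \<phi> (real n / 3)" using n by (intro nonneg) auto
      have "(\<Sum>u\<in>{u\<in>F. sup_norm u = n}. \<phi> (real (sup_norm u) / 3)) = real (card {u\<in>F. sup_norm u = n}) * \<phi> (real n / 3)"
        by simp
      also have "\<dots> \<le> real (card {u :: int ^ 'd. sup_norm u = n}) * \<phi> (real n / 3)"
        using p finS by (intro mult_right_mono of_nat_mono card_mono) auto
      also have "\<dots> \<le> (2 * real ?d * real (2 * n + 1) ^ (?d - 1)) * \<phi> (real n / 3)"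
        using p n by (intro mult_right_mono card_sup_norm_sphere) auto
      also have "\<dots> \<le> (2 * real ?d * (12 * ((real n - 1) / 3)) ^ (?d - 1)) * \<phi> (real n / 3)"
        using n p by (intro mult_right_mono mult_left_mono power_mono) auto
      also have "\<dots> = L * (((real n - 1) / 3) ^ (?d - 1) * \<phi> (real n / 3) / 3)"
        unfolding L_def power_mult_distrib by simp
      finally show "(\<Sum>u\<in>{u\<in>F. sup_norm u = n}. \<phi> (real (sup_norm u) / 3)) \<le> L * (((real n - 1) / 3) ^ (?d - 1) * \<phi> (real n / 3) / 3)"
        .
    qed
    also have "\<dots> = L * (\<Sum>n=4..m. ((real n - 1) / 3) ^ (?d - 1) * \<phi> (real n / 3) / 3)" by (simp add: sum_distrib_left)
    also have "\<dots> \<le> L * J"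
    proof (rule mult_left_mono)
      have "ennreal (\<Sum>n=4..m. ((real n - 1) / 3) ^ (?d - 1) * \<phi> (real n / 3) / 3) \<le> ennreal J"
        using sum_le_nn_integral_steps[where \<phi> = \<phi> and m = m and k = "?d - 1", OF nonneg anti] unfolding J(1) .
      then show "(\<Sum>n=4..m. ((real n - 1) / 3) ^ (?d - 1) * \<phi> (real n / 3) / 3) \<le> J"
        using J(2) by (simp add: ennreal_le_iff)
    qed (simp add: L_def)
    finally show ?thesis .
  qed
  moreover have "0 \<le> L * J" using J(2) by (simp add: L_def)
  ultimately show ?thesis by blast
qed

text \<open>
  A point at distance at most \<open>t = s \<rho>\<close> from \<open>x0 + (1 - s) (x -
  x0)\<close> is a convex combination with weights \<open>1 - s\<close> and \<open>s\<close> of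
  \<open>x\<close> and a point of the ball.
\<close>

lemma convex_shrink:
  fixes W :: "'a::euclidean_space set"
  assumes W: "convex W" "cball x0 \<rho> \<subseteq> W" and "0 < \<rho>" "0 \<le> t" "t \<le> \<rho>" and x: "x \<in> W"
    and v: "dist (x0 + (1 - t / \<rho>) *\<^sub>R (x - x0)) v \<le> t"
  shows "v \<in> W"
proof (cases "t = 0")
  case True
  then show ?thesis using v x by simp
next
  case False
  define s where "s = t / \<rho>"
  have s: "0 < s" "s \<le> 1" "t = s * \<rho>" using assms False by (auto simp: s_def)
  define e where "e = v - (x0 + (1 - s) *\<^sub>R (x - x0))"
  have "norm e \<le> t" using v by (simp add: e_def s_def dist_norm norm_minus_commute)
  then have "norm e \<le> s * \<rho>" by (simp only: s(3))
  then have "norm ((1 / s) *\<^sub>R e) \<le> \<rho>" using s by (simp add: divide_le_eq mult.commute)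
  then have "x0 + (1 / s) *\<^sub>R e \<in> W" using W(2) by (auto simp: dist_norm)
  then have "(1 - s) *\<^sub>R x + s *\<^sub>R (x0 + (1 / s) *\<^sub>R e) \<in> W"
    using W(1) x s by (intro convexD) auto
  also have "(1 - s) *\<^sub>R x + s *\<^sub>R (x0 + (1 / s) *\<^sub>R e) = v"
  proof -
    have "s *\<^sub>R (x0 + (1 / s) *\<^sub>R e) = s *\<^sub>R x0 + e" using s by (simp add: scaleR_add_right)
    then show ?thesis unfolding e_def by (simp add: scaleR_diff_right scaleR_diff_left)
  qed
  finally show ?thesis .
qed

text \<open>
  Conversely, \<open>y\<close> plus a vector \<open>e\<close> of length at most \<open>s
  \<rho>\<close> is \<open>1 + s\<close> times a convex combination of \<open>y\<close> and a
  point of the ball (with \<open>x0\<close> as origin).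
\<close>

lemma convex_grow:
  fixes W :: "'a::euclidean_space set"
  assumes W: "convex W" "cball x0 \<rho> \<subseteq> W" and "0 < \<rho>" "0 \<le> t" and y: "y \<in> W" and v: "dist y v \<le> t"
  shows "v \<in> (\<lambda>x. x0 + (1 + t / \<rho>) *\<^sub>R (x - x0)) ` W"
proof (cases "t = 0")
  case True
  then show ?thesis using v y by simp
next
  case False
  define s where "s = t / \<rho>"
  have s: "0 < s" "t = s * \<rho>" using assms False by (auto simp: s_def)
  define e where "e = v - y"
  have "norm e \<le> s * \<rho>" using v s by (simp add: e_def dist_norm norm_minus_commute)
  then have "norm ((1 / s) *\<^sub>R e) \<le> \<rho>" using s by (simp add: divide_le_eq mult.commute)
  then have "x0 + (1 / s) *\<^sub>R e \<in> W" using W(2) by (auto simp: dist_norm)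
  then have in_W: "(1 / (1 + s)) *\<^sub>R y + (s / (1 + s)) *\<^sub>R (x0 + (1 / s) *\<^sub>R e) \<in> W" (is "?x \<in> W")
    using W(1) y s by (intro convexD) (auto simp: field_simps)
  have "(1 + s) *\<^sub>R ?x = y + s *\<^sub>R x0 + e"
  proof -
    have "(1 + s) *\<^sub>R ?x = ((1 + s) * (1 / (1 + s))) *\<^sub>R y + ((1 + s) * (s / (1 + s))) *\<^sub>R (x0 + (1 / s) *\<^sub>R e)"
      by (simp only: scaleR_add_right scaleR_scaleR mult.assoc)
    also have "\<dots> = y + s *\<^sub>R (x0 + (1 / s) *\<^sub>R e)" using s by simp
    also have "\<dots> = y + s *\<^sub>R x0 + e" using s by (simp add: scaleR_add_right)
    finally show ?thesis .
  qed
  then have "v = x0 + (1 + s) *\<^sub>R (?x - x0)"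
    unfolding scaleR_diff_right by (simp add: e_def scaleR_add_left)
  then show ?thesis unfolding s_def[symmetric] by (rule rev_image_eqI[OF in_W])
qed

lemma measure_dilation:
  fixes W :: "(real ^ 'd) set"
  assumes "compact W" "0 \<le> c"
  shows "compact ((\<lambda>x. x0 + c *\<^sub>R (x - x0)) ` W)"
    and "measure lborel ((\<lambda>x. x0 + c *\<^sub>R (x - x0)) ` W) = c ^ CARD('d) * measure lborel W"
proof -
  have eq: "(\<lambda>x. x0 + c *\<^sub>R (x - x0)) = (\<lambda>x. c *\<^sub>R x + (x0 - c *\<^sub>R x0))"
    by (auto simp: fun_eq_iff algebra_simps)
  show c: "compact ((\<lambda>x. x0 + c *\<^sub>R (x - x0)) ` W)"
    by (intro compact_continuous_image assms continuous_intros)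
  have "emeasure lebesgue ((\<lambda>x. x0 + c *\<^sub>R (x - x0)) ` W) = ennreal (c ^ CARD('d)) * emeasure lebesgue W"
    unfolding eq using assms(2) by (subst emeasure_lebesgue_affine) auto
  then have "emeasure lborel ((\<lambda>x. x0 + c *\<^sub>R (x - x0)) ` W) = ennreal (c ^ CARD('d)) * emeasure lborel W"
    using c assms(1) by (simp add: borel_compact)
  then show "measure lborel ((\<lambda>x. x0 + c *\<^sub>R (x - x0)) ` W) = c ^ CARD('d) * measure lborel W"
    using assms(2) by (simp add: measure_def enn2real_mult)
qed

text \<open>
  The volume of \<open>W \<inter> (W - u)\<close>.
\<close>

definition covariogram :: "(real ^ 'd) set \<Rightarrow> real ^ 'd \<Rightarrow> real" where
  "covariogram W u = measure lborel {y \<in> W. y + u \<in> W}"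

lemma compact_overlap:
  fixes W :: "(real ^ 'd) set"
  assumes "compact W" shows "compact {y \<in> W. y + u \<in> W}"
proof -
  have "{y \<in> W. y + u \<in> W} = W \<inter> (\<lambda>y. y + (- u)) ` W"
  proof (intro set_eqI iffI)
    fix y assume "y \<in> {y \<in> W. y + u \<in> W}"
    then show "y \<in> W \<inter> (\<lambda>y. y + (- u)) ` W" by (intro IntI image_eqI[of _ _ "y + u"]) auto
  qed auto
  moreover have "compact ((\<lambda>y. y + (- u)) ` W)"
    by (intro compact_continuous_image assms continuous_intros)
  ultimately show ?thesis using assms by (simp only: compact_Int)
qed

text \<open>
  A copy of \<open>W\<close> shrunk by the factor \<open>1 - |u|/\<rho>\<close> lies in \<open>W
  \<inter> (W - u)\<close>.
\<close>

lemma covariogram_ge: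
  fixes W :: "(real ^ 'd) set"
  assumes W: "convex W" "compact W" "cball x0 \<rho> \<subseteq> W" and "0 < \<rho>" "norm u \<le> \<rho>"
  shows "(1 - norm u / \<rho>) ^ CARD('d) * measure lborel W \<le> covariogram W u"
proof -
  let ?W = "(\<lambda>x. x0 + (1 - norm u / \<rho>) *\<^sub>R (x - x0)) ` W"
  have p: "0 \<le> 1 - norm u / \<rho>" using assms by simp
  have "?W \<subseteq> {y \<in> W. y + u \<in> W}"
  proof
    fix y assume "y \<in> ?W"
    then obtain x where x: "x \<in> W" "y = x0 + (1 - norm u / \<rho>) *\<^sub>R (x - x0)" by blast
    show "y \<in> {y \<in> W. y + u \<in> W}"
      using convex_shrink[OF W(1,3) assms(4) _ assms(5) x(1), of y] convex_shrink[OF W(1,3) assms(4) _ assms(5) x(1), of "y + u"]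
      by (simp add: x(2) dist_norm)
  qed
  then have "measure lborel ?W \<le> covariogram W u"
    unfolding covariogram_def using measure_dilation(1)[OF W(2) p] compact_overlap[OF W(2)]
    by (intro measure_mono_fmeasurable) (auto simp: borel_compact fmeasurable_compact)
  then show ?thesis using measure_dilation(2)[OF W(2) p] by simp
qed

lemma lattice_cube_emeasure: "emeasure lborel (lattice_cube z) = 1"
proof -
  have b: "(1 :: real ^ 'd) \<bullet> i = 1" if "i \<in> Basis" for i using that by (auto simp: Basis_vec_def inner_axis)
  have lc: "lattice_cube z = {x. \<forall>i. of_int (z $ i) \<le> x $ i \<and> x $ i < of_int (z $ i) + 1}"
    by (simp add: lattice_cube_def floor_vec_def vec_eq_iff floor_eq_iff)
  have "box (ivec z) (ivec z + 1) \<subseteq> lattice_cube z" "lattice_cube z \<subseteq> cbox (ivec z) (ivec z + 1)"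
    unfolding lc by (auto simp: mem_box_cart less_eq_real_def)
  then have "emeasure lborel (box (ivec z) (ivec z + 1)) \<le> emeasure lborel (lattice_cube z)"
    "emeasure lborel (lattice_cube z) \<le> emeasure lborel (cbox (ivec z) (ivec z + 1))"
    by (auto intro!: emeasure_mono simp: sets_lattice_cube)
  moreover have "emeasure lborel (box (ivec z) (ivec z + 1)) = 1" "emeasure lborel (cbox (ivec z) (ivec z + 1)) = 1"
    by (subst emeasure_lborel_box emeasure_lborel_cbox; simp add: inner_add_left b)+
  ultimately show ?thesis by simp
qed

lemma measure_Union_lattice_cubes:
  fixes Z :: "(int ^ 'd) set"
  assumes "finite Z" shows "emeasure lborel (\<Union>z\<in>Z. lattice_cube z) = of_nat (card Z)"
proof -
  have "emeasure lborel (\<Union>z\<in>Z. lattice_cube z) = (\<Sum>z\<in>Z. emeasure lborel (lattice_cube z))"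
    using assms by (intro sum_emeasure[symmetric]) (auto simp: sets_lattice_cube disjoint_family_on_def, auto simp: lattice_cube_def)
  then show ?thesis by (simp add: lattice_cube_emeasure)
qed

lemma lattice_cube_diameter:
  fixes x y :: "real ^ 'd"
  assumes "x \<in> lattice_cube z" "y \<in> lattice_cube z" shows "dist x y \<le> real CARD('d)"
proof -
  have "\<bar>x $ i - y $ i\<bar> \<le> 1" for i
  proof -
    have "\<lfloor>x $ i\<rfloor> = \<lfloor>y $ i\<rfloor>" using assms by (auto simp: lattice_cube_def floor_vec_def vec_eq_iff)
    then show ?thesis by linarith
  qed
  then have "(\<Sum>i\<in>UNIV. \<bar>(x - y) $ i\<bar>) \<le> (\<Sum>i\<in>(UNIV :: 'd set). 1)" by (intro sum_mono) simp
  then show ?thesis using norm_le_l1_cart[of "x - y"] by (simp add: dist_norm)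
qed

text \<open>
  The unit cubes that meet \<open>W\<close>.
\<close>

definition cells :: "(real ^ 'd) set \<Rightarrow> (int ^ 'd) set" where "cells W = floor_vec ` W"

text \<open>
  The unit cubes that lie in \<open>W\<close> together with their shift by \<open>u\<close>. For
  them the window has no effect on pairs of cubes with difference \<open>u\<close>.
\<close>

definition inner_cells :: "int ^ 'd \<Rightarrow> (real ^ 'd) set \<Rightarrow> (int ^ 'd) set" where
  "inner_cells u W = {z. lattice_cube z \<subseteq> W \<and> lattice_cube (z + u) \<subseteq> W}"

lemma lattice_cube_nonempty: "ivec z \<in> lattice_cube z"
  by (simp add: lattice_cube_def floor_vec_def vec_eq_iff)

lemma inner_cells_subset: "inner_cells u W \<subseteq> cells W"
proof
  fix z assume "z \<in> inner_cells u W"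
  then have "ivec z \<in> W" using lattice_cube_nonempty[of z] by (auto simp: inner_cells_def)
  moreover have "z = floor_vec (ivec z)" using lattice_cube_nonempty[of z] by (simp add: lattice_cube_def)
  ultimately show "z \<in> cells W" unfolding cells_def by (rule rev_image_eqI)
qed

lemma finite_cells:
  fixes W :: "(real ^ 'd) set"
  assumes "bounded W" shows "finite (cells W)"
proof -
  obtain R where R: "\<And>x. x \<in> W \<Longrightarrow> norm x \<le> R" using assms unfolding bounded_iff by blast
  define n where "n = nat \<lceil>R + 1\<rceil>"
  have "floor_vec x \<in> lattice_block n 0" if "x \<in> W" for x
  proof -
    have "\<bar>\<lfloor>x $ i\<rfloor>\<bar> \<le> int n" for i
    proof -
      have "\<bar>x $ i\<bar> \<le> R" using component_le_norm_cart[of x i] R[OF that] by linarith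
      then have "\<bar>\<lfloor>x $ i\<rfloor>\<bar> \<le> \<lceil>R + 1\<rceil>" by linarith
      moreover have "\<lceil>R + 1\<rceil> \<le> int n" by (simp add: n_def)
      ultimately show ?thesis by linarith
    qed
    then show ?thesis by (simp add: lattice_block_def floor_vec_def)
  qed
  then show ?thesis unfolding cells_def by (intro finite_subset[OF _ card_lattice_block(1)[of n 0]]) auto
qed

text \<open>
  All cubes that meet \<open>W\<close> lie within the diameter of a unit cube of
  \<open>W\<close>, hence in a dilated copy.
\<close>

lemma card_cells_le:
  fixes W :: "(real ^ 'd) set"
  assumes W: "convex W" "compact W" "cball x0 \<rho> \<subseteq> W" and "0 < \<rho>"
  shows "real (card (cells W)) \<le> (1 + real CARD('d) / \<rho>) ^ CARD('d) * measure lborel W"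
proof -
  let ?W = "(\<lambda>x. x0 + (1 + real CARD('d) / \<rho>) *\<^sub>R (x - x0)) ` W"
  have p: "0 \<le> 1 + real CARD('d) / \<rho>" using assms by simp
  have fin: "finite (cells W)" by (intro finite_cells compact_imp_bounded W)
  have "(\<Union>z\<in>cells W. lattice_cube z) \<subseteq> ?W"
  proof
    fix v assume "v \<in> (\<Union>z\<in>cells W. lattice_cube z)"
    then obtain y where y: "y \<in> W" "v \<in> lattice_cube (floor_vec y)" by (auto simp: cells_def)
    have "dist y v \<le> real CARD('d)"
      by (rule lattice_cube_diameter[OF _ y(2)]) (simp add: lattice_cube_def)
    then show "v \<in> ?W" by (intro convex_grow[OF W(1,3) assms(4) _ y(1)]) auto
  qed
  then have "emeasure lborel (\<Union>z\<in>cells W. lattice_cube z) \<le> emeasure lborel ?W"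
    using measure_dilation(1)[OF W(2) p] by (intro emeasure_mono) (auto simp: borel_compact)
  then have "ennreal (real (card (cells W))) \<le> ennreal (measure lborel ?W)"
    using fmeasurableD2[OF fmeasurable_compact[OF measure_dilation(1)[OF W(2) p]]]
    by (simp add: measure_Union_lattice_cubes[OF fin] emeasure_eq_ennreal_measure ennreal_of_nat_eq_real_of_nat)
  then have "real (card (cells W)) \<le> measure lborel ?W" by (subst (asm) ennreal_le_iff) auto
  then show ?thesis by (simp only: measure_dilation(2)[OF W(2) p])
qed

text \<open>
  A cube that meets the copy of \<open>W\<close> shrunk by \<open>1 - t/\<rho>\<close> lies in
  \<open>W\<close>, and so does its shift by \<open>u\<close>.
\<close>

lemma card_inner_cells_ge:
  fixes W :: "(real ^ 'd) set" and u :: "int ^ 'd"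
  assumes W: "convex W" "compact W" "cball x0 \<rho> \<subseteq> W" and "0 < \<rho>"
    and t: "t = real CARD('d) + norm (ivec u)" "t \<le> \<rho>"
  shows "(1 - t / \<rho>) ^ CARD('d) * measure lborel W \<le> real (card (inner_cells u W))"
proof -
  let ?W = "(\<lambda>x. x0 + (1 - t / \<rho>) *\<^sub>R (x - x0)) ` W"
  have p: "0 \<le> 1 - t / \<rho>" using assms(4) t(2) by simp
  have t0: "0 \<le> t" using t(1) by simp
  have fin: "finite (inner_cells u W)"
    by (rule finite_subset[OF inner_cells_subset]) (intro finite_cells compact_imp_bounded W)
  have "?W \<subseteq> (\<Union>z\<in>inner_cells u W. lattice_cube z)"
  proof
    fix y assume "y \<in> ?W"
    then obtain x where x: "x \<in> W" "y = x0 + (1 - t / \<rho>) *\<^sub>R (x - x0)" by blast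
    have near: "v \<in> W" if "dist y v \<le> t" for v
      using convex_shrink[OF W(1,3) assms(4) t0 t(2) x(1)] that by (simp add: x(2))
    define z where "z = floor_vec y"
    have yz: "y \<in> lattice_cube z" by (simp add: z_def lattice_cube_def)
    have "v \<in> W" if "v \<in> lattice_cube z" for v
      using lattice_cube_diameter[OF yz that] t(1) norm_ge_zero[of "ivec u"] by (intro near) linarith
    moreover have "v \<in> W" if v: "v \<in> lattice_cube (z + u)" for v
    proof (rule near)
      have "v - ivec u \<in> lattice_cube z"
        using v translate_lattice_cube[of u z] by (auto simp: translate_def)
      then have "dist y (v - ivec u) \<le> real CARD('d)" by (rule lattice_cube_diameter[OF yz])
      moreover have "dist (v - ivec u) v = norm (ivec u)" by (simp add: dist_norm)
      ultimately show "dist y v \<le> t" using dist_triangle[of y v "v - ivec u"] t(1) by linarith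
    qed
    ultimately have "z \<in> inner_cells u W" by (auto simp: inner_cells_def)
    then show "y \<in> (\<Union>z\<in>inner_cells u W. lattice_cube z)" using yz by blast
  qed
  then have "emeasure lborel ?W \<le> emeasure lborel (\<Union>z\<in>inner_cells u W. lattice_cube z)"
    using fin by (intro emeasure_mono) (auto simp: sets_lattice_cube)
  then have "ennreal (measure lborel ?W) \<le> ennreal (real (card (inner_cells u W)))"
    using fmeasurableD2[OF fmeasurable_compact[OF measure_dilation(1)[OF W(2) p]]]
    by (simp add: measure_Union_lattice_cubes[OF fin] emeasure_eq_ennreal_measure ennreal_of_nat_eq_real_of_nat)
  then have "measure lborel ?W \<le> real (card (inner_cells u W))" by (subst (asm) ennreal_le_iff) auto
  then show ?thesis by (simp only: measure_dilation(2)[OF W(2) p])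
qed

lemma bounded_subset_cube_block:
  assumes "bounded B" shows "\<exists>A. B \<subseteq> cube_block A 0"
proof -
  define A where "A = Max (insert 0 (sup_norm ` cells B))"
  have "sup_norm z \<le> A" if "z \<in> cells B" for z
    using that finite_cells[OF assms] by (auto simp: A_def)
  then have "B \<subseteq> cube_block A 0"
    by (auto simp: cube_block_def lattice_block_iff cells_def)
  then show ?thesis by blast
qed

section \<open>Mean and variance of pair sums in large windows\<close>

context mixing_mpp
begin

text \<open>
  The near terms number at most a constant times \<open>(A + 1)\<^bsup>d\<^esup>\<close>, and
  the far terms have a bounded sum.
\<close>

lemma sum_cov_bound_le:
  assumes "(\<integral>\<^sup>+ r\<in>{1..}. ennreal (r ^ (CARD('d) - 1) * \<beta> r powr \<theta>) \<partial>lborel) < \<infinity>"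
  shows "\<exists>c\<ge>0. \<forall>A F. finite F \<longrightarrow> (\<Sum>u\<in>F. cov_bound A u) \<le> c * (real A + 1) ^ CARD('d)"
proof -
  let ?d = "CARD('d)"
  have th: "0 \<le> \<theta>" using delta_pos by (simp add: \<theta>_def)
  obtain S where S: "0 \<le> S" "\<And>F :: (int ^ 'd) set. finite F \<Longrightarrow> (\<forall>u\<in>F. 4 \<le> sup_norm u) \<Longrightarrow> (\<Sum>u\<in>F. \<beta> (real (sup_norm u) / 3) powr \<theta>) \<le> S"
  proof -
    have "0 \<le> \<beta> r powr \<theta>" for r by simp
    moreover have "\<beta> s powr \<theta> \<le> \<beta> r powr \<theta>" if "1 / 2 \<le> r" "r \<le> s" for r s
      using that \<beta>_nonneg[of s] \<beta>_antimono[OF that] th by (intro powr_mono2) auto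
    ultimately have "\<exists>S\<ge>0. \<forall>F :: (int ^ 'd) set. finite F \<longrightarrow> (\<forall>u\<in>F. 4 \<le> sup_norm u) \<longrightarrow> (\<Sum>u\<in>F. \<beta> (real (sup_norm u) / 3) powr \<theta>) \<le> S"
      using lattice_sum_bounded[where 'd='d and \<phi> = "\<lambda>r. \<beta> r powr \<theta>"] assms by blast
    then show ?thesis using that by blast
  qed
  define c1 where "c1 = 2 * (1 + 2 * K)\<^sup>2 * (6 * c0 + 5) ^ ?d"
  define c2 where "c2 = 2 * (2 + 4 * K) * 2 powr \<theta> * S"
  have c: "0 \<le> c1" "0 \<le> c2" using K_nonneg c0 S(1) by (auto simp: c1_def c2_def)
  have "(\<Sum>u\<in>F. cov_bound A u) \<le> (c1 + c2) * (real A + 1) ^ ?d" if F: "finite F" for A and F :: "(int ^ 'd) set"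
  proof -
    define n0 where "n0 = nat \<lceil>3 * c0 * (real A + 1) + 1\<rceil>"
    have p: "1 \<le> 3 * c0 * (real A + 1) + 1" using c0 by simp
    have n0: "3 * c0 * (real A + 1) + 1 \<le> real n0" "real n0 \<le> 3 * c0 * (real A + 1) + 2"
      using p unfolding n0_def by (auto simp: of_nat_nat) linarith+
    have cA1: "1 \<le> real A + 1" by simp
    let ?near = "{u \<in> F. \<not> far A u}" and ?far = "{u \<in> F. far A u}"
    have sub: "?near \<subseteq> lattice_block n0 0"
      using n0(1) by (auto simp: lattice_block_iff far_def)
    have "real (card ?near) \<le> real (card (lattice_block n0 (0 :: int ^ 'd)))"
      using sub by (intro of_nat_mono card_mono card_lattice_block)
    also have "\<dots> = real (2 * n0 + 1) ^ ?d" by (simp add: card_lattice_block)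
    also have "\<dots> \<le> ((6 * c0 + 5) * (real A + 1)) ^ ?d"
    proof (rule power_mono)
      have "real (2 * n0 + 1) \<le> 2 * (3 * c0 * (real A + 1) + 2) + 1" using n0(2) by simp
      also have "\<dots> = 6 * c0 * (real A + 1) + 5 * 1" by simp
      also have "\<dots> \<le> 6 * c0 * (real A + 1) + 5 * (real A + 1)" by (intro add_left_mono mult_left_mono) auto
      also have "\<dots> = (6 * c0 + 5) * (real A + 1)" by (simp add: distrib_right)
      finally show "real (2 * n0 + 1) \<le> (6 * c0 + 5) * (real A + 1)" .
    qed simp
    finally have card: "real (card ?near) \<le> (6 * c0 + 5) ^ ?d * (real A + 1) ^ ?d" by (simp add: power_mult_distrib)
    have "(\<Sum>u\<in>?near. cov_bound A u) = real (card ?near) * (2 * (1 + 2 * K)\<^sup>2)" by (simp add: cov_bound_def)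
    also have "\<dots> \<le> ((6 * c0 + 5) ^ ?d * (real A + 1) ^ ?d) * (2 * (1 + 2 * K)\<^sup>2)"
      using card by (intro mult_right_mono) auto
    finally have near: "(\<Sum>u\<in>?near. cov_bound A u) \<le> c1 * (real A + 1) ^ ?d" by (simp add: c1_def mult_ac)
    have 4: "4 \<le> sup_norm u" if "far A u" for u :: "int ^ 'd"
    proof -
      have "3 * 1 * 1 + 1 \<le> 3 * c0 * (real A + 1) + 1" using c0 by (intro add_right_mono mult_mono) auto
      then have "4 \<le> real (sup_norm u)" using that unfolding far_def by linarith
      then show ?thesis by simp
    qed
    have "(\<Sum>u\<in>?far. cov_bound A u) = (\<Sum>u\<in>?far. (2 * (2 + 4 * K) * 2 powr \<theta>) * \<beta> (real (sup_norm u) / 3) powr \<theta>)"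
    proof (rule sum.cong[OF refl])
      fix u assume u: "u \<in> ?far"
      have "0 \<le> \<beta> (real (sup_norm u) / 3)" using 4[of u] u by (intro \<beta>_nonneg) auto
      then show "cov_bound A u = (2 * (2 + 4 * K) * 2 powr \<theta>) * \<beta> (real (sup_norm u) / 3) powr \<theta>"
        using u by (simp add: cov_bound_def powr_mult)
    qed
    also have "\<dots> = (2 * (2 + 4 * K) * 2 powr \<theta>) * (\<Sum>u\<in>?far. \<beta> (real (sup_norm u) / 3) powr \<theta>)"
      by (simp add: sum_distrib_left)
    also have "\<dots> \<le> c2" unfolding c2_def using F 4 K_nonneg by (intro mult_left_mono S(2)) auto
    also have "\<dots> \<le> c2 * (real A + 1) ^ ?d" using c(2) mult_left_mono[OF one_le_power[OF cA1, of ?d] c(2)] by simp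
    finally have far: "(\<Sum>u\<in>?far. cov_bound A u) \<le> c2 * (real A + 1) ^ ?d" .
    have "(\<Sum>u\<in>F. cov_bound A u) = (\<Sum>u\<in>?near. cov_bound A u) + (\<Sum>u\<in>?far. cov_bound A u)"
      using F by (subst sum.union_disjoint[symmetric]) (auto intro!: sum.cong)
    then show ?thesis using near far by (simp add: distrib_right)
  qed
  then show ?thesis using c by (intro exI[of _ "c1 + c2"]) auto
qed

lemma sum_labels_cells:
  assumes "loc_finite \<omega>" "bounded W"
  shows "(\<Sum>p\<in>labels I X W \<omega>. g p) = (\<Sum>z\<in>cells W. \<Sum>p\<in>labels I X (W \<inter> lattice_cube z) \<omega>. g p)"
proof -
  have "(\<Sum>p\<in>labels I X W \<omega>. g p) = (\<Sum>z\<in>cells W. \<Sum>p\<in>{p \<in> labels I X W \<omega>. floor_vec (X p \<omega>) = z}. g p)"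
    using assms finite_cells[OF assms(2)] by (intro sum.group[symmetric]) (auto simp: loc_finite_def cells_def labels_def)
  also have "\<dots> = (\<Sum>z\<in>cells W. \<Sum>p\<in>labels I X (W \<inter> lattice_cube z) \<omega>. g p)"
    by (intro sum.cong) (auto simp: labels_def lattice_cube_def)
  finally show ?thesis .
qed

lemma labels_outside_cells: "z \<notin> cells W \<Longrightarrow> labels I X (W \<inter> lattice_cube z) \<omega> = {}"
  by (auto simp: labels_def cells_def lattice_cube_def)

end

context bounded_marks
begin

lemma pairs_scale: "pairs (\<lambda>x. c * h x) B1 B2 \<omega> \<omega>' = c * pairs h B1 B2 \<omega> \<omega>'"
  by (simp add: pair_sum_def sum_distrib_left mult_ac)

lemma scaled_expectation_bound:
  assumes cen: "centred f2" and h: "h \<in> borel_measurable borel" "\<And>x. \<bar>h x\<bar> \<le> H" "0 < H"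
    and B: "B1 \<subseteq> lattice_cube z" "B2 \<subseteq> lattice_cube z'" "B1 \<in> sets borel" "B2 \<in> sets borel"
  shows "integrable P (\<lambda>\<omega>. pairs h B1 B2 \<omega> \<omega>)" "\<bar>expectation (\<lambda>\<omega>. pairs h B1 B2 \<omega> \<omega>)\<bar> \<le> H * cov_bound 0 (z' - z)"
proof -
  have h': "(\<lambda>x. h x / H) \<in> borel_measurable borel" "\<And>x. \<bar>h x / H\<bar> \<le> 1" using h by (auto simp: divide_le_eq)
  have eq: "pairs h B1 B2 \<omega> \<omega> = H * pairs (\<lambda>x. h x / H) B1 B2 \<omega> \<omega>" for \<omega>
    using h(3) by (subst pairs_scale[symmetric]) simp
  show "integrable P (\<lambda>\<omega>. pairs h B1 B2 \<omega> \<omega>)"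
    unfolding eq using pairs_integrable(1)[OF h' B] by simp
  show "\<bar>expectation (\<lambda>\<omega>. pairs h B1 B2 \<omega> \<omega>)\<bar> \<le> H * cov_bound 0 (z' - z)"
    unfolding eq using pair_expectation_bound[OF cen h' B] h(3) by (simp add: abs_mult mult_left_mono)
qed

lemma pairs_expectation_cells:
  assumes cen: "centred f2" and h: "h \<in> borel_measurable borel" "\<And>x. \<bar>h x\<bar> \<le> H" "0 < H" and W: "compact W"
  shows "expectation (\<lambda>\<omega>. pairs h W W \<omega> \<omega>) =
    (\<Sum>z\<in>cells W. \<Sum>z'\<in>cells W. expectation (\<lambda>\<omega>. pairs h (W \<inter> lattice_cube z) (W \<inter> lattice_cube z') \<omega> \<omega>))"
proof -
  have WB: "W \<in> sets borel" and bW: "bounded W" using W by (auto simp: borel_compact compact_imp_bounded)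
  have S: "W \<inter> lattice_cube z \<in> sets borel" for z using WB sets_lattice_cube by auto
  note int = scaled_expectation_bound(1)[OF cen h Int_lower2 Int_lower2 S S]
  have "pairs h W W \<omega> \<omega> = (\<Sum>z\<in>cells W. \<Sum>z'\<in>cells W. pairs h (W \<inter> lattice_cube z) (W \<inter> lattice_cube z') \<omega> \<omega>)" if g: "loc_finite \<omega>" for \<omega>
  proof -
    have "pairs h W W \<omega> \<omega> = (\<Sum>z\<in>cells W. \<Sum>p\<in>labels I X (W \<inter> lattice_cube z) \<omega>. \<Sum>z'\<in>cells W. \<Sum>q\<in>labels I X (W \<inter> lattice_cube z') \<omega>. f1 (M p \<omega>) * f2 (M q \<omega>) * h (X q \<omega> - X p \<omega>))"
      unfolding pair_sum_def by (simp only: sum_labels_cells[OF g bW])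
    also have "\<dots> = (\<Sum>z\<in>cells W. \<Sum>z'\<in>cells W. pairs h (W \<inter> lattice_cube z) (W \<inter> lattice_cube z') \<omega> \<omega>)"
      unfolding pair_sum_def by (intro sum.cong[OF refl] sum.swap)
    finally show ?thesis .
  qed
  then have "expectation (\<lambda>\<omega>. pairs h W W \<omega> \<omega>) = expectation (\<lambda>\<omega>. \<Sum>z\<in>cells W. \<Sum>z'\<in>cells W. pairs h (W \<inter> lattice_cube z) (W \<inter> lattice_cube z') \<omega> \<omega>)"
    using AE_loc_finite int by (intro integral_cong_AE pairs_measurable h(1) WB borel_measurable_sum S) (auto elim!: eventually_mono)
  also have "\<dots> = (\<Sum>z\<in>cells W. \<Sum>z'\<in>cells W. expectation (\<lambda>\<omega>. pairs h (W \<inter> lattice_cube z) (W \<inter> lattice_cube z') \<omega> \<omega>))"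
    using int by (subst Bochner_Integration.integral_sum) (auto intro!: sum.cong Bochner_Integration.integral_sum)
  finally show ?thesis .
qed

lemma integrable_cov_bound:
  assumes "(\<integral>\<^sup>+ r\<in>{1..}. ennreal (r ^ (CARD('d) - 1) * \<beta> r powr \<theta>) \<partial>lborel) < \<infinity>"
  shows "integrable (count_space UNIV) (cov_bound 0)"
proof -
  obtain c where c: "\<And>F. finite F \<Longrightarrow> (\<Sum>u\<in>F. cov_bound 0 u) \<le> c * (real 0 + 1) ^ CARD('d)"
    using sum_cov_bound_le[OF assms] by blast
  have "(cov_bound 0) summable_on UNIV"
    using c by (intro nonneg_bdd_above_summable_on bdd_aboveI[of _ c]) (auto simp: cov_bound_nonneg)
  then have "Infinite_Sum.abs_summable_on (cov_bound 0) UNIV"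
    by (simp add: cov_bound_nonneg)
  then have "Infinite_Set_Sum.abs_summable_on (cov_bound 0) UNIV" by (simp only: abs_summable_equivalent)
  then show ?thesis by (simp add: Infinite_Set_Sum.abs_summable_on_def)
qed

text \<open>
  The contribution of two unit cubes with difference \<open>u\<close> to the asymptotic
  covariance.
\<close>

definition \<kappa> :: "int ^ 'd \<Rightarrow> real" where
  "\<kappa> u = expectation (\<lambda>\<omega>. pairs (\<lambda>_. 1) (lattice_cube 0) (lattice_cube u) \<omega> \<omega>)"

lemma kernel_limit:
  assumes h: "\<And>k. h k \<in> borel_measurable borel" "\<And>k x. \<bar>h k x\<bar> \<le> H" "0 < H" "\<And>x. (\<lambda>k. h k x) \<longlonglongrightarrow> 1"
  shows "(\<lambda>k. expectation (\<lambda>\<omega>. pairs (h k) (lattice_cube 0) (lattice_cube u) \<omega> \<omega>)) \<longlonglongrightarrow> \<kappa> u"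
  unfolding \<kappa>_def
proof (rule integral_dominated_convergence)
  show "(\<lambda>\<omega>. pairs (\<lambda>_. 1) (lattice_cube 0) (lattice_cube u) \<omega> \<omega>) \<in> borel_measurable P"
    by (intro pairs_measurable sets_lattice_cube) simp
  show "(\<lambda>\<omega>. pairs (h k) (lattice_cube 0) (lattice_cube u) \<omega> \<omega>) \<in> borel_measurable P" for k
    by (intro pairs_measurable sets_lattice_cube h)
  have "(\<integral>\<^sup>+\<omega>. ennreal (mean_count 0 0 \<omega> * mean_count 0 u \<omega>) \<partial>P) \<le> ennreal (1 + 2 * K)"
    by (rule order.trans[OF nn_integral_mono mean_count_moments2(1)[of 0 0 0 u]])
       (rule ennreal_leI, rule product_powr_bounds(3), use delta_pos in auto)
  then have "integrable P (\<lambda>\<omega>. mean_count 0 0 \<omega> * mean_count 0 u \<omega>)"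
    by (intro integrableI_nonneg) (auto intro: le_less_trans)
  then show "integrable P (\<lambda>\<omega>. H * (mean_count 0 0 \<omega> * mean_count 0 u \<omega>))" by simp
  show "AE \<omega> in P. (\<lambda>k. pairs (h k) (lattice_cube 0) (lattice_cube u) \<omega> \<omega>) \<longlonglongrightarrow> pairs (\<lambda>_. 1) (lattice_cube 0) (lattice_cube u) \<omega> \<omega>"
    unfolding pair_sum_def by (intro AE_I2 tendsto_sum tendsto_mult tendsto_const h(4))
  show "AE \<omega> in P. norm (pairs (h k) (lattice_cube 0) (lattice_cube u) \<omega> \<omega>) \<le> H * (mean_count 0 0 \<omega> * mean_count 0 u \<omega>)" for k
  proof (rule AE_I2)
    fix \<omega>
    show "norm (pairs (h k) (lattice_cube 0) (lattice_cube u) \<omega> \<omega>) \<le> H * (mean_count 0 0 \<omega> * mean_count 0 u \<omega>)"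
      using pairs_abs_le[of "h k" H "lattice_cube 0" "lattice_cube u" \<omega> \<omega>, OF h(2)] by (simp add: mean_count_def cube_block_0)
  qed
qed

lemma pairs_empty_labels:
  assumes "labels I X B1 \<omega> = {} \<or> labels I X B2 \<omega>' = {}" shows "pairs h B1 B2 \<omega> \<omega>' = 0"
  using assms by (auto simp: pair_sum_def)

text \<open>
  The pair sum is split over pairs of cubes that meet the window. For fixed difference
  \<open>u\<close>, almost all cubes are inner cells, and each of those contributes the same
  amount by stationarity, which tends to \<open>\<kappa> u\<close>. The bound of
  \<open>pair_expectation_bound\<close> is summable over \<open>u\<close> and dominates.
\<close>

lemma mean_limit:
  fixes W :: "nat \<Rightarrow> (real ^ 'd) set"
  assumes cen: "centred f2"
    and summable: "(\<integral>\<^sup>+ r\<in>{1..}. ennreal (r ^ (CARD('d) - 1) * \<beta> r powr \<theta>) \<partial>lborel) < \<infinity>"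
    and h: "\<And>k. h k \<in> borel_measurable borel" "\<And>k x. \<bar>h k x\<bar> \<le> H" "0 < H" "\<And>x. (\<lambda>k. h k x) \<longlonglongrightarrow> 1"
    and W: "\<And>k. convex (W k)" "\<And>k. compact (W k)" "\<And>k. cball (x0 k) (\<rho> k) \<subseteq> W k"
    and \<rho>: "\<And>k. real CARD('d) \<le> \<rho> k" "filterlim \<rho> at_top sequentially"
  shows "(\<lambda>k. expectation (\<lambda>\<omega>. pairs (h k) (W k) (W k) \<omega> \<omega>) / measure lborel (W k)) \<longlonglongrightarrow> (\<integral>u. \<kappa> u \<partial>count_space UNIV)"
proof -
  let ?d = "CARD('d)"
  define V where "V k = measure lborel (W k)" for k
  define e where "e k z z' = expectation (\<lambda>\<omega>. pairs (h k) (W k \<inter> lattice_cube z) (W k \<inter> lattice_cube z') \<omega> \<omega>)" for k z z'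
  define F where "F k u = (\<Sum>z\<in>cells (W k). e k z (z + u)) / V k" for k u
  have d: "0 < real ?d" by simp
  have \<rho>0: "0 < \<rho> k" for k using \<rho>(1)[of k] d by linarith
  have fin: "finite (cells (W k))" for k by (intro finite_cells compact_imp_bounded W)
  have S: "W k \<inter> lattice_cube z \<in> sets borel" for k z by (intro sets.Int borel_compact W(2) sets_lattice_cube)
  have cells: "real (card (cells (W k))) \<le> (1 + real ?d / \<rho> k) ^ ?d * V k" for k
    unfolding V_def by (rule card_cells_le[OF W(1,2,3) \<rho>0])
  have V0: "0 < V k" for k
  proof (rule ccontr)
    assume "\<not> 0 < V k"
    then have "V k = 0" unfolding V_def using measure_nonneg[of lborel "W k"] by linarith
    then have "real (card (cells (W k))) \<le> 0" using cells[of k] by simp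
    then have "cells (W k) = {}" using fin by simp
    moreover have "x0 k \<in> W k" using W(3)[of k] \<rho>0[of k] by (auto simp: less_imp_le)
    ultimately show False by (auto simp: cells_def)
  qed
  have e_bound: "\<bar>e k z z'\<bar> \<le> H * cov_bound 0 (z' - z)" for k z z'
    unfolding e_def by (rule scaled_expectation_bound(2)[OF cen h(1,2,3) Int_lower2 Int_lower2 S S])
  have e_bound': "\<bar>e k z (z + u)\<bar> \<le> H * cov_bound 0 u" for k z u using e_bound[of k z "z + u"] by simp
  have e_zero: "e k z z' = 0" if "z' \<notin> cells (W k)" for k z z'
    unfolding e_def using labels_outside_cells[OF that] by (simp add: pairs_empty_labels)
  \<comment> \<open>Grouping by the difference \<open>u = z' - z\<close> gives an integral over the lattice, to which dominated convergence applies.\<close>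
  have regroup: "expectation (\<lambda>\<omega>. pairs (h k) (W k) (W k) \<omega> \<omega>) / V k = (\<integral>u. F k u \<partial>count_space UNIV)" for k
  proof -
    let ?Z = "cells (W k)"
    define U where "U = (\<lambda>(z, z'). z' - z) ` (?Z \<times> ?Z)"
    have finU: "finite U" unfolding U_def using fin by auto
    have z0: "F k u = 0" if "u \<notin> U" for u
    proof -
      have "z + u \<notin> ?Z" if "z \<in> ?Z" for z
      proof
        assume "z + u \<in> ?Z"
        then have "u \<in> U" unfolding U_def using that by (intro image_eqI[of _ _ "(z, z + u)"]) auto
        then show False using \<open>u \<notin> U\<close> by simp
      qed
      then show ?thesis unfolding F_def using e_zero by simp
    qed
    have inner: "(\<Sum>u\<in>U. e k z (z + u)) = (\<Sum>z'\<in>?Z. e k z z')" if z: "z \<in> ?Z" for z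
    proof -
      have "(\<Sum>u\<in>U. e k z (z + u)) = (\<Sum>z'\<in>(\<lambda>u. z + u) ` U. e k z z')"
        by (subst sum.reindex) (auto simp: inj_on_def)
      also have "\<dots> = (\<Sum>z'\<in>?Z. e k z z')"
      proof (rule sum.mono_neutral_right)
        show "?Z \<subseteq> (\<lambda>u. z + u) ` U"
        proof
          fix z' assume "z' \<in> ?Z"
          then have "z' - z \<in> U" unfolding U_def using z by (intro image_eqI[of _ _ "(z, z')"]) auto
          then show "z' \<in> (\<lambda>u. z + u) ` U" by (intro image_eqI[of _ _ "z' - z"]) auto
        qed
      qed (use finU e_zero in auto)
      finally show ?thesis .
    qed
    have "(\<integral>u. F k u \<partial>count_space UNIV) = (\<Sum>u | u \<in> UNIV \<and> F k u \<noteq> 0. F k u)"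
      by (rule lebesgue_integral_count_space_finite_support, rule finite_subset[OF _ finU]) (use z0 in auto)
    also have "\<dots> = (\<Sum>u\<in>U. F k u)" using finU z0 by (intro sum.mono_neutral_left) auto
    also have "\<dots> = (\<Sum>z\<in>?Z. \<Sum>u\<in>U. e k z (z + u)) / V k"
      unfolding F_def by (subst sum.swap) (simp add: sum_divide_distrib)
    also have "\<dots> = (\<Sum>z\<in>?Z. \<Sum>z'\<in>?Z. e k z z') / V k" by (simp add: inner)
    also have "\<dots> = expectation (\<lambda>\<omega>. pairs (h k) (W k) (W k) \<omega> \<omega>) / V k"
      unfolding e_def by (subst pairs_expectation_cells[OF cen h(1,2,3) W(2)]) simp
    finally show ?thesis by simp
  qed
  have \<rho>lim: "(\<lambda>k. c / \<rho> k) \<longlonglongrightarrow> 0" for c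
    by (rule tendsto_divide_0[OF tendsto_const filterlim_at_top_imp_at_infinity[OF \<rho>(2)]])
  have inner_le: "card (inner_cells u (W k)) \<le> card (cells (W k))" for u k
    by (intro card_mono fin inner_cells_subset)
  have up: "(\<lambda>k. (1 + real ?d / \<rho> k) ^ ?d) \<longlonglongrightarrow> 1"
    using tendsto_power[OF tendsto_add[OF tendsto_const[of 1] \<rho>lim[of "real ?d"]], of ?d] by simp
  have cells': "real (card (cells (W k))) / V k \<le> (1 + real ?d / \<rho> k) ^ ?d" for k
    using cells[of k] V0[of k] by (simp add: divide_le_eq)
  have inner_lim: "(\<lambda>k. real (card (inner_cells u (W k))) / V k) \<longlonglongrightarrow> 1" for u
  proof (rule tendsto_sandwich[OF _ _ _ up])
    define t where "t = real ?d + norm (ivec u)"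
    have "eventually (\<lambda>k. t \<le> \<rho> k) sequentially" using \<rho>(2) unfolding filterlim_at_top by blast
    then show "eventually (\<lambda>k. (1 - t / \<rho> k) ^ ?d \<le> real (card (inner_cells u (W k))) / V k) sequentially"
    proof (rule eventually_mono)
      fix k assume "t \<le> \<rho> k"
      then show "(1 - t / \<rho> k) ^ ?d \<le> real (card (inner_cells u (W k))) / V k"
        using card_inner_cells_ge[OF W(1,2,3) \<rho>0, of t u k] t_def V0[of k] by (simp add: V_def le_divide_eq)
    qed
    show "eventually (\<lambda>k. real (card (inner_cells u (W k))) / V k \<le> (1 + real ?d / \<rho> k) ^ ?d) sequentially"
    proof (rule always_eventually, rule allI)
      fix k
      have "real (card (inner_cells u (W k))) / V k \<le> real (card (cells (W k))) / V k"
        using inner_le V0[of k] by (intro divide_right_mono) auto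
      then show "real (card (inner_cells u (W k))) / V k \<le> (1 + real ?d / \<rho> k) ^ ?d" using cells'[of k] by linarith
    qed
    show "(\<lambda>k. (1 - t / \<rho> k) ^ ?d) \<longlonglongrightarrow> 1"
      using tendsto_power[OF tendsto_diff[OF tendsto_const[of 1] \<rho>lim[of t]], of ?d] by simp
  qed
  have cells_lim: "(\<lambda>k. real (card (cells (W k))) / V k) \<longlonglongrightarrow> 1"
  proof (rule tendsto_sandwich[OF _ _ inner_lim[of 0] up])
    show "eventually (\<lambda>k. real (card (inner_cells 0 (W k))) / V k \<le> real (card (cells (W k))) / V k) sequentially"
      using inner_le V0 by (intro always_eventually allI divide_right_mono) (auto intro: less_imp_le)
  qed (use cells' in auto)
  have F_lim: "(\<lambda>k. F k u) \<longlonglongrightarrow> \<kappa> u" for u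
  proof -
    let ?G = "\<lambda>k. inner_cells u (W k)"
    define q where "q k = expectation (\<lambda>\<omega>. pairs (h k) (lattice_cube 0) (lattice_cube u) \<omega> \<omega>)" for k
    have inner: "e k z (z + u) = q k" if "z \<in> ?G k" for k z
    proof -
      have "W k \<inter> lattice_cube z = translate (ivec z) (lattice_cube 0)" "W k \<inter> lattice_cube (z + u) = translate (ivec z) (lattice_cube u)"
        using that by (auto simp: inner_cells_def translate_lattice_cube add.commute)
      then show ?thesis unfolding e_def q_def by (simp add: pairs_translate[OF h(1) sets_lattice_cube sets_lattice_cube])
    qed
    have dec: "F k u = real (card (?G k)) / V k * q k + (\<Sum>z\<in>cells (W k) - ?G k. e k z (z + u)) / V k" for k
    proof -
      have "(\<Sum>z\<in>cells (W k). e k z (z + u)) = (\<Sum>z\<in>?G k. e k z (z + u)) + (\<Sum>z\<in>cells (W k) - ?G k. e k z (z + u))"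
        using sum.subset_diff[OF inner_cells_subset[of u "W k"] fin[of k], of "\<lambda>z. e k z (z + u)"] by simp
      then show ?thesis by (simp add: F_def inner add_divide_distrib)
    qed
    have "(\<lambda>k. (\<Sum>z\<in>cells (W k) - ?G k. e k z (z + u)) / V k) \<longlonglongrightarrow> 0"
    proof (rule Lim_null_comparison)
      show "eventually (\<lambda>k. norm ((\<Sum>z\<in>cells (W k) - ?G k. e k z (z + u)) / V k)
          \<le> (real (card (cells (W k))) / V k - real (card (?G k)) / V k) * (H * cov_bound 0 u)) sequentially"
      proof (rule always_eventually, rule allI)
        fix k
        have "\<bar>\<Sum>z\<in>cells (W k) - ?G k. e k z (z + u)\<bar> \<le> (\<Sum>z\<in>cells (W k) - ?G k. H * cov_bound 0 u)"
          by (intro order.trans[OF sum_abs] sum_mono e_bound')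
        also have "\<dots> = real (card (cells (W k) - ?G k)) * (H * cov_bound 0 u)" by simp
        also have "real (card (cells (W k) - ?G k)) = real (card (cells (W k))) - real (card (?G k))"
          using inner_le fin finite_subset[OF inner_cells_subset fin] by (subst card_Diff_subset) (auto simp: inner_cells_subset of_nat_diff)
        finally show "norm ((\<Sum>z\<in>cells (W k) - ?G k. e k z (z + u)) / V k)
          \<le> (real (card (cells (W k))) / V k - real (card (?G k)) / V k) * (H * cov_bound 0 u)"
          using V0[of k] by (simp add: divide_right_mono flip: diff_divide_distrib)
      qed
      show "(\<lambda>k. (real (card (cells (W k))) / V k - real (card (?G k)) / V k) * (H * cov_bound 0 u)) \<longlonglongrightarrow> 0"
        using tendsto_mult[OF tendsto_diff[OF cells_lim inner_lim[of u]] tendsto_const[of "H * cov_bound 0 u"]] by simp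
    qed
    moreover have "(\<lambda>k. real (card (?G k)) / V k * q k) \<longlonglongrightarrow> 1 * \<kappa> u"
      unfolding q_def by (intro tendsto_mult inner_lim kernel_limit[OF h])
    ultimately have "(\<lambda>k. real (card (?G k)) / V k * q k + (\<Sum>z\<in>cells (W k) - ?G k. e k z (z + u)) / V k) \<longlonglongrightarrow> 1 * \<kappa> u + 0"
      by (intro tendsto_add)
    then show ?thesis unfolding dec by simp
  qed
  have F_bound: "norm (F k u) \<le> 2 ^ ?d * H * cov_bound 0 u" for k u
  proof -
    have "\<bar>\<Sum>z\<in>cells (W k). e k z (z + u)\<bar> \<le> (\<Sum>z\<in>cells (W k). H * cov_bound 0 u)"
      by (intro order.trans[OF sum_abs] sum_mono e_bound')
    then have "norm (F k u) \<le> real (card (cells (W k))) / V k * (H * cov_bound 0 u)"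
      using V0[of k] by (simp add: F_def divide_right_mono)
    also have "\<dots> \<le> (1 + real ?d / \<rho> k) ^ ?d * (H * cov_bound 0 u)"
      using cells'[of k] h(3) cov_bound_nonneg by (intro mult_right_mono) auto
    also have "\<dots> \<le> 2 ^ ?d * (H * cov_bound 0 u)"
      using \<rho>(1)[of k] \<rho>0[of k] h(3) cov_bound_nonneg by (intro mult_right_mono power_mono) (auto simp: add_nonneg_nonneg)
    finally show ?thesis by simp
  qed
  have "(\<lambda>k. \<integral>u. F k u \<partial>count_space UNIV) \<longlonglongrightarrow> (\<integral>u. \<kappa> u \<partial>count_space UNIV)"
    by (rule integral_dominated_convergence[where w = "\<lambda>u. 2 ^ ?d * H * cov_bound 0 u"])
       (use F_lim F_bound integrable_cov_bound[OF summable] in \<open>auto intro!: AE_I2\<close>)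
  then show ?thesis unfolding regroup[symmetric] V_def .
qed

text \<open>
  A kernel of range \<open>A\<close> links points of a cube only to points of the block of
  radius \<open>A\<close> around it.
\<close>

lemma pairs_truncate:
  assumes supp: "\<And>x i. h x \<noteq> 0 \<Longrightarrow> \<bar>x $ i\<bar> \<le> real A" and g: "loc_finite \<omega>" and W: "bounded W"
  shows "pairs h (W \<inter> lattice_cube z) W \<omega> \<omega> = pairs h (W \<inter> lattice_cube z) (W \<inter> cube_block A z) \<omega> \<omega>"
  unfolding pair_sum_def
proof (rule sum.cong[OF refl], rule sum.mono_neutral_right)
  fix p assume p: "p \<in> labels I X (W \<inter> lattice_cube z) \<omega>"
  show "finite (labels I X W \<omega>)" using g W by (simp add: loc_finite_def)
  show "labels I X (W \<inter> cube_block A z) \<omega> \<subseteq> labels I X W \<omega>" by (rule labels_mono) auto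
  show "\<forall>q\<in>labels I X W \<omega> - labels I X (W \<inter> cube_block A z) \<omega>. f1 (M p \<omega>) * f2 (M q \<omega>) * h (X q \<omega> - X p \<omega>) = 0"
  proof
    fix q assume q: "q \<in> labels I X W \<omega> - labels I X (W \<inter> cube_block A z) \<omega>"
    then have nin: "X q \<omega> \<notin> cube_block A z" by (auto simp: labels_def)
    have z: "\<lfloor>X p \<omega> $ i\<rfloor> = z $ i" for i using p by (auto simp: labels_def lattice_cube_def floor_vec_def)
    have "h (X q \<omega> - X p \<omega>) = 0"
    proof (rule ccontr)
      assume "h (X q \<omega> - X p \<omega>) \<noteq> 0"
      then have "\<bar>X q \<omega> $ i - X p \<omega> $ i\<bar> \<le> real A" for i using supp[of "X q \<omega> - X p \<omega>" i] by simp
      then have "\<bar>\<lfloor>X q \<omega> $ i\<rfloor> - z $ i\<bar> \<le> int A" for i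
        using floor_diff_le[of "X q \<omega> $ i" "X p \<omega> $ i" A] z[of i] by simp
      then show False using nin by (simp add: cube_block_def lattice_block_def floor_vec_def)
    qed
    then show "f1 (M p \<omega>) * f2 (M q \<omega>) * h (X q \<omega> - X p \<omega>) = 0" by simp
  qed
qed

text \<open>
  The pair sum is a sum over cubes of the functionals of \<open>block_sum_covariance\<close>, so
  its variance is the sum of their covariances.
\<close>

lemma variance_bound:
  assumes c: "\<And>F. finite F \<Longrightarrow> (\<Sum>u\<in>F. cov_bound A u) \<le> c"
    and h: "h \<in> borel_measurable borel" "\<And>x. \<bar>h x\<bar> \<le> H" "0 < H"
    and supp: "\<And>x i. h x \<noteq> 0 \<Longrightarrow> \<bar>x $ i\<bar> \<le> real A"
    and W: "compact W"
  defines "S \<equiv> \<lambda>\<omega>. pairs h W W \<omega> \<omega>"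
  shows "integrable P S" "integrable P (\<lambda>\<omega>. (S \<omega>)\<^sup>2)" "variance S \<le> H\<^sup>2 * ((block_size A)\<^sup>2 * (real (card (cells W)) * c))"
proof -
  have WB: "W \<in> sets borel" and bW: "bounded W" using W by (auto simp: borel_compact compact_imp_bounded)
  have fin: "finite (cells W)" by (rule finite_cells[OF bW])
  define h' where "h' x = h x / H" for x
  have h': "h' \<in> borel_measurable borel" "\<And>x. \<bar>h' x\<bar> \<le> 1" using h by (auto simp: h'_def[abs_def] divide_le_eq)
  have supp': "\<bar>x $ i\<bar> \<le> real A" if "h' x \<noteq> 0" for x i using supp[of x i] that by (simp add: h'_def)
  define T where "T z \<omega> = pairs h' (W \<inter> lattice_cube z) (W \<inter> cube_block A z) \<omega> \<omega>" for z \<omega>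
  define S' where "S' \<omega> = (\<Sum>z\<in>cells W. T z \<omega>)" for \<omega>
  have Sets: "W \<inter> lattice_cube z \<in> sets borel" "W \<inter> cube_block A z \<in> sets borel" for z
    by (intro sets.Int WB sets_lattice_cube sets_cube_block)+
  note B = Int_lower2[of W "lattice_cube _"] Int_lower2[of W "cube_block A _"] Sets
  have c0: "block_size A \<noteq> 0" using less_imp_neq[OF block_size_pos(1)[of A]] by simp
  have T1: "integrable P (T z)" for z
  proof -
    have "integrable P (\<lambda>\<omega>. block_size A * (pairs h' (W \<inter> lattice_cube z) (W \<inter> cube_block A z) \<omega> \<omega> / block_size A))"
      using block_sum_second_moment(1)[OF h' B] by (rule integrable_mult_right)
    then show ?thesis using c0 by (simp add: T_def[abs_def])
  qed
  have T2: "integrable P (\<lambda>\<omega>. (T z \<omega>)\<^sup>2)" for z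
  proof -
    have "integrable P (\<lambda>\<omega>. (block_size A)\<^sup>2 * (pairs h' (W \<inter> lattice_cube z) (W \<inter> cube_block A z) \<omega> \<omega> / block_size A)\<^sup>2)"
      using block_sum_second_moment(2)[OF h' B] by (rule integrable_mult_right)
    then show ?thesis using c0 by (simp add: T_def[abs_def] power_divide)
  qed
  have TT: "integrable P (\<lambda>\<omega>. T z \<omega> * T z' \<omega>)" for z z'
  proof (rule Bochner_Integration.integrable_bound)
    show "integrable P (\<lambda>\<omega>. (T z \<omega>)\<^sup>2 + (T z' \<omega>)\<^sup>2)" using T2 by simp
    show "(\<lambda>\<omega>. T z \<omega> * T z' \<omega>) \<in> borel_measurable P"
      by (intro borel_measurable_times borel_measurable_integrable T1)
    have "\<bar>x * y\<bar> \<le> x\<^sup>2 + y\<^sup>2" for x y :: real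
    proof -
      have "2 * (\<bar>x\<bar> * \<bar>y\<bar>) \<le> x\<^sup>2 + y\<^sup>2" using zero_le_power2[of "\<bar>x\<bar> - \<bar>y\<bar>"] by (simp add: power2_diff)
      moreover have "0 \<le> \<bar>x\<bar> * \<bar>y\<bar>" by simp
      ultimately show ?thesis unfolding abs_mult by linarith
    qed
    then show "AE \<omega> in P. norm (T z \<omega> * T z' \<omega>) \<le> norm ((T z \<omega>)\<^sup>2 + (T z' \<omega>)\<^sup>2)"
      by (intro AE_I2) simp
  qed
  have sq: "(S' \<omega>)\<^sup>2 = (\<Sum>z\<in>cells W. \<Sum>z'\<in>cells W. T z \<omega> * T z' \<omega>)" for \<omega>
    by (simp add: S'_def power2_eq_square sum_product)
  have S'1: "integrable P S'" unfolding S'_def[abs_def] by (intro Bochner_Integration.integrable_sum T1)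
  have S'2: "integrable P (\<lambda>\<omega>. (S' \<omega>)\<^sup>2)" unfolding sq by (intro Bochner_Integration.integrable_sum TT)
  have SS': "S \<omega> = H * S' \<omega>" if g: "loc_finite \<omega>" for \<omega>
  proof -
    have "S \<omega> = H * pairs h' W W \<omega> \<omega>" unfolding S_def h'_def using h(3) by (subst pairs_scale[symmetric]) simp
    also have "pairs h' W W \<omega> \<omega> = (\<Sum>z\<in>cells W. pairs h' (W \<inter> lattice_cube z) W \<omega> \<omega>)"
      unfolding pair_sum_def by (rule sum_labels_cells[OF g bW])
    also have "\<dots> = S' \<omega>" unfolding S'_def T_def using pairs_truncate[OF supp' g bW] by simp
    finally show ?thesis .
  qed
  have Sm: "S \<in> borel_measurable P" unfolding S_def by (intro pairs_measurable h(1) WB)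
  have AEeq: "AE \<omega> in P. S \<omega> = H * S' \<omega>" using AE_loc_finite by (rule eventually_mono) (rule SS')
  have HS'm: "(\<lambda>\<omega>. H * S' \<omega>) \<in> borel_measurable P" using S'1 by measurable
  show "integrable P S"
    using integrable_cong_AE[OF Sm HS'm AEeq] S'1 by simp
  have AEeq2: "AE \<omega> in P. (S \<omega>)\<^sup>2 = H\<^sup>2 * (S' \<omega>)\<^sup>2" using AEeq by (rule eventually_mono) (simp add: power_mult_distrib)
  show "integrable P (\<lambda>\<omega>. (S \<omega>)\<^sup>2)"
    by (subst integrable_cong_AE[OF _ _ AEeq2]) (use Sm S'1 S'2 in auto)
  have ES: "expectation S = H * expectation S'"
    using integral_cong_AE[OF Sm HS'm AEeq] by simp
  have "variance S = expectation (\<lambda>\<omega>. H\<^sup>2 * (S' \<omega> - expectation S')\<^sup>2)"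
  proof (rule integral_cong_AE)
    show "AE \<omega> in P. (S \<omega> - expectation S)\<^sup>2 = H\<^sup>2 * (S' \<omega> - expectation S')\<^sup>2"
      using AEeq unfolding ES
      by (rule eventually_mono) (simp add: power_mult_distrib flip: right_diff_distrib)
  qed (use Sm S'1 in auto)
  also have "\<dots> = H\<^sup>2 * variance S'" by simp
  finally have var: "variance S = H\<^sup>2 * variance S'" .
  have "variance S' = expectation (\<lambda>\<omega>. (S' \<omega>)\<^sup>2) - (expectation S')\<^sup>2" by (rule variance_eq[OF S'1 S'2])
  also have "expectation (\<lambda>\<omega>. (S' \<omega>)\<^sup>2) = (\<Sum>z\<in>cells W. \<Sum>z'\<in>cells W. expectation (\<lambda>\<omega>. T z \<omega> * T z' \<omega>))"
    unfolding sq using TT by (subst Bochner_Integration.integral_sum) (auto intro!: sum.cong Bochner_Integration.integral_sum)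
  also have "(expectation S')\<^sup>2 = (\<Sum>z\<in>cells W. \<Sum>z'\<in>cells W. expectation (T z) * expectation (T z'))"
    unfolding S'_def[abs_def] by (simp add: Bochner_Integration.integral_sum T1 power2_eq_square sum_product)
  also have "(\<Sum>z\<in>cells W. \<Sum>z'\<in>cells W. expectation (\<lambda>\<omega>. T z \<omega> * T z' \<omega>)) - \<dots>
      = (\<Sum>z\<in>cells W. \<Sum>z'\<in>cells W. expectation (\<lambda>\<omega>. T z \<omega> * T z' \<omega>) - expectation (T z) * expectation (T z'))"
    by (simp add: sum_subtractf)
  also have "\<dots> \<le> (\<Sum>z\<in>cells W. \<Sum>z'\<in>cells W. (block_size A)\<^sup>2 * cov_bound A (z' - z))"
  proof (intro sum_mono)
    fix z z'
    show "expectation (\<lambda>\<omega>. T z \<omega> * T z' \<omega>) - expectation (T z) * expectation (T z') \<le> (block_size A)\<^sup>2 * cov_bound A (z' - z)"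
      using block_sum_covariance[OF h' B B, of z z'] by (simp add: T_def[abs_def] abs_le_iff)
  qed
  also have "\<dots> \<le> (\<Sum>z\<in>cells W. (block_size A)\<^sup>2 * c)"
  proof (rule sum_mono)
    fix z
    have "(\<Sum>z'\<in>cells W. cov_bound A (z' - z)) = (\<Sum>u\<in>(\<lambda>z'. z' - z) ` cells W. cov_bound A u)"
      by (subst sum.reindex) (auto simp: inj_on_def)
    also have "\<dots> \<le> c" using fin by (intro c) auto
    finally show "(\<Sum>z'\<in>cells W. (block_size A)\<^sup>2 * cov_bound A (z' - z)) \<le> (block_size A)\<^sup>2 * c"
      by (simp add: mult_left_mono flip: sum_distrib_left)
  qed
  also have "\<dots> = (block_size A)\<^sup>2 * (real (card (cells W)) * c)" by simp
  finally show "variance S \<le> H\<^sup>2 * ((block_size A)\<^sup>2 * (real (card (cells W)) * c))"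
    unfolding var by (intro mult_left_mono) auto
qed

end

section \<open>Centred marks and the statistics of the theorem\<close>

context mixing_mpp
begin

text \<open>
  The points in \<open>B\<close> with marks in \<open>C\<close> have an intensity measure
  proportional to Lebesgue measure. To see this, insert \<open>1 = \<integral>
  1\<^sub>Q(X\<^sub>n - y) dy\<close> with \<open>Q\<close> the unit cube, exchange the
  integrals, shift the process by \<open>y\<close>, and exchange them back: the points are then
  confined to \<open>Q\<close>, and \<open>h\<close> is integrated over all translates.
\<close>

lemma intensity_functional:
  fixes h :: "real ^ 'd \<Rightarrow> real" and C :: "'m set"
  assumes C: "C \<in> sets borel" and B: "B \<in> sets borel" "bounded B"
    and h: "h \<in> borel_measurable borel" "\<And>x. 0 \<le> h x" "\<And>x. x \<notin> B \<Longrightarrow> h x = 0"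
  shows "(\<integral>\<^sup>+\<omega>. ennreal (\<Sum>n\<in>labels I X B \<omega>. h (X n \<omega>) * indicator C (M n \<omega>)) \<partial>P)
    = (\<integral>\<^sup>+\<omega>. ennreal (\<Sum>n\<in>labels I X unit_cube \<omega>. indicator C (M n \<omega>)) \<partial>P) * (\<integral>\<^sup>+x. ennreal (h x) \<partial>lborel)"
proof -
  interpret PL: pair_sigma_finite P lborel ..
  let ?Q = "unit_cube :: (real ^ 'd) set"
  note [measurable] = h(1) C sets_unit_cube[where 'd='d]
  have eq: "sets (borel \<Otimes>\<^sub>M borel) = sets (borel :: ((real ^ 'd) \<times> 'm) measure)" by (simp only: borel_prod)
  note [measurable_cong] = eq[symmetric]
  have Qint: "(\<integral>\<^sup>+y. indicator ?Q (x - y) \<partial>lborel) = 1" for x :: "real ^ 'd"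
  proof -
    let ?R = "{y. x - y \<in> ?Q}"
    have b: "(1 :: real ^ 'd) \<bullet> i = 1" if "i \<in> Basis" for i using that by (auto simp: Basis_vec_def inner_axis)
    have "{y \<in> space borel. x - y \<in> ?Q} \<in> sets borel" by measurable
    then have R: "?R \<in> sets borel" by simp
    have "box (x - 1) x \<subseteq> ?R"
    proof
      fix y assume "y \<in> box (x - 1) x"
      then have "x $ i - 1 < y $ i \<and> y $ i < x $ i" for i by (simp add: mem_box_cart)
      then have "0 \<le> (x - y) $ i \<and> (x - y) $ i < 1" for i
        unfolding vector_minus_component by (smt (verit))
      then show "y \<in> ?R" unfolding unit_cube_def by blast
    qed
    moreover have "?R \<subseteq> cbox (x - 1) x"
    proof
      fix y assume "y \<in> ?R"
      then have "0 \<le> (x - y) $ i \<and> (x - y) $ i < 1" for i unfolding unit_cube_def by blast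
      then have "(x - 1) $ i \<le> y $ i \<and> y $ i \<le> x $ i" for i
        unfolding vector_minus_component one_index by (smt (verit))
      then show "y \<in> cbox (x - 1) x" by (simp add: mem_box_cart)
    qed
    ultimately have "emeasure lborel (box (x - 1) x) \<le> emeasure lborel ?R" "emeasure lborel ?R \<le> emeasure lborel (cbox (x - 1) x)"
      using R by (auto intro!: emeasure_mono)
    moreover have "emeasure lborel (box (x - 1) x) = 1" "emeasure lborel (cbox (x - 1) x) = 1"
      by (subst emeasure_lborel_box emeasure_lborel_cbox; simp add: inner_diff_left b)+
    ultimately have "emeasure lborel ?R = 1" by simp
    moreover have "(\<integral>\<^sup>+y. indicator ?Q (x - y) \<partial>lborel) = (\<integral>\<^sup>+y. indicator ?R y \<partial>lborel)"
      by (simp add: indicator_def)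
    ultimately show ?thesis using R by simp
  qed
  have hint: "(\<integral>\<^sup>+y. ennreal (h (x + y)) \<partial>lborel) = (\<integral>\<^sup>+y. ennreal (h y) \<partial>lborel)" for x
  proof -
    have "(\<integral>\<^sup>+y. ennreal (h y) \<partial>distr lborel borel (\<lambda>y. x + y)) = (\<integral>\<^sup>+y. ennreal (h (x + y)) \<partial>lborel)"
      by (subst nn_integral_distr) auto
    then show ?thesis by (simp only: lborel_distr_plus)
  qed
  define f1 where "f1 \<omega> y = (\<Sum>n\<in>labels I X B \<omega>. h (X n \<omega>) * indicator C (M n \<omega>) * indicator ?Q (X n \<omega> - y))" for \<omega> y
  define f2 where "f2 \<omega> y = (\<Sum>n\<in>labels I X ?Q \<omega>. h (X n \<omega> + y) * indicator C (M n \<omega>))" for \<omega> y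
  have f1m: "(\<lambda>(\<omega>, y). ennreal (f1 \<omega> y)) \<in> borel_measurable (P \<Otimes>\<^sub>M lborel)"
  proof -
    have "(\<lambda>p. window_integral B (\<lambda>e. h (fst e) * indicator C (snd e) * indicator ?Q (fst e - snd p)) (mpp I X M (fst p)))
       \<in> borel_measurable (P \<Otimes>\<^sub>M lborel)"
      by (rule borel_measurable_window_integral[OF measurable_compose[OF measurable_fst mpp_measurable] B(1)]) measurable
    then show ?thesis by (simp add: window_integral_mpp[OF B(1)] f1_def case_prod_beta)
  qed
  have f2m: "(\<lambda>(\<omega>, y). ennreal (f2 \<omega> y)) \<in> borel_measurable (P \<Otimes>\<^sub>M lborel)"
  proof -
    have "(\<lambda>p. window_integral ?Q (\<lambda>e. h (fst e + snd p) * indicator C (snd e)) (mpp I X M (fst p)))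
       \<in> borel_measurable (P \<Otimes>\<^sub>M lborel)"
      by (rule borel_measurable_window_integral[OF measurable_compose[OF measurable_fst mpp_measurable] sets_unit_cube]) measurable
    then show ?thesis by (simp add: window_integral_mpp[OF sets_unit_cube] f2_def case_prod_beta)
  qed
  have shift: "(\<integral>\<^sup>+\<omega>. ennreal (f1 \<omega> y) \<partial>P) = (\<integral>\<^sup>+\<omega>. ennreal (f2 \<omega> y) \<partial>P)" for y
  proof -
    let ?g = "\<lambda>e :: (real ^ 'd) \<times> 'm. h (fst e + y) * indicator C (snd e)"
    have g: "?g \<in> borel_measurable borel" by measurable
    have F: "(\<lambda>\<mu>. ennreal (window_integral ?Q ?g \<mu>)) \<in> borel_measurable (measure_algebra borel)"
      by (rule measurable_compose[OF _ measurable_ennreal],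
          rule borel_measurable_window_integral[OF measurable_ident_sets[OF refl] sets_unit_cube]) (use g in simp)
    have "f1 \<omega> y = (\<Sum>n\<in>labels I (\<lambda>n \<omega>. X n \<omega> - y) ?Q \<omega>. ?g (X n \<omega> - y, M n \<omega>))" if gd: "loc_finite \<omega>" for \<omega>
    proof -
      have bQ: "bounded (translate y ?Q)"
      proof -
        have "translate y ?Q \<subseteq> (\<lambda>x. y + x) ` cube_block 0 0"
          unfolding cube_block_0 lattice_cube_eq_translate translate_def by (auto intro!: image_eqI[where x="_ - y"])
        then show ?thesis by (rule bounded_subset[OF bounded_translation[OF bounded_cube_block]])
      qed
      have "f1 \<omega> y = (\<Sum>n\<in>labels I X (B \<inter> translate y ?Q) \<omega>. h (X n \<omega>) * indicator C (M n \<omega>))"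
        unfolding f1_def using gd B(2)
        by (intro sum.mono_neutral_cong_right) (auto simp: loc_finite_def labels_def translate_def indicator_def)
      also have "\<dots> = (\<Sum>n\<in>labels I X (translate y ?Q) \<omega>. h (X n \<omega>) * indicator C (M n \<omega>))"
        using gd bQ h(3) by (intro sum.mono_neutral_left) (auto simp: loc_finite_def labels_def)
      also have "\<dots> = (\<Sum>n\<in>labels I (\<lambda>n \<omega>. X n \<omega> - y) ?Q \<omega>. ?g (X n \<omega> - y, M n \<omega>))"
        by (simp add: labels_shift)
      finally show ?thesis .
    qed
    then have "(\<integral>\<^sup>+\<omega>. ennreal (f1 \<omega> y) \<partial>P) = (\<integral>\<^sup>+\<omega>. ennreal (window_integral ?Q ?g (mpp I (\<lambda>n \<omega>. X n \<omega> - y) M \<omega>)) \<partial>P)"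
      using AE_loc_finite by (intro nn_integral_cong_AE) (auto simp: window_integral_mpp[OF sets_unit_cube g] elim!: eventually_mono)
    also have "\<dots> = (\<integral>\<^sup>+\<omega>. ennreal (window_integral ?Q ?g (mpp I X M \<omega>)) \<partial>P)"
      by (rule stationary_nn_integral[OF F])
    finally show ?thesis by (simp add: window_integral_mpp[OF sets_unit_cube g] f2_def)
  qed
  have int1: "(\<integral>\<^sup>+y. ennreal (f1 \<omega> y) \<partial>lborel) = ennreal (\<Sum>n\<in>labels I X B \<omega>. h (X n \<omega>) * indicator C (M n \<omega>))" for \<omega>
  proof -
    have "(\<integral>\<^sup>+y. ennreal (f1 \<omega> y) \<partial>lborel) = (\<integral>\<^sup>+y. (\<Sum>n\<in>labels I X B \<omega>. ennreal (h (X n \<omega>) * indicator C (M n \<omega>)) * indicator ?Q (X n \<omega> - y)) \<partial>lborel)"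
      unfolding f1_def using h(2) by (intro nn_integral_cong, subst sum_ennreal[symmetric]) (auto simp: ennreal_mult ennreal_indicator intro!: sum.cong)
    also have "\<dots> = (\<Sum>n\<in>labels I X B \<omega>. ennreal (h (X n \<omega>) * indicator C (M n \<omega>)) * (\<integral>\<^sup>+y. indicator ?Q (X n \<omega> - y) \<partial>lborel))"
      by (subst nn_integral_sum) (auto simp: nn_integral_cmult)
    also have "\<dots> = ennreal (\<Sum>n\<in>labels I X B \<omega>. h (X n \<omega>) * indicator C (M n \<omega>))"
      unfolding Qint using h(2) by (simp add: sum_ennreal)
    finally show ?thesis .
  qed
  have int2: "(\<integral>\<^sup>+y. ennreal (f2 \<omega> y) \<partial>lborel) = ennreal (\<Sum>n\<in>labels I X ?Q \<omega>. indicator C (M n \<omega>)) * (\<integral>\<^sup>+x. ennreal (h x) \<partial>lborel)" for \<omega>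
  proof -
    have "(\<integral>\<^sup>+y. ennreal (f2 \<omega> y) \<partial>lborel) = (\<integral>\<^sup>+y. (\<Sum>n\<in>labels I X ?Q \<omega>. ennreal (indicator C (M n \<omega>)) * ennreal (h (X n \<omega> + y))) \<partial>lborel)"
      unfolding f2_def using h(2) by (intro nn_integral_cong, subst sum_ennreal[symmetric]) (auto simp: ennreal_mult mult.commute intro!: sum.cong)
    also have "\<dots> = (\<Sum>n\<in>labels I X ?Q \<omega>. ennreal (indicator C (M n \<omega>)) * (\<integral>\<^sup>+y. ennreal (h (X n \<omega> + y)) \<partial>lborel))"
      by (subst nn_integral_sum) (auto simp: nn_integral_cmult)
    also have "\<dots> = (\<Sum>n\<in>labels I X ?Q \<omega>. ennreal (indicator C (M n \<omega>))) * (\<integral>\<^sup>+x. ennreal (h x) \<partial>lborel)"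
      unfolding hint by (simp only: sum_distrib_right)
    finally show ?thesis by (simp add: sum_ennreal)
  qed
  have "(\<integral>\<^sup>+\<omega>. ennreal (\<Sum>n\<in>labels I X B \<omega>. h (X n \<omega>) * indicator C (M n \<omega>)) \<partial>P) = (\<integral>\<^sup>+\<omega>. (\<integral>\<^sup>+y. ennreal (f1 \<omega> y) \<partial>lborel) \<partial>P)"
    by (simp add: int1)
  also have "\<dots> = (\<integral>\<^sup>+y. (\<integral>\<^sup>+\<omega>. ennreal (f1 \<omega> y) \<partial>P) \<partial>lborel)"
    using PL.Fubini'[OF f1m] by simp
  also have "\<dots> = (\<integral>\<^sup>+y. (\<integral>\<^sup>+\<omega>. ennreal (f2 \<omega> y) \<partial>P) \<partial>lborel)" by (simp only: shift)
  also have "\<dots> = (\<integral>\<^sup>+\<omega>. (\<integral>\<^sup>+y. ennreal (f2 \<omega> y) \<partial>lborel) \<partial>P)"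
    using PL.Fubini'[OF f2m] by simp
  also have "\<dots> = (\<integral>\<^sup>+\<omega>. ennreal (\<Sum>n\<in>labels I X ?Q \<omega>. indicator C (M n \<omega>)) \<partial>P) * (\<integral>\<^sup>+x. ennreal (h x) \<partial>lborel)"
  proof -
    have "(\<lambda>\<omega>. \<Sum>n\<in>labels I X ?Q \<omega>. indicator C (M n \<omega>) :: real) \<in> borel_measurable P"
      using window_sum_measurable[OF sets_unit_cube, of "\<lambda>e. indicator C (snd e)"] by simp
    then show ?thesis unfolding int2 by (intro nn_integral_multc) auto
  qed
  finally show ?thesis .
qed

end

lemma infsum_finite_support:
  fixes f :: "'a \<Rightarrow> real"
  assumes "finite F" "F \<subseteq> A" "\<And>x. x \<in> A - F \<Longrightarrow> f x = 0"
  shows "infsum f A = sum f F"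
proof -
  have "infsum f A = infsum f F" using assms by (intro infsum_cong_neutral) auto
  then show ?thesis using assms(1) by simp
qed

lemma not_summable_on_constant:
  fixes f :: "'a \<Rightarrow> real"
  assumes "infinite S" "S \<subseteq> A" "\<And>x. x \<in> S \<Longrightarrow> f x = c" "c \<noteq> 0"
  shows "\<not> f summable_on A"
proof
  assume "f summable_on A"
  then have "f summable_on S" using assms(2) by (rule summable_on_subset_banach)
  then have "(\<lambda>_. c) summable_on S" using assms(3) by (simp cong: summable_on_cong)
  then show False using infsum_diverge_constant[OF assms(1,4)] by blast
qed

context mixing_mpp
begin

definition mark_dev :: "'m set \<Rightarrow> 'm \<Rightarrow> real" where
  "mark_dev C m = indicator C m - palm_mark P I X M C"

definition mark_sum :: "(real ^ 'd) set \<Rightarrow> 'm set \<Rightarrow> 'w \<Rightarrow> real" where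
  "mark_sum W C \<omega> = (\<Sum>n\<in>labels I X W \<omega>. mark_dev C (M n \<omega>))"

text \<open>
  The expected number of points in the unit cube with mark in \<open>C\<close>, as a sum over
  labels.
\<close>

definition unit_mass :: "'m set \<Rightarrow> ennreal" where
  "unit_mass C = (\<integral>\<^sup>+\<omega>. ennreal (\<Sum>n\<in>labels I X unit_cube \<omega>. indicator C (M n \<omega>)) \<partial>P)"

lemma unit_mass_eq:
  assumes C: "C \<in> sets borel"
  shows "(\<integral>\<^sup>+\<omega>. emeasure (mpp I X M \<omega>) (unit_cube \<times> C) \<partial>P) = unit_mass C"
  unfolding unit_mass_def
proof (rule nn_integral_cong_AE, rule eventually_mono[OF AE_loc_finite])
  fix \<omega> assume "loc_finite \<omega>"
  then have fin: "finite (labels I X unit_cube \<omega>)" using bounded_unit_cube[where 'd='d] by (simp add: loc_finite_def)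
  have "emeasure (mpp I X M \<omega>) (unit_cube \<times> C) = emeasure (count_space UNIV) {n \<in> labels I X unit_cube \<omega>. M n \<omega> \<in> C}"
    by (simp add: emeasure_mpp[OF sets_strip[OF sets_unit_cube C]] labels_def conj_ac)
  also have "\<dots> = of_nat (card {n \<in> labels I X unit_cube \<omega>. M n \<omega> \<in> C})" using fin by simp
  also have "\<dots> = ennreal (real (card {n \<in> labels I X unit_cube \<omega>. M n \<omega> \<in> C}))"
    by (simp add: ennreal_of_nat_eq_real_of_nat)
  also have "real (card {n \<in> labels I X unit_cube \<omega>. M n \<omega> \<in> C}) = (\<Sum>n\<in>labels I X unit_cube \<omega>. indicator C (M n \<omega>))"
    using fin by (simp add: indicator_def of_bool_def sum.If_cases Int_def)
  finally show "emeasure (mpp I X M \<omega>) (unit_cube \<times> C) = ennreal (\<Sum>n\<in>labels I X unit_cube \<omega>. indicator C (M n \<omega>))" .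
qed

lemma palm_mark_props:
  assumes C: "C \<in> sets borel" and lam: "0 < intensity P I X M" "intensity P I X M < \<infinity>"
  shows "0 \<le> palm_mark P I X M C" "palm_mark P I X M C \<le> 1"
    and "unit_mass C = ennreal (palm_mark P I X M C) * unit_mass UNIV"
proof -
  have U: "intensity P I X M = unit_mass UNIV" unfolding intensity_def by (rule unit_mass_eq) simp
  have le: "unit_mass C \<le> unit_mass UNIV"
    unfolding unit_mass_def by (intro nn_integral_mono ennreal_leI sum_mono) (auto simp: indicator_def)
  have p: "palm_mark P I X M C = enn2real (unit_mass C / unit_mass UNIV)"
    by (simp add: palm_mark_def unit_mass_eq[OF C] U)
  have quot: "unit_mass C / unit_mass UNIV \<le> 1"
    using le lam unfolding U by (simp add: divide_le_posI_ennreal)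
  show "0 \<le> palm_mark P I X M C" by (simp add: p)
  show "palm_mark P I X M C \<le> 1" unfolding p using quot by (simp add: enn2real_leI)
  have "ennreal (palm_mark P I X M C) = unit_mass C / unit_mass UNIV"
    unfolding p using quot by (intro ennreal_enn2real) (auto intro: le_less_trans)
  then show "unit_mass C = ennreal (palm_mark P I X M C) * unit_mass UNIV"
    using lam unfolding U by (simp add: ennreal_divide_times ennreal_mult_divide_eq)
qed

lemma mark_dev_measurable: "C \<in> sets borel \<Longrightarrow> mark_dev C \<in> borel_measurable borel"
  unfolding mark_dev_def[abs_def] by simp

lemma mark_dev_le:
  assumes C: "C \<in> sets borel" and lam: "0 < intensity P I X M" "intensity P I X M < \<infinity>"
  shows "\<bar>mark_dev C m\<bar> \<le> 1"
  using palm_mark_props(1,2)[OF assms] by (auto simp: mark_dev_def indicator_def)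

text \<open>
  By \<open>intensity_functional\<close>, replacing the mark set \<open>UNIV\<close> by
  \<open>C\<close> multiplies the expected sum of \<open>h(X\<^sub>n)\<close> by
  \<open>P\<^sub>M(C)\<close> for every location weight \<open>h\<close>.
\<close>

lemma centred_mark_dev:
  assumes C: "C \<in> sets borel" and lam: "0 < intensity P I X M" "intensity P I X M < \<infinity>"
  shows "centred (mark_dev C)"
  unfolding centred_def
proof (intro allI impI)
  fix B :: "(real ^ 'd) set" and h :: "real ^ 'd \<Rightarrow> real"
  assume B: "B \<in> sets borel" "bounded B" and h: "h \<in> borel_measurable borel" "\<forall>x. \<bar>h x\<bar> \<le> 1"
  let ?p = "palm_mark P I X M C"
  have eq: "sets (borel \<Otimes>\<^sub>M borel) = sets (borel :: ((real ^ 'd) \<times> 'm) measure)" by (simp only: borel_prod)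
  note [measurable_cong] = eq[symmetric]
  note [measurable] = h(1) C B(1)
  obtain A where A: "B \<subseteq> cube_block A 0" using bounded_subset_cube_block[OF B(2)] by blast
  let ?E = "\<lambda>D g. expectation (\<lambda>\<omega>. \<Sum>n\<in>labels I X B \<omega>. g (X n \<omega>) * indicator D (M n \<omega>))"
  have int: "integrable P (\<lambda>\<omega>. \<Sum>n\<in>labels I X B \<omega>. g (X n \<omega>) * indicator D (M n \<omega>))"
    if "g \<in> borel_measurable borel" "\<And>x. \<bar>g x\<bar> \<le> 1" "D \<in> sets borel" for g :: "real ^ 'd \<Rightarrow> real" and D
  proof -
    note [measurable] = that(1,3)
    have "\<bar>g (fst e) * indicator D (snd e)\<bar> \<le> 1" for e using that(2)[of "fst e"] by (simp add: indicator_def)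
    then show ?thesis
      using window_sum_integrable[OF B(1) _ _ A, of "\<lambda>e. g (fst e) * indicator D (snd e)"] by simp
  qed
  have scale: "?E C g = ?p * ?E UNIV g"
    if g: "g \<in> borel_measurable borel" "\<And>x. 0 \<le> g x" "\<And>x. g x \<le> 1" "\<And>x. x \<notin> B \<Longrightarrow> g x = 0" for g :: "real ^ 'd \<Rightarrow> real"
  proof -
    have gi: "\<bar>g x\<bar> \<le> 1" for x using g(2,3)[of x] by simp
    have e: "ennreal (?E D g) = unit_mass D * (\<integral>\<^sup>+x. ennreal (g x) \<partial>lborel)" if D: "D \<in> sets borel" for D
      using nn_integral_eq_integral[OF int[OF g(1) gi D]] intensity_functional[OF D B g(1,2,4)] g(2)
      by (simp add: unit_mass_def sum_nonneg)
    have "ennreal (?E C g) = ennreal ?p * ennreal (?E UNIV g)"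
      using e[OF C] e[of UNIV] by (simp add: palm_mark_props(3)[OF C lam] mult.assoc)
    also have "\<dots> = ennreal (?p * ?E UNIV g)"
      using g(2) palm_mark_props(1)[OF C lam] by (intro ennreal_mult[symmetric]) (auto intro!: Bochner_Integration.integral_nonneg sum_nonneg)
    finally show ?thesis
      using g(2) palm_mark_props(1)[OF C lam] by (subst (asm) ennreal_inj) (auto intro!: Bochner_Integration.integral_nonneg sum_nonneg mult_nonneg_nonneg)
  qed
  define hp where "hp x = max 0 (h x) * indicator B x" for x
  define hn where "hn x = max 0 (- h x) * indicator B x" for x
  have hm: "hp \<in> borel_measurable borel" "hn \<in> borel_measurable borel" unfolding hp_def[abs_def] hn_def[abs_def] by measurable
  have hb: "0 \<le> hp x" "hp x \<le> 1" "0 \<le> hn x" "hn x \<le> 1" for x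
    using h(2)[rule_format, of x] by (auto simp: hp_def hn_def indicator_def abs_le_iff)
  have hab: "\<bar>hp x\<bar> \<le> 1" "\<bar>hn x\<bar> \<le> 1" for x using hb[of x] by auto
  have h0: "x \<notin> B \<Longrightarrow> hp x = 0" "x \<notin> B \<Longrightarrow> hn x = 0" for x by (simp_all add: hp_def hn_def)
  let ?s = "\<lambda>D g \<omega>. \<Sum>n\<in>labels I X B \<omega>. g (X n \<omega>) * indicator D (M n \<omega>)"
  have "(\<Sum>q\<in>labels I X B \<omega>. mark_dev C (M q \<omega>) * h (X q \<omega>)) = (?s C hp \<omega> - ?s C hn \<omega>) - ?p * (?s UNIV hp \<omega> - ?s UNIV hn \<omega>)" for \<omega>
    unfolding sum_subtractf[symmetric] sum_distrib_left
  proof (intro sum.cong refl)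
    fix q assume "q \<in> labels I X B \<omega>"
    then have heq: "h (X q \<omega>) = hp (X q \<omega>) - hn (X q \<omega>)" by (simp add: labels_def hp_def hn_def max_def)
    then show "mark_dev C (M q \<omega>) * h (X q \<omega>) = hp (X q \<omega>) * indicator C (M q \<omega>) - hn (X q \<omega>) * indicator C (M q \<omega>)
      - ?p * (hp (X q \<omega>) * indicator UNIV (M q \<omega>) - hn (X q \<omega>) * indicator UNIV (M q \<omega>))"
      unfolding heq mark_dev_def by (simp add: algebra_simps)
  qed
  then have "expectation (\<lambda>\<omega>. \<Sum>q\<in>labels I X B \<omega>. mark_dev C (M q \<omega>) * h (X q \<omega>))
    = (?E C hp - ?E C hn) - ?p * (?E UNIV hp - ?E UNIV hn)"
    using int[OF hm(1) hab(1) C] int[OF hm(2) hab(2) C] int[OF hm(1) hab(1), of UNIV] int[OF hm(2) hab(2), of UNIV] by simp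
  also have "\<dots> = 0"
    using scale[OF hm(1) hb(1,2) h0(1)] scale[OF hm(2) hb(3,4) h0(2)] by (simp add: right_diff_distrib)
  finally show "expectation (\<lambda>\<omega>. \<Sum>q\<in>labels I X B \<omega>. mark_dev C (M q \<omega>) * h (X q \<omega>)) = 0" .
qed

lemma mark_bounded_marks:
  assumes "C \<in> sets borel" "D \<in> sets borel" and lam: "0 < intensity P I X M" "intensity P I X M < \<infinity>"
  shows "bounded_marks P I X M \<delta> K c0 \<beta> (mark_dev C) (mark_dev D)"
  by unfold_locales (use assms mark_dev_measurable mark_dev_le in auto)

lemma Y_stat_eq_mark_sum:
  assumes "loc_finite \<omega>" "bounded W"
  shows "Y_stat P I X M W C \<omega> = mark_sum W C \<omega> / sqrt (measure lborel W)"
proof -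
  have "(\<Sum>\<^sub>\<infinity>n\<in>I \<omega>. indicator W (X n \<omega>) * (indicator C (M n \<omega>) - palm_mark P I X M C))
     = (\<Sum>n\<in>labels I X W \<omega>. indicator W (X n \<omega>) * (indicator C (M n \<omega>) - palm_mark P I X M C))"
    using assms by (intro infsum_finite_support) (auto simp: loc_finite_def labels_def)
  also have "\<dots> = mark_sum W C \<omega>"
    unfolding mark_sum_def mark_dev_def by (intro sum.cong) (auto simp: labels_def)
  finally show ?thesis by (simp add: Y_stat_def)
qed



text \<open>
  The expectation in the theorem is a Bochner integral, for which equality almost everywhere
  with a measurable function is not enough on an incomplete space. So measurability is shown on
  the null set of realisations that are not locally finite, too.
\<close>

lemma Y_stat_measurable:
  assumes C: "C \<in> sets borel" and W: "W \<in> sets borel"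
  shows "Y_stat P I X M W C \<in> borel_measurable P"
proof -
  let ?p = "palm_mark P I X M C"
  let ?a = "\<lambda>\<omega>. emeasure (mpp I X M \<omega>) (W \<times> C)" and ?b = "\<lambda>\<omega>. emeasure (mpp I X M \<omega>) (W \<times> (- C))"
  let ?L = "\<lambda>\<omega>. {n \<in> labels I X W \<omega>. M n \<omega> \<in> C}" and ?R = "\<lambda>\<omega>. {n \<in> labels I X W \<omega>. M n \<omega> \<notin> C}"
  have a: "?a \<omega> = emeasure (count_space UNIV) (?L \<omega>)" and b: "?b \<omega> = emeasure (count_space UNIV) (?R \<omega>)" for \<omega>
    by (simp_all add: emeasure_mpp[OF sets_strip[OF W C]] emeasure_mpp[OF sets_strip[OF W borel_comp[OF C]]] labels_def conj_ac)
  have [measurable]: "?a \<in> borel_measurable P" "?b \<in> borel_measurable P"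
    by (intro emeasure_mpp_measurable sets_strip W C borel_comp)+
  let ?f = "\<lambda>\<omega> n. indicator W (X n \<omega>) * (indicator C (M n \<omega>) - ?p) :: real"
  \<comment> \<open>The summands take only the values \<open>0\<close>, \<open>1 - p\<close> and \<open>- p\<close>, so they are summable iff finitely many are nonzero; otherwise the sum is \<open>0\<close> by convention.\<close>
  have "(\<Sum>\<^sub>\<infinity>n\<in>I \<omega>. ?f \<omega> n) =
     (if (?p = 1 \<or> ?a \<omega> < \<infinity>) \<and> (?p = 0 \<or> ?b \<omega> < \<infinity>) then (1 - ?p) * enn2real (?a \<omega>) - ?p * enn2real (?b \<omega>) else 0)" for \<omega>
  proof -
    have fa: "?a \<omega> < \<infinity> \<longleftrightarrow> finite (?L \<omega>)" and fb: "?b \<omega> < \<infinity> \<longleftrightarrow> finite (?R \<omega>)"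
      by (simp_all add: a b emeasure_count_space of_nat_less_top)
    show ?thesis
    proof (cases "(?p = 1 \<or> finite (?L \<omega>)) \<and> (?p = 0 \<or> finite (?R \<omega>))")
      case True
      define F where "F = (if ?p = 1 then {} else ?L \<omega>) \<union> (if ?p = 0 then {} else ?R \<omega>)"
      have "(\<Sum>\<^sub>\<infinity>n\<in>I \<omega>. ?f \<omega> n) = (\<Sum>n\<in>F. ?f \<omega> n)"
        by (rule infsum_finite_support) (use True in \<open>auto simp: F_def labels_def indicator_def split: if_splits\<close>)
      also have "\<dots> = (\<Sum>n\<in>(if ?p = 1 then {} else ?L \<omega>). ?f \<omega> n) + (\<Sum>n\<in>(if ?p = 0 then {} else ?R \<omega>). ?f \<omega> n)"
        unfolding F_def by (rule sum.union_disjoint) (use True in auto)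
      also have "(\<Sum>n\<in>(if ?p = 1 then {} else ?L \<omega>). ?f \<omega> n) = (\<Sum>n\<in>(if ?p = 1 then {} else ?L \<omega>). 1 - ?p)"
        by (intro sum.cong) (auto simp: labels_def split: if_splits)
      also have "\<dots> = (1 - ?p) * enn2real (?a \<omega>)" using True by (auto simp: a)
      also have "(\<Sum>n\<in>(if ?p = 0 then {} else ?R \<omega>). ?f \<omega> n) = (\<Sum>n\<in>(if ?p = 0 then {} else ?R \<omega>). - ?p)"
        by (intro sum.cong) (auto simp: labels_def split: if_splits)
      also have "\<dots> = - (?p * enn2real (?b \<omega>))" using True by (auto simp: b)
      finally show ?thesis using True unfolding fa fb by simp
    next
      case False
      then consider "?p \<noteq> 1" "infinite (?L \<omega>)" | "?p \<noteq> 0" "infinite (?R \<omega>)" by blast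
      then have "\<not> ?f \<omega> summable_on I \<omega>"
      proof cases
        case 1
        then show ?thesis by (intro not_summable_on_constant[of "?L \<omega>" _ _ "1 - ?p"]) (auto simp: labels_def)
      next
        case 2
        then show ?thesis by (intro not_summable_on_constant[of "?R \<omega>" _ _ "- ?p"]) (auto simp: labels_def)
      qed
      then show ?thesis using False unfolding fa fb by (auto simp: infsum_not_exists)
    qed
  qed
  then show ?thesis unfolding Y_stat_def[abs_def] by simp
qed

text \<open>
  Both sets are translates of each other.
\<close>

lemma window_overlap_eq_covariogram:
  fixes W :: "(real ^ 'd) set"
  assumes "compact W"
  shows "measure lborel ((\<lambda>y. y - x) ` W \<inter> (\<lambda>y. y - z) ` W) = covariogram W (z - x)"
proof -
  let ?S = "{y \<in> W. y + (z - x) \<in> W}"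
  have eq: "(\<lambda>y. y - x) ` W \<inter> (\<lambda>y. y - z) ` W = (+) (- x) ` ?S"
  proof (intro set_eqI iffI)
    fix v assume "v \<in> (\<lambda>y. y - x) ` W \<inter> (\<lambda>y. y - z) ` W"
    then obtain y y' where "v = y - x" "y \<in> W" "v = y' - z" "y' \<in> W" by blast
    moreover have "y' = y + (z - x)" using calculation by (simp add: algebra_simps)
    ultimately show "v \<in> (+) (- x) ` ?S" by (intro image_eqI[of _ _ y]) auto
  next
    fix v assume "v \<in> (+) (- x) ` ?S"
    then obtain y where y: "v = - x + y" "y \<in> W" "y + (z - x) \<in> W" by blast
    show "v \<in> (\<lambda>y. y - x) ` W \<inter> (\<lambda>y. y - z) ` W"
      using y by (intro IntI image_eqI[of _ _ y] image_eqI[of _ _ "y + (z - x)"]) auto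
  qed
  have "compact ?S" by (rule compact_overlap[OF assms])
  then have S: "?S \<in> sets borel" "(+) (- x) ` ?S \<in> sets borel"
    by (auto intro!: borel_compact compact_continuous_image continuous_intros)
  show ?thesis unfolding eq covariogram_def
    using measure_translation[of "- x" ?S] S by (simp add: measure_completion)
qed

end

section \<open>The edge-corrected kernel and the estimator as a pair sum\<close>

lemma borel_measurable_covariogram:
  fixes W :: "(real ^ 'd) set"
  assumes "compact W"
  shows "covariogram W \<in> borel_measurable borel"
proof -
  have WB: "W \<in> sets borel" using assms by (rule borel_compact)
  have ind: "indicator {y \<in> W. y + u \<in> W} = (\<lambda>y. indicator W y * indicator W (y + u) :: real)" for u
    by (auto simp: fun_eq_iff indicator_def)
  have eq: "covariogram W = (\<lambda>u. \<integral>y. indicator W y * indicator W (y + u) \<partial>lborel)"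
  proof
    fix u
    have S: "{y \<in> W. y + u \<in> W} \<in> sets lborel"
      using borel_compact[OF compact_overlap[OF assms]] by simp
    have "covariogram W u = (\<integral>y. indicator {y \<in> W. y + u \<in> W} y \<partial>lborel)"
      unfolding covariogram_def using S by simp
    then show "covariogram W u = (\<integral>y. indicator W y * indicator W (y + u) \<partial>lborel)" unfolding ind .
  qed
  have iW: "(indicator W :: real ^ 'd \<Rightarrow> real) \<in> borel_measurable borel" using WB by simp
  have "(\<lambda>p. indicator W (snd p) * indicator W (snd p + fst p) :: real) \<in> borel_measurable (borel \<Otimes>\<^sub>M lborel)"
    by (intro borel_measurable_times measurable_compose[OF _ iW] borel_measurable_add) auto
  then show ?thesis unfolding eq
    by (intro lborel.borel_measurable_lebesgue_integral) (simp add: case_prod_beta)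
qed

lemma covariogram_0: "covariogram W 0 = measure lborel W"
  by (simp add: covariogram_def)

lemma covariogram_le:
  fixes W :: "(real ^ 'd) set"
  assumes "compact W" shows "covariogram W u \<le> measure lborel W"
  unfolding covariogram_def using compact_overlap[OF assms] assms
  by (intro measure_mono_fmeasurable) (auto simp: borel_compact fmeasurable_compact)

text \<open>
  The kernel of the estimator, with the edge correction, multiplied by the volume of the window.
\<close>

definition edge_kernel :: "(real \<Rightarrow> real) \<Rightarrow> real \<Rightarrow> (real ^ 'd) set \<Rightarrow> real ^ 'd \<Rightarrow> real" where
  "edge_kernel w a W u = measure lborel W / covariogram W u * w (norm u / a)"

text \<open>
  On the range \<open>|u| \<le> r_w a\<close> of the kernel, \<open>|u| / \<rho> \<le> 2 / (3
  d)\<close>. By Bernoulli's inequality the covariogram is then at least a third of the volume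
  of the window.
\<close>

lemma edge_kernel_props:
  fixes W :: "(real ^ 'd) set"
  assumes W: "convex W" "compact W" "cball x0 \<rho> \<subseteq> W" and V: "0 < measure lborel W" and \<rho>: "0 < \<rho>"
    and w: "\<And>x. 0 \<le> w x" "w \<in> borel_measurable borel" "\<And>x. w x \<le> m_w" "\<And>x. x \<notin> {- r_w..r_w} \<Longrightarrow> w x = 0"
    and r: "0 < r_w" and a: "0 < a" "r_w * a \<le> 2 / (3 * real CARD('d)) * \<rho>"
  shows "edge_kernel w a W \<in> borel_measurable borel"
    and "\<bar>edge_kernel w a W u\<bar> \<le> 3 * m_w"
    and "edge_kernel w a W u \<noteq> 0 \<Longrightarrow> norm u \<le> r_w * a"
proof -
  let ?d = "real CARD('d)" and ?V = "measure lborel W"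
  note [measurable] = w(2) borel_measurable_covariogram[OF W(2)]
  show "edge_kernel w a W \<in> borel_measurable borel" unfolding edge_kernel_def[abs_def] by measurable
  have d: "1 \<le> ?d" using zero_less_card_finite[where 'a='d] by linarith
  have supp: "norm u \<le> r_w * a" if "w (norm u / a) \<noteq> 0" for u :: "real ^ 'd"
  proof -
    have "norm u / a \<in> {- r_w..r_w}" using w(4) that by blast
    then show ?thesis using a(1) by (simp add: pos_divide_le_eq)
  qed
  then show "edge_kernel w a W u \<noteq> 0 \<Longrightarrow> norm u \<le> r_w * a" by (simp add: edge_kernel_def)
  have m0: "0 \<le> m_w" using w(1)[of 0] w(3)[of 0] by linarith
  show "\<bar>edge_kernel w a W u\<bar> \<le> 3 * m_w"
  proof (cases "w (norm u / a) = 0")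
    case True
    then show ?thesis using m0 by (simp add: edge_kernel_def)
  next
    case False
    define s where "s = norm u / \<rho>"
    have "norm u \<le> 2 / (3 * ?d) * \<rho>" using supp[OF False] a(2) by linarith
    then have s: "s \<le> 2 / (3 * ?d)" using \<rho> by (simp add: s_def pos_divide_le_eq)
    have s1: "s \<le> 1"
    proof -
      have "2 \<le> 3 * ?d" using d by linarith
      then have "2 / (3 * ?d) \<le> 1" by (subst divide_le_eq_1_pos) auto
      then show ?thesis using s by linarith
    qed
    have ds: "?d * s \<le> 2 / 3"
    proof -
      have "?d * s \<le> ?d * (2 / (3 * ?d))" using s by (intro mult_left_mono) auto
      then show ?thesis using d by simp
    qed
    have "1 / 3 \<le> 1 - ?d * s" using ds by (simp add: field_simps)
    also have "\<dots> = 1 + ?d * (- s)" by simp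
    also have "\<dots> \<le> (1 + (- s)) ^ CARD('d)" using s1 by (intro Bernoulli_inequality) auto
    finally have bern: "1 / 3 \<le> (1 - s) ^ CARD('d)" by simp
    have nu: "norm u \<le> \<rho>" using s1 \<rho> by (simp add: s_def divide_le_eq)
    have "1 / 3 * ?V \<le> (1 - s) ^ CARD('d) * ?V" using bern V by (intro mult_right_mono) auto
    also have "\<dots> \<le> covariogram W u" unfolding s_def by (rule covariogram_ge[OF W \<rho> nu])
    finally have cov: "1 / 3 * ?V \<le> covariogram W u" .
    moreover have "0 < 1 / 3 * ?V" using V by simp
    ultimately have c0: "0 < covariogram W u" by linarith
    have "?V / covariogram W u \<le> 3" using cov c0 by (simp add: pos_divide_le_eq)
    then have "?V / covariogram W u * w (norm u / a) \<le> 3 * m_w"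
      using w(1,3) V c0 by (intro mult_mono) auto
    moreover have "0 \<le> ?V / covariogram W u * w (norm u / a)" using w(1) V c0 by simp
    ultimately show ?thesis by (simp add: edge_kernel_def)
  qed
qed

lemma edge_kernel_tendsto:
  fixes W :: "nat \<Rightarrow> (real ^ 'd) set"
  assumes W: "\<And>k. convex (W k)" "\<And>k. compact (W k)" "\<And>k. cball (x0 k) (\<rho> k) \<subseteq> W k" and V: "\<And>k. 0 < measure lborel (W k)"
    and \<rho>: "\<And>k. 0 < \<rho> k" "filterlim \<rho> at_top sequentially"
    and w: "(w \<longlongrightarrow> w 0) (at 0)" "w 0 = 1" and a: "filterlim a at_top sequentially"
  shows "(\<lambda>k. edge_kernel w (a k) (W k) u) \<longlonglongrightarrow> 1"
proof -
  let ?d = "CARD('d)"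
  have \<rho>lim: "(\<lambda>k. norm u / \<rho> k) \<longlonglongrightarrow> 0"
    by (rule tendsto_divide_0[OF tendsto_const filterlim_at_top_imp_at_infinity[OF \<rho>(2)]])
  have alim: "(\<lambda>k. norm u / a k) \<longlonglongrightarrow> 0"
    by (rule tendsto_divide_0[OF tendsto_const filterlim_at_top_imp_at_infinity[OF a]])
  have "isCont w 0" using w(1) by (simp add: isCont_def)
  then have wlim: "(\<lambda>k. w (norm u / a k)) \<longlonglongrightarrow> 1" using isCont_tendsto_compose[OF \<open>isCont w 0\<close> alim] w(2) by simp
  have "(\<lambda>k. covariogram (W k) u / measure lborel (W k)) \<longlonglongrightarrow> 1"
  proof (rule tendsto_sandwich[of "\<lambda>k. (1 - norm u / \<rho> k) ^ ?d" _ _ "\<lambda>_. 1"])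
    have "eventually (\<lambda>k. norm u \<le> \<rho> k) sequentially" using \<rho>(2) unfolding filterlim_at_top by blast
    then show "eventually (\<lambda>k. (1 - norm u / \<rho> k) ^ ?d \<le> covariogram (W k) u / measure lborel (W k)) sequentially"
      by (rule eventually_mono) (use covariogram_ge[OF W \<rho>(1)] V in \<open>simp add: pos_le_divide_eq\<close>)
    show "eventually (\<lambda>k. covariogram (W k) u / measure lborel (W k) \<le> 1) sequentially"
      using covariogram_le[OF W(2)] V by (simp add: pos_divide_le_eq)
    show "(\<lambda>k. (1 - norm u / \<rho> k) ^ ?d) \<longlonglongrightarrow> 1"
      using tendsto_power[OF tendsto_diff[OF tendsto_const[of 1] \<rho>lim], of ?d] by simp
  qed simp
  then have "(\<lambda>k. inverse (covariogram (W k) u / measure lborel (W k)) * w (norm u / a k)) \<longlonglongrightarrow> inverse 1 * 1"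
    by (intro tendsto_mult wlim tendsto_inverse) auto
  then show ?thesis by (simp add: edge_kernel_def)
qed

context mixing_mpp
begin

lemma pairs_window_integrable:
  assumes "bounded_marks P I X M \<delta> K c0 \<beta> f1 f2" and h: "h \<in> borel_measurable borel" "\<And>x. \<bar>h x\<bar> \<le> 1" and W: "compact W"
  shows "integrable P (\<lambda>\<omega>. pair_sum I X M f1 f2 h W W \<omega> \<omega>)"
proof -
  interpret bounded_marks P I X M \<delta> K c0 \<beta> f1 f2 by fact
  obtain A where A: "W \<subseteq> cube_block A 0" using bounded_subset_cube_block[OF compact_imp_bounded[OF W]] by blast
  have "(\<integral>\<^sup>+\<omega>. ennreal (mean_count A 0 \<omega> * mean_count A 0 \<omega>) \<partial>P) \<le> ennreal (1 + 2 * K)"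
    by (rule order.trans[OF nn_integral_mono mean_count_moments2(1)[of A 0 A 0]])
       (rule ennreal_leI, rule product_powr_bounds(3), use delta_pos in auto)
  then have i: "integrable P (\<lambda>\<omega>. mean_count A 0 \<omega> * mean_count A 0 \<omega>)"
    by (intro integrableI_nonneg) (auto intro: le_less_trans)
  show ?thesis
  proof (rule Bochner_Integration.integrable_bound)
    show "integrable P (\<lambda>\<omega>. block_size A * block_size A * (mean_count A 0 \<omega> * mean_count A 0 \<omega>))" using i by simp
    show "(\<lambda>\<omega>. pairs h W W \<omega> \<omega>) \<in> borel_measurable P" using W by (intro pairs_measurable h borel_compact)
    show "AE \<omega> in P. norm (pairs h W W \<omega> \<omega>) \<le> norm (block_size A * block_size A * (mean_count A 0 \<omega> * mean_count A 0 \<omega>))"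
      using AE_loc_finite
    proof (rule eventually_mono)
      fix \<omega> assume g: "loc_finite \<omega>"
      show "norm (pairs h W W \<omega> \<omega>) \<le> norm (block_size A * block_size A * (mean_count A 0 \<omega> * mean_count A 0 \<omega>))"
        using pairs_block_le[OF g g h(2) A A] by (simp add: abs_mult)
    qed
  qed
qed

lemma mark_sum_product: "mark_sum W C \<omega> * mark_sum W D \<omega> = pair_sum I X M (mark_dev C) (mark_dev D) (\<lambda>_. 1) W W \<omega> \<omega>"
  by (simp add: mark_sum_def pair_sum_def sum_product)

text \<open>
  As the kernel equals \<open>1\<close> at \<open>0\<close>, the diagonal of the full pair sum
  is \<open>\<Sum> f\<^sub>C(M\<^sub>p) f\<^sub>D(M\<^sub>p)\<close>. This differs from the
  single sum of the estimator by terms linear in \<open>f\<^sub>C\<close> and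
  \<open>f\<^sub>D\<close>, which are the mark sums.
\<close>

lemma sigma_hat_eq_pair_sum:
  assumes g: "loc_finite \<omega>" and W: "compact W" "0 < measure lborel W" and w: "w 0 = 1"
    and a: "a = b * measure lborel W powr (1 / real CARD('d))"
  shows "sigma_hat P I X M w b W C D \<omega> =
    pair_sum I X M (mark_dev C) (mark_dev D) (edge_kernel w a W) W W \<omega> \<omega> / measure lborel W
    + (palm_mark P I X M D * mark_sum W C \<omega> + palm_mark P I X M C * mark_sum W D \<omega>) / measure lborel W"
proof -
  let ?V = "measure lborel W" and ?L = "labels I X W \<omega>" and ?h = "edge_kernel w a W"
  let ?p = "palm_mark P I X M C" and ?q = "palm_mark P I X M D"
  have fin: "finite ?L" using g W by (simp add: loc_finite_def compact_imp_bounded)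
  have sub: "?L \<subseteq> I \<omega>" and inW: "\<And>n. n \<in> ?L \<longleftrightarrow> n \<in> I \<omega> \<and> X n \<omega> \<in> W" by (auto simp: labels_def)
  let ?c = "\<lambda>p q. mark_dev C (M p \<omega>) * mark_dev D (M q \<omega>) * ?h (X q \<omega> - X p \<omega>)"
  have first: "(\<Sum>\<^sub>\<infinity>p\<in>I \<omega>. indicator W (X p \<omega>) * (indicator (C \<inter> D) (M p \<omega>) - ?p * ?q))
     = (\<Sum>p\<in>?L. indicator (C \<inter> D) (M p \<omega>) - ?p * ?q)"
    by (subst infsum_finite_support[OF fin sub]) (auto simp: inW intro!: sum.cong)
  have kernel0: "?h 0 = 1" using W(2) w by (simp add: edge_kernel_def covariogram_0)
  let ?S = "{(p, q). p \<in> I \<omega> \<and> q \<in> I \<omega> \<and> p \<noteq> q}"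
  let ?F = "{(p, q). p \<in> ?L \<and> q \<in> ?L \<and> p \<noteq> q}"
  have F: "?F = ?L \<times> ?L - (\<lambda>p. (p, p)) ` ?L" by auto
  have second: "(\<Sum>\<^sub>\<infinity>(p, q)\<in>?S. indicator W (X p \<omega>) * indicator W (X q \<omega>)
          * (indicator C (M p \<omega>) - ?p) * (indicator D (M q \<omega>) - ?q)
          / measure lborel ((\<lambda>y. y - X p \<omega>) ` W \<inter> (\<lambda>y. y - X q \<omega>) ` W)
          * w (norm (X q \<omega> - X p \<omega>) / (b * ?V powr (1 / real CARD('d)))))
     = (\<Sum>(p, q)\<in>?F. ?c p q) / ?V"
  proof -
    have finF: "finite ?F" unfolding F using fin by auto
    show ?thesis
      unfolding sum_divide_distrib
      by (subst infsum_finite_support[OF finF])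
         (use W(2) in \<open>auto simp: inW indicator_eq_0_iff window_overlap_eq_covariogram[OF W(1)] edge_kernel_def a mark_dev_def intro!: sum.cong\<close>)
  qed
  have "pair_sum I X M (mark_dev C) (mark_dev D) ?h W W \<omega> \<omega> = (\<Sum>(p, q)\<in>?L \<times> ?L. ?c p q)"
    by (simp add: pair_sum_def sum.cartesian_product)
  also have "\<dots> = (\<Sum>(p, q)\<in>?F. ?c p q) + (\<Sum>(p, q)\<in>(\<lambda>p. (p, p)) ` ?L. ?c p q)"
    unfolding F using fin by (intro sum.subset_diff) auto
  also have "(\<Sum>(p, q)\<in>(\<lambda>p. (p, p)) ` ?L. ?c p q) = (\<Sum>p\<in>?L. mark_dev C (M p \<omega>) * mark_dev D (M p \<omega>))"
    by (subst sum.reindex) (auto simp: inj_on_def kernel0)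
  finally have pairs: "pair_sum I X M (mark_dev C) (mark_dev D) ?h W W \<omega> \<omega>
     = (\<Sum>(p, q)\<in>?F. ?c p q) + (\<Sum>p\<in>?L. mark_dev C (M p \<omega>) * mark_dev D (M p \<omega>))" .
  have marks: "(\<Sum>p\<in>?L. indicator (C \<inter> D) (M p \<omega>) - ?p * ?q)
     = (\<Sum>p\<in>?L. mark_dev C (M p \<omega>) * mark_dev D (M p \<omega>)) + (?q * mark_sum W C \<omega> + ?p * mark_sum W D \<omega>)"
    unfolding mark_sum_def sum_distrib_left sum.distrib[symmetric]
    by (intro sum.cong refl) (simp add: mark_dev_def indicator_inter_arith algebra_simps)
  show ?thesis
    unfolding sigma_hat_def first second pairs marks by (simp add: add_divide_distrib)
qed

end

section \<open>Consistency of the estimator\<close>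

context mixing_mpp
begin

text \<open>
  The mean square error is at most a constant times the sum of the squared bias, the variance of
  the pair sum, and the second moment of the mark sums, each suitably normalised.
\<close>

lemma estimator_consistent:
  fixes W :: "nat \<Rightarrow> (real ^ 'd) set"
  assumes lam: "0 < intensity P I X M" "intensity P I X M < \<infinity>" and C: "C \<in> sets borel" and D: "D \<in> sets borel"
    and summable: "(\<integral>\<^sup>+ r\<in>{1..}. ennreal (r ^ (CARD('d) - 1) * \<beta> r powr \<theta>) \<partial>lborel) < \<infinity>"
    and W: "\<And>k. convex (W k)" "\<And>k. compact (W k)" "\<And>k. cball (x0 k) (\<rho> k) \<subseteq> W k"
    and \<rho>: "\<And>k. real CARD('d) \<le> \<rho> k" "filterlim \<rho> at_top sequentially"
    and w: "\<And>x. 0 \<le> w x" "w \<in> borel_measurable borel" "\<And>x. w x \<le> m_w" "\<And>x. x \<notin> {- r_w..r_w} \<Longrightarrow> w x = 0"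
      "(w \<longlongrightarrow> w 0) (at 0)" "w 0 = 1" "0 < r_w"
    and a: "\<And>k. a k = b k * measure lborel (W k) powr (1 / real CARD('d))" "\<And>k. 0 < a k"
      "\<And>k. r_w * a k \<le> 2 / (3 * real CARD('d)) * \<rho> k" "filterlim a at_top sequentially"
      "(\<lambda>k. a k ^ (3 * CARD('d)) / measure lborel (W k)) \<longlonglongrightarrow> 0"
  shows "\<exists>\<sigma>::real.
    (\<lambda>k. expectation (\<lambda>\<omega>. Y_stat P I X M (W k) C \<omega> * Y_stat P I X M (W k) D \<omega>)) \<longlonglongrightarrow> \<sigma> \<and>
    (\<lambda>k. \<integral>\<^sup>+ \<omega>. ennreal ((\<sigma> - sigma_hat P I X M w (b k) (W k) C D \<omega>)\<^sup>2) \<partial>P) \<longlonglongrightarrow> 0"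
proof -
  let ?d = "CARD('d)"
  define V where "V k = measure lborel (W k)" for k
  have d: "1 \<le> real ?d" using zero_less_card_finite[where 'a='d] by linarith
  have \<rho>0: "0 < \<rho> k" for k using \<rho>(1)[of k] d by linarith
  have V0: "0 < V k" for k
  proof -
    have "0 < measure lborel (cball (x0 k) (\<rho> k))" by (rule content_cball_pos[OF \<rho>0])
    also have "\<dots> \<le> V k" unfolding V_def using W(2,3)
      by (intro measure_mono_fmeasurable) (auto simp: fmeasurable_compact)
    finally show ?thesis .
  qed
  have WB: "W k \<in> sets borel" "bounded (W k)" for k using W(2) by (auto simp: borel_compact compact_imp_bounded)
  interpret CD: bounded_marks P I X M \<delta> K c0 \<beta> "mark_dev C" "mark_dev D" by (rule mark_bounded_marks[OF C D lam])
  interpret CC: bounded_marks P I X M \<delta> K c0 \<beta> "mark_dev C" "mark_dev C" by (rule mark_bounded_marks[OF C C lam])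
  interpret DD: bounded_marks P I X M \<delta> K c0 \<beta> "mark_dev D" "mark_dev D" by (rule mark_bounded_marks[OF D D lam])
  define \<sigma> where "\<sigma> = (\<integral>u. CD.\<kappa> u \<partial>count_space UNIV)"
  let ?one = "\<lambda>(_ :: nat) (_ :: real ^ 'd). 1 :: real"
  have one: "\<And>k. ?one k \<in> borel_measurable borel" "\<And>k x. \<bar>?one k x\<bar> \<le> 1" "(0::real) < 1" "\<And>x. (\<lambda>k. ?one k x) \<longlonglongrightarrow> 1" by auto
  have lim1: "(\<lambda>k. expectation (\<lambda>\<omega>. mark_sum (W k) C \<omega> * mark_sum (W k) D \<omega>) / V k) \<longlonglongrightarrow> \<sigma>"
    using CD.mean_limit[OF centred_mark_dev[OF D lam] summable one W \<rho>] by (simp add: mark_sum_product V_def \<sigma>_def)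
  have limC: "(\<lambda>k. expectation (\<lambda>\<omega>. mark_sum (W k) C \<omega> * mark_sum (W k) C \<omega>) / V k) \<longlonglongrightarrow> (\<integral>u. CC.\<kappa> u \<partial>count_space UNIV)"
    using CC.mean_limit[OF centred_mark_dev[OF C lam] summable one W \<rho>] by (simp add: mark_sum_product V_def)
  have limD: "(\<lambda>k. expectation (\<lambda>\<omega>. mark_sum (W k) D \<omega> * mark_sum (W k) D \<omega>) / V k) \<longlonglongrightarrow> (\<integral>u. DD.\<kappa> u \<partial>count_space UNIV)"
    using DD.mean_limit[OF centred_mark_dev[OF D lam] summable one W \<rho>] by (simp add: mark_sum_product V_def)
  have YY: "expectation (\<lambda>\<omega>. Y_stat P I X M (W k) C \<omega> * Y_stat P I X M (W k) D \<omega>) =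
      expectation (\<lambda>\<omega>. mark_sum (W k) C \<omega> * mark_sum (W k) D \<omega>) / V k" for k
  proof -
    have "expectation (\<lambda>\<omega>. Y_stat P I X M (W k) C \<omega> * Y_stat P I X M (W k) D \<omega>) =
      expectation (\<lambda>\<omega>. mark_sum (W k) C \<omega> * mark_sum (W k) D \<omega> / V k)"
    proof (rule integral_cong_AE)
      show "(\<lambda>\<omega>. Y_stat P I X M (W k) C \<omega> * Y_stat P I X M (W k) D \<omega>) \<in> borel_measurable P"
        by (intro borel_measurable_times Y_stat_measurable C D WB)
      show "(\<lambda>\<omega>. mark_sum (W k) C \<omega> * mark_sum (W k) D \<omega> / V k) \<in> borel_measurable P"
        unfolding mark_sum_product by (intro borel_measurable_divide CD.pairs_measurable WB) auto
      show "AE \<omega> in P. Y_stat P I X M (W k) C \<omega> * Y_stat P I X M (W k) D \<omega> = mark_sum (W k) C \<omega> * mark_sum (W k) D \<omega> / V k"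
        using AE_loc_finite by (rule eventually_mono) (use V0[of k] in \<open>simp add: Y_stat_eq_mark_sum WB V_def\<close>)
    qed
    then show ?thesis by simp
  qed
  define h where "h k = edge_kernel w (a k) (W k)" for k
  have m1: "1 \<le> m_w" using w(3)[of 0] w(6) by simp
  define H where "H = 3 * m_w"
  have H0: "0 < H" using m1 by (simp add: H_def)
  note ekp = edge_kernel_props[OF W V0[unfolded V_def] \<rho>0 w(1-4) w(7) a(2,3)]
  have h: "\<And>k. h k \<in> borel_measurable borel" "\<And>k x. \<bar>h k x\<bar> \<le> H" "\<And>k x. h k x \<noteq> 0 \<Longrightarrow> norm x \<le> r_w * a k"
    unfolding h_def H_def by (rule ekp; assumption)+
  have hlim: "\<And>x. (\<lambda>k. h k x) \<longlonglongrightarrow> 1"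
    unfolding h_def by (rule edge_kernel_tendsto[OF W V0[unfolded V_def] \<rho>0 \<rho>(2) w(5,6) a(4)])
  define S where "S k \<omega> = CD.pairs (h k) (W k) (W k) \<omega> \<omega>" for k \<omega>
  define L where "L k = expectation (S k) / V k" for k
  have Llim: "L \<longlonglongrightarrow> \<sigma>"
    using CD.mean_limit[OF centred_mark_dev[OF D lam] summable h(1,2) H0 hlim W \<rho>]
    unfolding L_def[abs_def] S_def[abs_def] V_def \<sigma>_def .
  obtain c where c: "0 \<le> c" "\<And>A F. finite F \<Longrightarrow> (\<Sum>u\<in>F. cov_bound A u) \<le> c * (real A + 1) ^ ?d"
    using sum_cov_bound_le[OF summable] by blast
  define A where "A k = nat \<lceil>r_w * a k\<rceil>" for k
  have A: "r_w * a k \<le> real (A k)" "real (A k) \<le> r_w * a k + 1" for k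
  proof -
    have "0 \<le> r_w * a k" using w(7) a(2)[of k] by simp
    then show "r_w * a k \<le> real (A k)" "real (A k) \<le> r_w * a k + 1" unfolding A_def by linarith+
  qed
  have supp: "\<bar>x $ i\<bar> \<le> real (A k)" if "h k x \<noteq> 0" for k x i
    using h(3)[OF that] A(1)[of k] component_le_norm_cart[of x i] by linarith
  have S1: "integrable P (S k)" for k
    unfolding S_def[abs_def] by (rule CD.variance_bound(1)[OF c(2) h(1,2) H0 supp W(2)])
  have S2: "integrable P (\<lambda>\<omega>. (S k \<omega>)\<^sup>2)" for k
    unfolding S_def[abs_def] by (rule CD.variance_bound(2)[OF c(2) h(1,2) H0 supp W(2)])
  have Svar: "variance (S k) \<le> H\<^sup>2 * ((block_size (A k))\<^sup>2 * (real (card (cells (W k))) * (c * (real (A k) + 1) ^ ?d)))" for k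
    unfolding S_def[abs_def] by (rule CD.variance_bound(3)[OF c(2) h(1,2) H0 supp W(2)])
  define C1 where "C1 = H\<^sup>2 * c * 2 ^ (3 * ?d) * (r_w + 2) ^ (3 * ?d)"
  have varlim: "(\<lambda>k. variance (S k) / (V k)\<^sup>2) \<longlonglongrightarrow> 0"
  proof (rule tendsto_sandwich[of "\<lambda>_. 0" _ _ "\<lambda>k. C1 * (a k ^ (3 * ?d) / V k)"])
    show "eventually (\<lambda>k. 0 \<le> variance (S k) / (V k)\<^sup>2) sequentially"
      by (intro always_eventually allI divide_nonneg_nonneg Bochner_Integration.integral_nonneg) auto
    show "(\<lambda>k. C1 * (a k ^ (3 * ?d) / V k)) \<longlonglongrightarrow> 0"
      using tendsto_mult_left[OF a(5), of C1] by (simp add: V_def)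
    have "eventually (\<lambda>k. 1 \<le> a k) sequentially" using a(4) unfolding filterlim_at_top by blast
    then show "eventually (\<lambda>k. variance (S k) / (V k)\<^sup>2 \<le> C1 * (a k ^ (3 * ?d) / V k)) sequentially"
    proof (rule eventually_mono)
      fix k assume a1: "1 \<le> a k"
      let ?B = "real (A k) + 1"
      have B: "?B \<le> (r_w + 2) * a k"
      proof -
        have "?B \<le> r_w * a k + 2 * 1" using A(2)[of k] by simp
        also have "\<dots> \<le> r_w * a k + 2 * a k" using a1 by (intro add_left_mono mult_left_mono) auto
        finally show ?thesis by (simp add: distrib_right)
      qed
      have cA2: "(block_size (A k))\<^sup>2 \<le> (2 * ?B) ^ (2 * ?d)"
      proof -
        have "block_size (A k) \<le> (2 * ?B) ^ ?d" unfolding block_size_def of_nat_power by (rule power_mono) auto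
        then have "(block_size (A k))\<^sup>2 \<le> ((2 * ?B) ^ ?d)\<^sup>2" by (rule power_mono) simp
        then show ?thesis by (simp only: power_mult[symmetric] mult.commute)
      qed
      have cells: "real (card (cells (W k))) \<le> 2 ^ ?d * V k"
      proof -
        have "real (card (cells (W k))) \<le> (1 + real ?d / \<rho> k) ^ ?d * V k"
          unfolding V_def by (rule card_cells_le[OF W \<rho>0])
        also have "\<dots> \<le> 2 ^ ?d * V k"
          using \<rho>(1)[of k] \<rho>0[of k] V0[of k] by (intro mult_right_mono power_mono) (auto simp: add_nonneg_nonneg)
        finally show ?thesis .
      qed
      have "variance (S k) \<le> H\<^sup>2 * ((block_size (A k))\<^sup>2 * (real (card (cells (W k))) * (c * ?B ^ ?d)))" by (rule Svar)
      also have "\<dots> \<le> H\<^sup>2 * ((2 * ?B) ^ (2 * ?d) * (2 ^ ?d * V k * (c * ?B ^ ?d)))"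
        using cA2 cells c(1) V0[of k] by (intro mult_left_mono mult_mono mult_nonneg_nonneg) auto
      also have "\<dots> = H\<^sup>2 * c * 2 ^ (3 * ?d) * ?B ^ (3 * ?d) * V k"
      proof -
        have "(2 * ?B) ^ (2 * ?d) * (2 ^ ?d * ?B ^ ?d) = (2 * ?B) ^ (2 * ?d) * (2 * ?B) ^ ?d" by (simp only: power_mult_distrib)
        also have "\<dots> = (2 * ?B) ^ (3 * ?d)" by (simp add: power_add[symmetric])
        finally have e: "(2 * ?B) ^ (2 * ?d) * (2 ^ ?d * ?B ^ ?d) = 2 ^ (3 * ?d) * ?B ^ (3 * ?d)" by (simp only: power_mult_distrib)
        have "x1 * (x2 * (x3 * v * (x4 * x5))) = x1 * x4 * (x2 * (x3 * x5)) * v" for x1 x2 x3 x4 x5 v :: real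
          by (simp only: mult_ac)
        then have "H\<^sup>2 * ((2 * ?B) ^ (2 * ?d) * (2 ^ ?d * V k * (c * ?B ^ ?d))) = H\<^sup>2 * c * ((2 * ?B) ^ (2 * ?d) * (2 ^ ?d * ?B ^ ?d)) * V k" .
        then show ?thesis unfolding e by (simp only: mult.assoc)
      qed
      also have "\<dots> \<le> H\<^sup>2 * c * 2 ^ (3 * ?d) * ((r_w + 2) * a k) ^ (3 * ?d) * V k"
        using B c(1) V0[of k] by (intro mult_right_mono mult_left_mono power_mono) auto
      also have "\<dots> = C1 * a k ^ (3 * ?d) * V k" by (simp add: C1_def power_mult_distrib)
      finally have "variance (S k) / (V k)\<^sup>2 \<le> C1 * a k ^ (3 * ?d) * V k / (V k)\<^sup>2" by (rule divide_right_mono) simp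
      also have "\<dots> = C1 * (a k ^ (3 * ?d) / V k)" using V0[of k] by (simp add: power2_eq_square)
      finally show "variance (S k) / (V k)\<^sup>2 \<le> C1 * (a k ^ (3 * ?d) / V k)" .
    qed
  qed simp
  have Vlim: "(\<lambda>k. 1 / V k) \<longlonglongrightarrow> 0"
  proof (rule tendsto_sandwich[of "\<lambda>_. 0" _ _ "\<lambda>k. a k ^ (3 * ?d) / V k"])
    have "eventually (\<lambda>k. 1 \<le> a k) sequentially" using a(4) unfolding filterlim_at_top by blast
    then show "eventually (\<lambda>k. 1 / V k \<le> a k ^ (3 * ?d) / V k) sequentially"
      by (rule eventually_mono) (use V0 in \<open>auto intro!: divide_right_mono less_imp_le[OF V0] one_le_power\<close>)
    show "eventually (\<lambda>k. 0 \<le> 1 / V k) sequentially" using V0 by (intro always_eventually allI) (simp add: less_imp_le)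
  qed (use a(5) in \<open>simp_all add: V_def\<close>)
  define EC where "EC k = expectation (\<lambda>\<omega>. mark_sum (W k) C \<omega> * mark_sum (W k) C \<omega>) / V k" for k
  define ED where "ED k = expectation (\<lambda>\<omega>. mark_sum (W k) D \<omega> * mark_sum (W k) D \<omega>) / V k" for k
  define bound where "bound k = 3 * (\<sigma> - L k)\<^sup>2 + 3 * (variance (S k) / (V k)\<^sup>2) + 6 * ((EC k + ED k) * (1 / V k))" for k
  have le: "(\<integral>\<^sup>+ \<omega>. ennreal ((\<sigma> - sigma_hat P I X M w (b k) (W k) C D \<omega>)\<^sup>2) \<partial>P) \<le> ennreal (bound k)" for k
  proof -
    let ?p = "palm_mark P I X M C" and ?q = "palm_mark P I X M D"
    let ?sC = "mark_sum (W k) C" and ?sD = "mark_sum (W k) D"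
    define R where "R \<omega> = 3 * (\<sigma> - L k)\<^sup>2 + 3 * ((S k \<omega> - expectation (S k))\<^sup>2 / (V k)\<^sup>2) + 6 * ((?sC \<omega> * ?sC \<omega> + ?sD \<omega> * ?sD \<omega>) / (V k)\<^sup>2)" for \<omega>
    have iC: "integrable P (\<lambda>\<omega>. ?sC \<omega> * ?sC \<omega>)"
      unfolding mark_sum_product using W(2) by (intro pairs_window_integrable CC.bounded_marks_axioms) auto
    have iD: "integrable P (\<lambda>\<omega>. ?sD \<omega> * ?sD \<omega>)"
      unfolding mark_sum_product using W(2) by (intro pairs_window_integrable DD.bounded_marks_axioms) auto
    have iS: "integrable P (\<lambda>\<omega>. (S k \<omega> - expectation (S k))\<^sup>2)"
      using S1[of k] S2[of k] by (simp add: power2_diff)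
    have iR: "integrable P R" unfolding R_def[abs_def] using iC iD iS by simp
    have ER: "expectation R = bound k"
      unfolding R_def[abs_def] bound_def EC_def ED_def using iC iD iS V0[of k]
      by (simp add: prob_space power2_eq_square add_divide_distrib)
    have R0: "0 \<le> R \<omega>" for \<omega>
    proof -
      have "0 \<le> ?sC \<omega> * ?sC \<omega> + ?sD \<omega> * ?sD \<omega>" by simp
      then have "0 \<le> (?sC \<omega> * ?sC \<omega> + ?sD \<omega> * ?sD \<omega>) / (V k)\<^sup>2" by (rule divide_nonneg_nonneg) simp
      then show ?thesis unfolding R_def by simp
    qed
    have pt: "(\<sigma> - sigma_hat P I X M w (b k) (W k) C D \<omega>)\<^sup>2 \<le> R \<omega>" if g: "loc_finite \<omega>" for \<omega>
    proof -
      define x where "x = \<sigma> - L k"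
      define y where "y = (S k \<omega> - expectation (S k)) / V k"
      define z where "z = (?q * ?sC \<omega> + ?p * ?sD \<omega>) / V k"
      have sh: "sigma_hat P I X M w (b k) (W k) C D \<omega> = S k \<omega> / V k + z"
        unfolding S_def h_def z_def V_def by (rule sigma_hat_eq_pair_sum[where w = w, OF g W(2)[of k] V0[of k, unfolded V_def] w(6) a(1)[of k]])
      have combine: "t \<le> 3 * r1 + 3 * r2 + 6 * r3" if "t = r" "r \<le> 3 * r1 + 3 * r2' + 3 * r3'" "r3' \<le> 2 * r3" "r2' = r2" for t r r1 r2 r2' r3 r3' :: real
        using that by linarith
      have "\<sigma> - sigma_hat P I X M w (b k) (W k) C D \<omega> = x - y - z"
        unfolding sh x_def y_def L_def by (simp add: diff_divide_distrib)
      then have "(\<sigma> - sigma_hat P I X M w (b k) (W k) C D \<omega>)\<^sup>2 = (x - y - z)\<^sup>2" by simp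
      moreover have "(x - y - z)\<^sup>2 \<le> 3 * x\<^sup>2 + 3 * y\<^sup>2 + 3 * z\<^sup>2"
      proof -
        have "0 \<le> (x + y)\<^sup>2 + (x + z)\<^sup>2 + (y - z)\<^sup>2" by simp
        then show ?thesis by (simp add: power2_eq_square algebra_simps)
      qed
      moreover have "z\<^sup>2 \<le> 2 * ((?sC \<omega> * ?sC \<omega> + ?sD \<omega> * ?sD \<omega>) / (V k)\<^sup>2)"
      proof -
        have pq: "0 \<le> ?p" "?p \<le> 1" "0 \<le> ?q" "?q \<le> 1" using palm_mark_props(1,2) C D lam by auto
        have "(?q * ?sC \<omega> + ?p * ?sD \<omega>)\<^sup>2 \<le> 2 * (?q * ?sC \<omega>)\<^sup>2 + 2 * (?p * ?sD \<omega>)\<^sup>2"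
          using zero_le_power2[of "?q * ?sC \<omega> - ?p * ?sD \<omega>"] by (simp add: power2_sum power2_diff)
        also have "\<dots> = 2 * (?q\<^sup>2 * (?sC \<omega>)\<^sup>2) + 2 * (?p\<^sup>2 * (?sD \<omega>)\<^sup>2)" by (simp add: power_mult_distrib)
        also have "\<dots> \<le> 2 * (1 * (?sC \<omega>)\<^sup>2) + 2 * (1 * (?sD \<omega>)\<^sup>2)"
          using pq by (intro add_mono mult_left_mono mult_right_mono power_le_one) auto
        finally have "(?q * ?sC \<omega> + ?p * ?sD \<omega>)\<^sup>2 / (V k)\<^sup>2 \<le> (2 * (?sC \<omega>)\<^sup>2 + 2 * (?sD \<omega>)\<^sup>2) / (V k)\<^sup>2"
          by (intro divide_right_mono) auto
        then show ?thesis unfolding z_def power_divide by (simp add: power2_eq_square distrib_left)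
      qed
      moreover have "y\<^sup>2 = (S k \<omega> - expectation (S k))\<^sup>2 / (V k)\<^sup>2" unfolding y_def power_divide ..
      ultimately show ?thesis unfolding R_def x_def[symmetric] by (rule combine)
    qed
    have "(\<integral>\<^sup>+ \<omega>. ennreal ((\<sigma> - sigma_hat P I X M w (b k) (W k) C D \<omega>)\<^sup>2) \<partial>P) \<le> (\<integral>\<^sup>+ \<omega>. ennreal (R \<omega>) \<partial>P)"
      by (rule nn_integral_mono_AE) (rule eventually_mono[OF AE_loc_finite], rule ennreal_leI, rule pt)
    also have "\<dots> = ennreal (bound k)" using nn_integral_eq_integral[OF iR] R0 ER by simp
    finally show ?thesis .
  qed
  have "bound \<longlonglongrightarrow> 3 * (\<sigma> - \<sigma>)\<^sup>2 + 3 * 0 + 6 * (((\<integral>u. CC.\<kappa> u \<partial>count_space UNIV) + (\<integral>u. DD.\<kappa> u \<partial>count_space UNIV)) * 0)"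
    unfolding bound_def[abs_def]
    by (intro tendsto_add tendsto_mult tendsto_const tendsto_power tendsto_diff Llim varlim Vlim
        limC[folded EC_def] limD[folded ED_def])
  then have "(\<lambda>k. ennreal (bound k)) \<longlonglongrightarrow> 0" using tendsto_ennrealI[of bound 0] by simp
  then have "(\<lambda>k. \<integral>\<^sup>+ \<omega>. ennreal ((\<sigma> - sigma_hat P I X M w (b k) (W k) C D \<omega>)\<^sup>2) \<partial>P) \<longlonglongrightarrow> 0"
    by (rule tendsto_sandwich[of "\<lambda>_. 0" _ _ "\<lambda>k. ennreal (bound k)", rotated 3]) (use le in auto)
  then show ?thesis using lim1 unfolding YY by blast
qed

end

lemma sets_closed_unit_cube: "(closed_unit_cube :: (real ^ 'd) set) \<in> sets borel" "bounded (closed_unit_cube :: (real ^ 'd) set)"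
proof -
  have eq: "(closed_unit_cube :: (real ^ 'd) set) = cbox 0 1" by (auto simp: closed_unit_cube_def mem_box_cart)
  show "(closed_unit_cube :: (real ^ 'd) set) \<in> sets borel" "bounded (closed_unit_cube :: (real ^ 'd) set)" unfolding eq by auto
qed

text \<open>
  The supremum in the inradius need not be attained, so a ball of three quarters of it is taken.
\<close>

lemma inradius_balls:
  assumes "filterlim (\<lambda>k. inradius (W k)) at_top sequentially"
  shows "eventually (\<lambda>k. 0 < inradius (W k) \<and> (\<exists>x. cball x (3 / 4 * inradius (W k)) \<subseteq> W k)) sequentially"
proof -
  \<comment> \<open>The supremum of the empty set is some fixed real, so exceeding it shows that the window contains a ball.\<close>
  have "eventually (\<lambda>k. max 1 (Sup {} + 1) \<le> inradius (W k)) sequentially"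
    using assms unfolding filterlim_at_top by blast
  then show ?thesis
  proof (rule eventually_mono)
    fix k assume k: "max 1 (Sup {} + 1) \<le> inradius (W k)"
    then have pos: "0 < inradius (W k)" by simp
    let ?R = "{r. r > 0 \<and> (\<exists>x\<in>W k. cball x r \<subseteq> W k)}"
    have "?R \<noteq> {}"
    proof
      assume R: "?R = {}"
      have "inradius (W k) = Sup {}" unfolding inradius_def R ..
      moreover have "Sup {} + 1 \<le> inradius (W k)" using k by simp
      ultimately show False by linarith
    qed
    moreover have "3 / 4 * inradius (W k) < Sup ?R" using pos unfolding inradius_def[symmetric] by simp
    ultimately obtain r where r: "r \<in> ?R" "3 / 4 * inradius (W k) < r" by (elim less_cSupE)
    then obtain x where "cball x r \<subseteq> W k" by blast
    moreover have "cball x (3 / 4 * inradius (W k)) \<subseteq> cball x r" using r(2) by (intro subset_cball) simp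
    ultimately show "0 < inradius (W k) \<and> (\<exists>x. cball x (3 / 4 * inradius (W k)) \<subseteq> W k)" using pos by blast
  qed
qed

theorem theorem3p5:
  fixes P :: "'w measure"
    and I :: "'w \<Rightarrow> nat set"
    and X :: "nat \<Rightarrow> 'w \<Rightarrow> real ^ 'd"
    and M :: "nat \<Rightarrow> 'w \<Rightarrow> 'm::polish_space"
    and W :: "nat \<Rightarrow> (real ^ 'd) set"
    and w :: "real \<Rightarrow> real" and m_w r_w :: real
    and b :: "nat \<Rightarrow> real"
    and \<delta> :: real and \<beta> :: "real \<Rightarrow> real"
    and C :: "nat \<Rightarrow> 'm set" and l i j :: nat
  assumes "prob_space P"
    and "marked_point_process P I X M"
    and "simple_mpp P I X"
    and "stationary_mpp P I X M"
    and "0 < intensity P I X M" and "intensity P I X M < \<infinity>"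
    and "convex_averaging_sequence W"
    and "\<And>x. 0 \<le> w x" and "\<And>x. w (- x) = w x" and "w \<in> borel_measurable borel"
    and "(w \<longlongrightarrow> w 0) (at 0)" and "w 0 = 1"
    and "\<And>x. w x \<le> m_w"
    and "0 < r_w" and "\<And>x. x \<notin> {- r_w..r_w} \<Longrightarrow> w x = 0"
    and "\<And>k. 0 < b k"
    and "\<And>k. b k \<le> inradius (W k) /
           (2 * real CARD('d) * r_w * measure lborel (W k) powr (1 / real CARD('d)))"
    and "b \<longlonglongrightarrow> 0"
    and "filterlim (\<lambda>k. b k ^ CARD('d) * measure lborel (W k)) at_top sequentially"
    and "(\<lambda>k. b k powr (3 * real CARD('d) / 2) * measure lborel (W k)) \<longlonglongrightarrow> 0"
    and "0 < \<delta>"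
    and "(\<integral>\<^sup>+ \<omega>. ennreal (measure (mpp I X M \<omega>) (closed_unit_cube \<times> UNIV) powr (4 + \<delta>)) \<partial>P) < \<infinity>"
    and "beta_mixing_rate P I X M \<beta>"
    and "(\<integral>\<^sup>+ r\<in>{1..}. ennreal (r ^ (CARD('d) - 1) * \<beta> r powr (\<delta> / (4 + \<delta>))) \<partial>lborel) < \<infinity>"
    and "\<And>n. n \<in> {1..l} \<Longrightarrow> C n \<in> sets borel"
    and "i \<in> {1..l}" and "j \<in> {1..l}"
  shows "\<exists>\<sigma>::real.
    (\<lambda>k. \<integral>\<omega>. Y_stat P I X M (W k) (C i) \<omega> * Y_stat P I X M (W k) (C j) \<omega> \<partial>P) \<longlonglongrightarrow> \<sigma> \<and>
    (\<lambda>k. \<integral>\<^sup>+ \<omega>. ennreal ((\<sigma> - sigma_hat P I X M w (b k) (W k) (C i) (C j) \<omega>)\<^sup>2) \<partial>P) \<longlonglongrightarrow> 0"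
proof -
  let ?d = "CARD('d)"
  have d: "1 \<le> real ?d" using zero_less_card_finite[where 'a='d] by linarith
  define K where "K = enn2real (\<integral>\<^sup>+ \<omega>. ennreal (measure (mpp I X M \<omega>) (closed_unit_cube \<times> UNIV) powr (4 + \<delta>)) \<partial>P)"
  have K: "(\<integral>\<^sup>+ \<omega>. ennreal (measure (mpp I X M \<omega>) (closed_unit_cube \<times> UNIV) powr (4 + \<delta>)) \<partial>P) = ennreal K"
    using assms(22) by (simp add: K_def)
  obtain c0 where c0: "1 \<le> c0" "\<And>a b. 1 / 2 \<le> a \<Longrightarrow> a \<le> b / c0 \<Longrightarrow>
        beta_coefficient P (sigma_algebra_on P I X M (cube a)) (sigma_algebra_on P I X M (- cube (a + b))) \<le> \<beta> b"
    using assms(23) unfolding beta_mixing_rate_def by blast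
  have lf: "AE \<omega> in P. \<forall>B. bounded B \<longrightarrow> finite (labels I X B \<omega>)"
    using assms(2) by (simp add: marked_point_process_def labels_def)
  have mom: "(\<integral>\<^sup>+\<omega>. ennreal (real (card (labels I X unit_cube \<omega>)) powr (4 + \<delta>)) \<partial>P) \<le> ennreal K"
    unfolding K[symmetric]
  proof (rule nn_integral_mono_AE, rule eventually_mono[OF lf])
    fix \<omega> assume "\<forall>B. bounded B \<longrightarrow> finite (labels I X B \<omega>)"
    then have fin: "finite (labels I X closed_unit_cube \<omega>)" using sets_closed_unit_cube(2) by blast
    have "emeasure (mpp I X M \<omega>) (closed_unit_cube \<times> UNIV) = emeasure (count_space UNIV) (labels I X closed_unit_cube \<omega>)"
      by (simp add: emeasure_mpp[OF sets_strip[OF sets_closed_unit_cube(1) space_in_borel]] labels_def)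
    then have m: "measure (mpp I X M \<omega>) (closed_unit_cube \<times> UNIV) = real (card (labels I X closed_unit_cube \<omega>))"
      using fin by (simp add: measure_def)
    have "unit_cube \<subseteq> closed_unit_cube" by (auto simp: unit_cube_def closed_unit_cube_def less_imp_le)
    then have "card (labels I X unit_cube \<omega>) \<le> card (labels I X closed_unit_cube \<omega>)"
      using fin by (intro card_mono labels_mono)
    then show "ennreal (real (card (labels I X unit_cube \<omega>)) powr (4 + \<delta>)) \<le> ennreal (measure (mpp I X M \<omega>) (closed_unit_cube \<times> UNIV) powr (4 + \<delta>))"
      unfolding m using assms(21) by (intro ennreal_leI powr_mono2) auto
  qed
  interpret prob_space P by fact
  interpret mixing_mpp P I X M \<delta> K c0 \<beta>
  proof
    show "\<beta> s \<le> \<beta> r" if "1 / 2 \<le> r" "r \<le> s" for r s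
    proof -
      have "antimono_on {1 / 2..} \<beta>" using assms(23) by (simp add: beta_mixing_rate_def)
      from monotone_onD[OF this, of r s] that show ?thesis by simp
    qed
  qed (use assms(2,4,21,23) lf mom c0 in \<open>auto simp: marked_point_process_def beta_mixing_rate_def K_def\<close>)
  \<comment> \<open>With this radius the assumption on \<open>b\<close> reads \<open>r_w a\<^sub>k \<le> 2 / (3 d) \<rho>\<^sub>k\<close>.\<close>
  define \<rho> where "\<rho> k = 3 / 4 * inradius (W k)" for k
  have rad: "filterlim (\<lambda>k. inradius (W k)) at_top sequentially" and conv: "\<And>k. convex (W k)" "\<And>k. compact (W k)"
    using assms(7) by (auto simp: convex_averaging_sequence_def)
  have \<rho>top: "filterlim \<rho> at_top sequentially"
    unfolding \<rho>_def[abs_def] by (rule filterlim_tendsto_pos_mult_at_top[OF tendsto_const _ rad]) simp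
  have "eventually (\<lambda>k. real ?d \<le> \<rho> k) sequentially" using \<rho>top unfolding filterlim_at_top by blast
  then have "eventually (\<lambda>k. real ?d \<le> \<rho> k \<and> 0 < inradius (W k) \<and> (\<exists>x. cball x (\<rho> k) \<subseteq> W k)) sequentially"
    using inradius_balls[OF rad] unfolding \<rho>_def by eventually_elim blast
  \<comment> \<open>Both limits may be taken along the windows from \<open>k0\<close> on, for which all bounds hold.\<close>
  then obtain k0 where k0: "\<And>k. k0 \<le> k \<Longrightarrow> real ?d \<le> \<rho> k \<and> 0 < inradius (W k) \<and> (\<exists>x. cball x (\<rho> k) \<subseteq> W k)"
    unfolding eventually_sequentially by blast
  have "\<exists>x. cball x (\<rho> (k + k0)) \<subseteq> W (k + k0)" for k using k0[of "k + k0"] by simp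
  then obtain x0 where x0: "\<And>k. cball (x0 k) (\<rho> (k + k0)) \<subseteq> W (k + k0)" by metis
  define V where "V k = measure lborel (W (k + k0))" for k
  have V0: "0 < V k" for k
  proof -
    have "0 < \<rho> (k + k0)" using k0[of "k + k0"] by (simp add: \<rho>_def)
    then have "0 < measure lborel (cball (x0 k) (\<rho> (k + k0)))" by (rule content_cball_pos)
    also have "\<dots> \<le> V k" unfolding V_def using conv x0
      by (intro measure_mono_fmeasurable) (auto simp: fmeasurable_compact)
    finally show ?thesis .
  qed
  define a where "a k = b (k + k0) * V k powr (1 / real ?d)" for k
  have a0: "0 < a k" for k using assms(16)[of "k + k0"] V0[of k] by (simp add: a_def)
  have Vd: "(V k powr (1 / real ?d)) ^ ?d = V k" for k
    using V0[of k] by (simp add: powr_realpow[symmetric] powr_powr)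
  have ad: "a k ^ ?d = b (k + k0) ^ ?d * V k" for k by (simp add: a_def power_mult_distrib Vd)
  have a_rho: "r_w * a k \<le> 2 / (3 * real ?d) * \<rho> (k + k0)" for k
  proof -
    let ?v = "V k powr (1 / real ?d)"
    have v: "0 < ?v" using V0[of k] by simp
    have "b (k + k0) \<le> inradius (W (k + k0)) / (2 * real ?d * r_w * ?v)" using assms(17)[of "k + k0"] by (simp add: V_def)
    then have "r_w * (b (k + k0) * ?v) \<le> r_w * (inradius (W (k + k0)) / (2 * real ?d * r_w * ?v) * ?v)"
      using v assms(14) by (intro mult_left_mono mult_right_mono) auto
    also have "\<dots> = inradius (W (k + k0)) / (2 * real ?d)" using v assms(14) by simp
    also have "\<dots> = 2 / (3 * real ?d) * \<rho> (k + k0)" by (simp add: \<rho>_def)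
    finally show ?thesis by (simp add: a_def)
  qed
  have atop: "filterlim a at_top sequentially"
    unfolding filterlim_at_top
  proof
    fix Z :: real
    have "filterlim (\<lambda>k. a k ^ ?d) at_top sequentially"
      unfolding ad V_def by (rule filterlim_compose[OF assms(19) filterlim_add_const_nat_at_top])
    then have "eventually (\<lambda>k. (max 1 Z) ^ ?d \<le> a k ^ ?d) sequentially" unfolding filterlim_at_top by blast
    then show "eventually (\<lambda>k. Z \<le> a k) sequentially"
    proof (rule eventually_mono)
      fix k assume "(max 1 Z) ^ ?d \<le> a k ^ ?d"
      then have "max 1 Z \<le> a k" using a0[of k] by (subst (asm) power_mono_iff) auto
      then show "Z \<le> a k" by simp
    qed
  qed
  have a3: "(\<lambda>k. a k ^ (3 * ?d) / V k) \<longlonglongrightarrow> 0"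
  proof -
    have "a k ^ (3 * ?d) / V k = (b (k + k0) powr (3 * real ?d / 2) * V k)\<^sup>2" for k
    proof -
      have "a k ^ (3 * ?d) = (b (k + k0) ^ ?d * V k) ^ 3" unfolding ad[symmetric] by (simp add: power_mult[symmetric] mult.commute)
      also have "\<dots> = b (k + k0) ^ (3 * ?d) * V k ^ 3" by (simp add: power_mult_distrib power_mult[symmetric] mult.commute)
      finally have "a k ^ (3 * ?d) / V k = b (k + k0) ^ (3 * ?d) * (V k)\<^sup>2"
        using V0[of k] by (simp add: power2_eq_square power3_eq_cube)
      moreover have "(b (k + k0) powr (3 * real ?d / 2))\<^sup>2 = b (k + k0) ^ (3 * ?d)"
        using assms(16)[of "k + k0"] by (simp add: powr_realpow[symmetric] powr_powr power2_eq_square powr_add[symmetric])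
      ultimately show ?thesis by (simp add: power_mult_distrib)
    qed
    moreover have "(\<lambda>k. (b (k + k0) powr (3 * real ?d / 2) * V k)\<^sup>2) \<longlonglongrightarrow> 0\<^sup>2"
      unfolding V_def by (intro tendsto_power LIMSEQ_ignore_initial_segment[OF assms(20)])
    ultimately show ?thesis by simp
  qed
  have summ: "(\<integral>\<^sup>+ r\<in>{1..}. ennreal (r ^ (CARD('d) - 1) * \<beta> r powr \<theta>) \<partial>lborel) < \<infinity>"
    using assms(24) by (simp add: \<theta>_def)
  have "\<exists>\<sigma>::real.
    (\<lambda>k. expectation (\<lambda>\<omega>. Y_stat P I X M (W (k + k0)) (C i) \<omega> * Y_stat P I X M (W (k + k0)) (C j) \<omega>)) \<longlonglongrightarrow> \<sigma> \<and>
    (\<lambda>k. \<integral>\<^sup>+ \<omega>. ennreal ((\<sigma> - sigma_hat P I X M w (b (k + k0)) (W (k + k0)) (C i) (C j) \<omega>)\<^sup>2) \<partial>P) \<longlonglongrightarrow> 0"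
  proof (rule estimator_consistent[where \<rho> = "\<lambda>k. \<rho> (k + k0)" and a = a and m_w = m_w and r_w = r_w and ?x0.0 = x0])
    show "C i \<in> sets borel" "C j \<in> sets borel" using assms(25,26,27) by auto
    show "real ?d \<le> \<rho> (k + k0)" for k using k0[of "k + k0"] by simp
    show "filterlim (\<lambda>k. \<rho> (k + k0)) at_top sequentially"
      by (rule filterlim_compose[OF \<rho>top filterlim_add_const_nat_at_top])
    show "a k = b (k + k0) * measure lborel (W (k + k0)) powr (1 / real ?d)" for k by (simp add: a_def V_def)
    show "(\<lambda>k. a k ^ (3 * ?d) / measure lborel (W (k + k0))) \<longlonglongrightarrow> 0" using a3 by (simp add: V_def)
  qed (rule assms(5) assms(6) summ conv x0 assms(8) assms(10) assms(13) assms(11) assms(12) assms(14) a0 a_rho atop | (rule assms(15), assumption))+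
  then obtain \<sigma> where "(\<lambda>k. expectation (\<lambda>\<omega>. Y_stat P I X M (W (k + k0)) (C i) \<omega> * Y_stat P I X M (W (k + k0)) (C j) \<omega>)) \<longlonglongrightarrow> \<sigma>"
    "(\<lambda>k. \<integral>\<^sup>+ \<omega>. ennreal ((\<sigma> - sigma_hat P I X M w (b (k + k0)) (W (k + k0)) (C i) (C j) \<omega>)\<^sup>2) \<partial>P) \<longlonglongrightarrow> 0" by blast
  then show ?thesis
    by (intro exI[of _ \<sigma>] conjI) (rule LIMSEQ_offset[of _ k0], assumption)+
qed

end
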